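(* Let $F$ be a field of characteristic $p>0$, let $\pi$ be an $n$-fold quasi-Pfister form over $F$, let $\sigma$ be a subform of $\pi$ which is minimal over $F$ and has $\dim\sigma\geq2$, and let $d\in F^*$ be such that the quasilinear $p$-form $\varphi\simeq\pi\perp d\sigma$ is anisotropic. Then an integer $m$ lies in $\{\dim(\varphi_E)_{an}\mid E/F\text{ a field extension}\}$ if and only if $m=p^k+\ell$ where one of the following holds: (i) $0\leq k\leq n$ and $\ell=0$; (ii) $0\leq k\leq n$ and $\max\{1,k-n+\dim\sigma\}\leq\ell\leq\min\{\dim\sigma,p^k\}$.
   Context: A quasilinear $p$-form over $F$ ($\mathrm{char}\,F=p$) is a map $\varphi:V\to F$ on a finite-dimensional $F$-vector space with $\varphi(av)=a^p\varphi(v)$, $\varphi(v+w)=\varphi(v)+\varphi(w)$; $\langle c_1,\dots,c_n\rangle$ denotes $\sum c_iX_i^p$, $\perp$ is concatenation, $c\langle c_1,\dots,c_n\rangle=\langle cc_1,\dots,cc_n\rangle$, $\langle c_i\rangle\otimes\langle d_j\rangle=\langle c_id_j\rangle_{i,j}$. Subform: injective linear map between underlying spaces compatible with the forms. Anisotropic: $\varphi(v)=0$ implies $v=0$; $\varphi\simeq\varphi_{an}\perp k\times\langle0\rangle$ with $\varphi_{an}$ anisotropic (anisotropic part). For $E/F$, $\varphi_E(e\otimes v)=e^p\varphi(v)$ on $E\otimes_FV$. An $n$-fold quasi-Pfister form is $\langle\langle a_1,\dots,a_n\rangle\rangle=\langle\langle a_1\rangle\rangle\otimes\cdots\otimes\langle\langle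 a_n\rangle\rangle$ with $\langle\langle a\rangle\rangle=\langle1,a,\dots,a^{p-1}\rangle$. With $D_F^*(\varphi)$ the set of nonzero values of $\varphi$, the norm field is $N_F(\varphi)=F^p(a/b\mid a,b\in D_F^*(\varphi))$ and the norm degree is $\mathrm{ndeg}_F\varphi=[N_F(\varphi):F^p]$. An anisotropic form $\varphi$ is minimal over $F$ if $\mathrm{ndeg}_F\varphi=p^{\dim\varphi-1}$. *)

theory Defs
  imports
    "Jordan_Normal_Form.Missing_VectorSpace"
    "HOL-Algebra.Embedded_Algebras"
    "HOL-Algebra.Generated_Fields"
    "HOL-Computational_Algebra.Primes"
begin

text \<open>
  A form is given by its underlying space \<open>V\<close> (a vector space over the field \<open>K\<close>) and by its map
  \<open>\<phi>\<close>. All fields are carrier-based, since the extension fields have to be quantified over.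
\<close>

locale quasilinear_form = vectorspace K V
  for p :: nat and K :: "('a, 'k) ring_scheme" and V :: "('a, 'v, 'm) module_scheme" +
  fixes \<phi> :: "'v \<Rightarrow> 'a"
  assumes finite_dimensional: "fin_dim"
    and form_closed: "\<phi> \<in> carrier V \<rightarrow> carrier K"
    and form_smult: "\<lbrakk>a \<in> carrier K; v \<in> carrier V\<rbrakk>
          \<Longrightarrow> \<phi> (a \<odot>\<^bsub>V\<^esub> v) = a [^]\<^bsub>K\<^esub> p \<otimes>\<^bsub>K\<^esub> \<phi> v"
    and form_add: "\<lbrakk>v \<in> carrier V; w \<in> carrier V\<rbrakk> \<Longrightarrow> \<phi> (v \<oplus>\<^bsub>V\<^esub> w) = \<phi> v \<oplus>\<^bsub>K\<^esub> \<phi> w"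

definition anisotropic ::
    "('a, 'k) ring_scheme \<Rightarrow> ('a, 'v, 'm) module_scheme \<Rightarrow> ('v \<Rightarrow> 'a) \<Rightarrow> bool" where
  "anisotropic K V \<phi> \<longleftrightarrow> (\<forall>v \<in> carrier V. \<phi> v = \<zero>\<^bsub>K\<^esub> \<longrightarrow> v = \<zero>\<^bsub>V\<^esub>)"

definition subform ::
    "('a, 'k) ring_scheme \<Rightarrow> ('a, 'v, 'm) module_scheme \<Rightarrow> ('v \<Rightarrow> 'a)
      \<Rightarrow> ('a, 'w, 'n) module_scheme \<Rightarrow> ('w \<Rightarrow> 'a) \<Rightarrow> bool" where
  "subform K V \<phi> W \<psi> \<longleftrightarrow>
     (\<exists>f \<in> LinearCombinations.module_hom K V W. inj_on f (carrier V) \<and> (\<forall>v \<in> carrier V. \<psi> (f v) = \<phi> v))"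

definition isometric ::
    "('a, 'k) ring_scheme \<Rightarrow> ('a, 'v, 'm) module_scheme \<Rightarrow> ('v \<Rightarrow> 'a)
      \<Rightarrow> ('a, 'w, 'n) module_scheme \<Rightarrow> ('w \<Rightarrow> 'a) \<Rightarrow> bool" where
  "isometric K V \<phi> W \<psi> \<longleftrightarrow>
     (\<exists>f \<in> LinearCombinations.module_hom K V W. bij_betw f (carrier V) (carrier W) \<and> (\<forall>v \<in> carrier V. \<psi> (f v) = \<phi> v))"

abbreviation coord_space :: "('a, 'k) ring_scheme \<Rightarrow> nat \<Rightarrow> ('a, nat \<Rightarrow> 'a) module" where
  "coord_space K n \<equiv> ring.func_space K {..<n}"

text \<open>The form \<open>\<langle>c\<^sub>0, \<dots>, c\<^sub>n\<^sub>-\<^sub>1\<rangle>\<close> on \<open>K\<^sup>n\<close>.\<close>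

definition diag_form :: "nat \<Rightarrow> ('a, 'k) ring_scheme \<Rightarrow> 'a list \<Rightarrow> (nat \<Rightarrow> 'a) \<Rightarrow> 'a" where
  "diag_form p K cs v = (\<Oplus>\<^bsub>K\<^esub> i \<in> {..<length cs}. cs ! i \<otimes>\<^bsub>K\<^esub> v i [^]\<^bsub>K\<^esub> p)"

text \<open>
  The orthogonal sum lives on \<open>direct_sum V W\<close>; for diagonal forms this is concatenation of the
  coefficient lists, up to isometry.
\<close>

definition perp :: "('a, 'k) ring_scheme \<Rightarrow> ('v \<Rightarrow> 'a) \<Rightarrow> ('w \<Rightarrow> 'a) \<Rightarrow> 'v \<times> 'w \<Rightarrow> 'a" where
  "perp K \<phi> \<psi> = (\<lambda>(v, w). \<phi> v \<oplus>\<^bsub>K\<^esub> \<psi> w)"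

definition tensor_coeffs :: "('a, 'k) ring_scheme \<Rightarrow> 'a list \<Rightarrow> 'a list \<Rightarrow> 'a list" where
  "tensor_coeffs K cs ds = [c \<otimes>\<^bsub>K\<^esub> d. c \<leftarrow> cs, d \<leftarrow> ds]"

primrec pfister_coeffs :: "nat \<Rightarrow> ('a, 'k) ring_scheme \<Rightarrow> 'a list \<Rightarrow> 'a list" where
  "pfister_coeffs p K [] = [\<one>\<^bsub>K\<^esub>]"
| "pfister_coeffs p K (a # as) =
     tensor_coeffs K (map (\<lambda>i. a [^]\<^bsub>K\<^esub> i) [0..<p]) (pfister_coeffs p K as)"

definition quasi_pfister ::
    "nat \<Rightarrow> ('a, 'k) ring_scheme \<Rightarrow> nat \<Rightarrow> ('a, 'v, 'm) module_scheme \<Rightarrow> ('v \<Rightarrow> 'a) \<Rightarrow> bool" where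
  "quasi_pfister p K n V \<phi> \<longleftrightarrow>
     (\<exists>as. length as = n \<and> set as \<subseteq> carrier K \<and>
        (let cs = pfister_coeffs p K as
         in isometric K V \<phi> (coord_space K (length cs)) (diag_form p K cs)))"

definition nonzero_values ::
    "('a, 'k) ring_scheme \<Rightarrow> ('a, 'v, 'm) module_scheme \<Rightarrow> ('v \<Rightarrow> 'a) \<Rightarrow> 'a set" where
  "nonzero_values K V \<phi> = \<phi> ` carrier V - {\<zero>\<^bsub>K\<^esub>}"

definition pth_powers :: "nat \<Rightarrow> ('a, 'k) ring_scheme \<Rightarrow> 'a set" where
  "pth_powers p K = (\<lambda>x. x [^]\<^bsub>K\<^esub> p) ` carrier K"

definition norm_field ::
    "nat \<Rightarrow> ('a, 'k) ring_scheme \<Rightarrow> ('a, 'v, 'm) module_scheme \<Rightarrow> ('v \<Rightarrow> 'a) \<Rightarrow> 'a set" where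
  "norm_field p K V \<phi> =
     generate_field K (pth_powers p K \<union>
       {a \<otimes>\<^bsub>K\<^esub> inv\<^bsub>K\<^esub> b | a b. a \<in> nonzero_values K V \<phi> \<and> b \<in> nonzero_values K V \<phi>})"

definition norm_degree ::
    "nat \<Rightarrow> ('a, 'k) ring_scheme \<Rightarrow> ('a, 'v, 'm) module_scheme \<Rightarrow> ('v \<Rightarrow> 'a) \<Rightarrow> nat" where
  "norm_degree p K V \<phi> = ring.dim K (pth_powers p K) (norm_field p K V \<phi>)"

text \<open>
  The condition \<open>0 < dim\<close> excludes the zero-dimensional form, whose norm degree \<open>1\<close> is
  not \<open>p\<^sup>-\<^sup>1\<close>; without it truncated subtraction would make that form minimal.
\<close>

definition minimal_form ::
    "nat \<Rightarrow> ('a, 'k) ring_scheme \<Rightarrow> ('a, 'v, 'm) module_scheme \<Rightarrow> ('v \<Rightarrow> 'a) \<Rightarrow> bool" where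
  "minimal_form p K V \<phi> \<longleftrightarrow>
     anisotropic K V \<phi> \<and> 0 < vectorspace.dim K V \<and>
     norm_degree p K V \<phi> = p ^ (vectorspace.dim K V - 1)"

text \<open>An extension \<open>E/F\<close> is a field \<open>E\<close> with an embedding \<open>h\<close> of \<open>F\<close>.\<close>

definition field_extension ::
    "('a, 'k) ring_scheme \<Rightarrow> ('e, 'l) ring_scheme \<Rightarrow> ('a \<Rightarrow> 'e) \<Rightarrow> bool" where
  "field_extension F E h \<longleftrightarrow> field F \<and> field E \<and> h \<in> ring_hom F E"

text \<open>
  The space \<open>W = E \<otimes>\<^sub>F V\<close> together with \<open>\<iota> v = 1 \<otimes> v\<close> is characterized, up to unique isomorphism,
  by \<open>\<iota>\<close> being \<open>h\<close>-semilinear and taking an \<open>F\<close>-basis of \<open>V\<close> bijectively to an \<open>E\<close>-basis of \<open>W\<close>.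
  As \<open>e \<otimes> v = e \<odot> \<iota> v\<close>, a quasilinear form \<open>\<psi>\<close> on \<open>W\<close> satisfies \<open>\<psi> (e \<otimes> v) = e\<^sup>p \<phi> v\<close> for all
  \<open>e\<close>, \<open>v\<close> iff it satisfies \<open>\<psi> (\<iota> v) = \<phi> v\<close> for all \<open>v\<close>.
\<close>

definition base_change ::
    "('a, 'k) ring_scheme \<Rightarrow> ('a, 'v, 'm) module_scheme \<Rightarrow> ('e, 'l) ring_scheme \<Rightarrow> ('a \<Rightarrow> 'e)
      \<Rightarrow> ('e, 'w, 'n) module_scheme \<Rightarrow> ('v \<Rightarrow> 'w) \<Rightarrow> bool" where
  "base_change F V E h W \<iota> \<longleftrightarrow>
     vectorspace E W \<and>
     \<iota> \<in> carrier V \<rightarrow> carrier W \<and>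
     (\<forall>v \<in> carrier V. \<forall>w \<in> carrier V. \<iota> (v \<oplus>\<^bsub>V\<^esub> w) = \<iota> v \<oplus>\<^bsub>W\<^esub> \<iota> w) \<and>
     (\<forall>a \<in> carrier F. \<forall>v \<in> carrier V. \<iota> (a \<odot>\<^bsub>V\<^esub> v) = h a \<odot>\<^bsub>W\<^esub> \<iota> v) \<and>
     (\<exists>B. finite B \<and> vectorspace.basis F V B \<and> inj_on \<iota> B \<and> vectorspace.basis E W (\<iota> ` B))"

definition scalar_extension ::
    "nat \<Rightarrow> ('a, 'k) ring_scheme \<Rightarrow> ('a, 'v, 'm) module_scheme \<Rightarrow> ('v \<Rightarrow> 'a)
      \<Rightarrow> ('e, 'l) ring_scheme \<Rightarrow> ('a \<Rightarrow> 'e) \<Rightarrow> ('e, 'w, 'n) module_scheme \<Rightarrow> ('w \<Rightarrow> 'e) \<Rightarrow> bool" where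
  "scalar_extension p F V \<phi> E h W \<psi> \<longleftrightarrow>
     quasilinear_form p E W \<psi> \<and>
     (\<exists>\<iota>. base_change F V E h W \<iota> \<and>
        (\<forall>e \<in> carrier E. \<forall>v \<in> carrier V.
           \<psi> (e \<odot>\<^bsub>W\<^esub> \<iota> v) = e [^]\<^bsub>E\<^esub> p \<otimes>\<^bsub>E\<^esub> h (\<phi> v)))"

definition anisotropic_part ::
    "nat \<Rightarrow> ('a, 'k) ring_scheme \<Rightarrow> ('a, 'v, 'm) module_scheme \<Rightarrow> ('v \<Rightarrow> 'a)
      \<Rightarrow> ('a, 'w, 'n) module_scheme \<Rightarrow> ('w \<Rightarrow> 'a) \<Rightarrow> bool" where
  "anisotropic_part p K V \<phi> A \<alpha> \<longleftrightarrow>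
     quasilinear_form p K A \<alpha> \<and> anisotropic K A \<alpha> \<and>
     (\<exists>k. isometric K V \<phi>
        (direct_sum A (coord_space K k)) (perp K \<alpha> (diag_form p K (replicate k \<zero>\<^bsub>K\<^esub>))))"

text \<open>
  The set \<open>{dim (\<phi>\<^sub>E)\<^sub>a\<^sub>n | E/F a field extension}\<close> for extension fields \<open>E\<close> with carrier in the
  type \<open>'e\<close>. Restricting the spaces over \<open>E\<close> to the type \<open>nat \<Rightarrow> 'e\<close> loses nothing, since
  every finite-dimensional space is isomorphic to some \<open>coord_space E n\<close>.

  For a field \<open>F\<close> with carrier in \<open>'a\<close> the choice \<open>'e = 'a list\<close> yields all the values: \<open>\<phi>\<^sub>E\<close> and
  \<open>\<phi>\<^sub>L\<close> have anisotropic parts of equal dimension for a suitable finitely generated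
  \<open>L \<subseteq> E\<close> over \<open>F\<close>, and \<open>L\<close> injects into \<open>'a list\<close>, whose cardinality is the maximum of that of
  \<open>'a\<close> and countable infinity.
\<close>

definition aniso_dims ::
    "'e itself \<Rightarrow> nat \<Rightarrow> ('a, 'k) ring_scheme \<Rightarrow> ('a, 'v, 'm) module_scheme \<Rightarrow> ('v \<Rightarrow> 'a) \<Rightarrow> nat set"
  where
  "aniso_dims (_ :: 'e itself) p F V \<phi> =
     {vectorspace.dim E A | (E :: 'e ring) h
        (W :: ('e, nat \<Rightarrow> 'e) module) \<psi> (A :: ('e, nat \<Rightarrow> 'e) module) \<alpha>.
        field_extension F E h \<and> scalar_extension p F V \<phi> E h W \<psi> \<and> anisotropic_part p E W \<psi> A \<alpha>}"

end

theory Submission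
  imports Defs "HOL-Algebra.Finite_Extensions" "HOL-Algebra.Weak_Morphisms"
begin

text \<open>
  A quasilinear form is semilinear with respect to the Frobenius map, so the dimension of the
  anisotropic part of \<open>\<phi>\<^sub>E\<close> is the dimension over \<open>E\<^sup>p\<close> of the \<open>E\<^sup>p\<close>-span of the values of \<open>\<phi>\<close>.
  The values of \<open>\<pi>\<close> form the field \<open>P = F\<^sup>p(a\<^sub>1, \<dots>, a\<^sub>n)\<close>, and those of \<open>\<sigma>\<close> span
  \<open>b \<langle>1, x\<^sub>1, \<dots>, x\<^sub>t\<rangle>\<close> where minimality makes the \<open>x\<^sub>i \<in> P\<close> \<open>p\<close>-independent, so that they extend to
  a \<open>p\<close>-basis of \<open>P\<close>. Over \<open>E\<close> the field \<open>P\<close> becomes \<open>Q = E\<^sup>p(a\<^sub>1, \<dots>, a\<^sub>n)\<close>, of degree \<open>p\<^sup>k\<close> over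
  \<open>E\<^sup>p\<close>, and the values of \<open>\<phi>\<close> span either \<open>Q\<close> (if \<open>d \<in> Q\<close>) or the direct sum of \<open>Q\<close> and \<open>d\<close> times
  the span of \<open>\<sigma>\<close>, of dimension \<open>l\<close>. The bound \<open>k - n + dim \<sigma> \<le> l\<close> holds because a span of
  \<open>1, x\<^sub>1, \<dots>, x\<^sub>t\<close> of dimension \<open>l\<close> generates a field of degree at most \<open>p\<^sup>l\<^sup>-\<^sup>1\<close>.

  Conversely it suffices to use purely inseparable \<open>E = L\<^sup>1\<^sup>/\<^sup>p\<close> with \<open>F\<^sup>p \<subseteq> L \<subseteq> F\<close>. Up to the Frobenius
  isomorphism this is the field \<open>L\<close> with the embedding \<open>x \<mapsto> x\<^sup>p\<close> of \<open>F\<close>, and \<open>E\<^sup>p\<close>-spans become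
  \<open>L\<close>-spans in \<open>F\<close>. The field \<open>L\<close> is generated over \<open>F\<^sup>p\<close> by differences \<open>c - m\<close>, where \<open>c\<close> runs through
  \<open>n - k\<close> members of the \<open>p\<close>-basis and \<open>m\<close> lies in the field generated by the other members.
\<close>

text \<open>The lower bound on l compares two contributions to the degree p^k of Q. The n - t
  members of the p-basis other than the x_i contribute at most p^(n - t), so the x_i contribute at
  least p^(k - n + t), and t + 1 is the dimension of \<sigma>. The converse needs a different L in
  each case. For l = 0 the element d must be absorbed, so it becomes a generator of L itself;
  anisotropy makes it p-independent of the p-basis. For l > 0 the field L stays inside P, and
  anisotropy keeps d out of P. The obstacle there is to control two numbers at once, the degree of P
  over L and the dimension of the span of \<sigma>. If k < l - 1, the free generators are too few to
  reach dimension l, and the elements m supply independent members of the field that they generate;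
  this is where l \<le> p^k enters. The degree is undisturbed, since each c is recovered from c - m
  and the free generators. The necessary conditions hold for extensions with carrier in any type,
  and all values that they allow are attained by fields between F^p and F, so extensions of large
  cardinality give nothing new.\<close>

hide_const (open) Divisibility.prime

section \<open>The Frobenius map and simple extensions\<close>

lemma (in cring) binomial_expansion:
  assumes x: "x \<in> carrier R" and y: "y \<in> carrier R"
  shows "(x \<oplus> y) [^] n = (\<Oplus>k\<in>{..n}. [(n choose k)] \<cdot> (x [^] k \<otimes> y [^] (n - k)))"
proof (induction n)
  case 0 then show ?case using x y by simp
next
  case (Suc n)
  let ?t = "\<lambda>n k. [(n choose k)] \<cdot> (x [^] k \<otimes> y [^] (n - k))"
  have cl: "?t m k \<in> carrier R" for m k using x y by simp
  have ty: "(\<Oplus>k\<in>{..n}. ?t n k) \<otimes> y = (\<Oplus>k\<in>{..n}. [(n choose k)] \<cdot> (x [^] k \<otimes> y [^] (Suc n - k)))"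
    using x y by (subst finsum_ldistr) (auto intro!: finsum_cong' simp: add_pow_ldistr m_assoc Suc_diff_le)
  have tx: "(\<Oplus>k\<in>{..n}. ?t n k) \<otimes> x = (\<Oplus>k\<in>{..n}. [(n choose k)] \<cdot> (x [^] Suc k \<otimes> y [^] (n - k)))"
    using x y by (subst finsum_ldistr) (auto intro!: finsum_cong' simp: add_pow_ldistr add_pow_rdistr m_ac)
  have "(\<Oplus>k\<in>{..Suc n}. ?t (Suc n) k) = (\<Oplus>k\<in>{..n}. ?t (Suc n) (Suc k)) \<oplus> ?t (Suc n) 0"
    by (rule finsum_Suc2) (use cl in auto)
  also have "(\<Oplus>k\<in>{..n}. ?t (Suc n) (Suc k))
     = (\<Oplus>k\<in>{..n}. [(n choose k)] \<cdot> (x [^] Suc k \<otimes> y [^] (n - k)) \<oplus> [(n choose Suc k)] \<cdot> (x [^] Suc k \<otimes> y [^] (n - k)))"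
    using x y by (intro finsum_cong') (auto simp: add.nat_pow_mult)
  also have "\<dots> = (\<Oplus>k\<in>{..n}. [(n choose k)] \<cdot> (x [^] Suc k \<otimes> y [^] (n - k)))
      \<oplus> (\<Oplus>k\<in>{..n}. [(n choose Suc k)] \<cdot> (x [^] Suc k \<otimes> y [^] (n - k)))"
    using x y by (intro finsum_addf) auto
  finally have s: "(\<Oplus>k\<in>{..Suc n}. ?t (Suc n) k) = (\<Oplus>k\<in>{..n}. ?t n k) \<otimes> x
      \<oplus> ((\<Oplus>k\<in>{..n}. [(n choose Suc k)] \<cdot> (x [^] Suc k \<otimes> y [^] (n - k))) \<oplus> ?t (Suc n) 0)"
    unfolding tx using x y by (simp add: a_assoc)
  \<comment> \<open>The product of the sum with \<open>y\<close> is split off at either end. Its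
    term at \<open>Suc n\<close> vanishes with the binomial coefficient, so shifting the index and
    restoring the term at 0 loses nothing.\<close>
  let ?u = "\<lambda>k. [(n choose k)] \<cdot> (x [^] k \<otimes> y [^] (Suc n - k))"
  have "(\<Oplus>k\<in>{..Suc n}. ?u k) = (\<Oplus>k\<in>{..n}. ?u (Suc k)) \<oplus> ?u 0"
    by (rule finsum_Suc2) (use x y in auto)
  moreover have "(\<Oplus>k\<in>{..Suc n}. ?u k) = ?u (Suc n) \<oplus> (\<Oplus>k\<in>{..n}. ?u k)"
    by (rule finsum_Suc) (use x y in auto)
  ultimately have "(\<Oplus>k\<in>{..n}. ?u (Suc k)) \<oplus> ?u 0 = (\<Oplus>k\<in>{..n}. ?u k)"
    using x y by (simp add: binomial_eq_0)
  with s ty have "(\<Oplus>k\<in>{..Suc n}. ?t (Suc n) k)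
      = (\<Oplus>k\<in>{..n}. ?t n k) \<otimes> x \<oplus> (\<Oplus>k\<in>{..n}. ?t n k) \<otimes> y"
    by simp
  also have "\<dots> = (\<Oplus>k\<in>{..n}. ?t n k) \<otimes> (x \<oplus> y)"
    using x y cl by (simp add: r_distr)
  finally show ?case using Suc.IH by simp
qed

lemma (in domain) nat_pow_eq_zero:
  assumes "x \<in> carrier R" "x [^] (n::nat) = \<zero>" shows "x = \<zero>"
  using assms(2) by (induction n) (auto simp: integral_iff assms(1))

text \<open>Commutative rings are the right generality because the lemma is applied to the
  polynomial ring as well as to the field: this is how (X - x)^p is computed. Only the two outer
  terms survive, as p divides the other binomial coefficients.\<close>

lemma (in cring) frobenius_add:
  fixes p :: nat
  assumes p: "prime p" "[p] \<cdot> \<one> = \<zero>" and x: "x \<in> carrier R" and y: "y \<in> carrier R"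
  shows "(x \<oplus> y) [^] p = x [^] p \<oplus> y [^] p"
proof -
  let ?t = "\<lambda>k. [(p choose k)] \<cdot> (x [^] k \<otimes> y [^] (p - k))"
  have pz: "[(p * m)] \<cdot> z = \<zero>" if "z \<in> carrier R" for z and m :: nat
  proof -
    have "[p] \<cdot> z = \<zero>" using add_pow_ldistr[of \<one> z p] p(2) that by simp
    then show ?thesis using that by (metis add.nat_pow_one add.nat_pow_pow)
  qed
  have mid: "?t k = \<zero>" if k: "0 < k" "k < p" for k
  proof -
    obtain m where "p choose k = p * m"
      using dvd_choose_prime[of k p] k p(1) unfolding dvd_def by auto
    then show ?thesis using pz x y by simp
  qed
  obtain q where q: "p = Suc q" using prime_gt_0_nat[OF p(1)] gr0_implies_Suc by blast
  have "(\<Oplus>k\<in>{..p}. ?t k) = ?t p \<oplus> (\<Oplus>k\<in>{..q}. ?t k)"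
    unfolding q by (rule finsum_Suc) (use x y in auto)
  also have "(\<Oplus>k\<in>{..q}. ?t k) = (\<Oplus>k\<in>{..q}. if k = 0 then y [^] p else \<zero>)"
  proof (rule finsum_cong')
    fix k assume "k \<in> {..q}"
    then show "?t k = (if k = 0 then y [^] p else \<zero>)" using mid[of k] q x y by auto
  qed (use y in auto)
  also have "\<dots> = y [^] p"
    using finsum_singleton[of 0 "{..q}" "\<lambda>k. y [^] p"] y by (simp add: eq_commute)
  finally show ?thesis
    unfolding binomial_expansion[OF x y, of p] using x y by simp
qed

locale char_p_field = field R for R (structure) +
  fixes p :: nat
  assumes prime_p: "prime p" and char_p: "[p] \<cdot> \<one> = \<zero>"
begin

declare Span.simps [simp del] and finite_extension.simps [simp del]

text \<open>Recursion on the list takes the place of unfolding to folds. The head of a list is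
  adjoined last, so \<open>ys @ xs\<close> stands for the tower that adjoins \<open>xs\<close>
  before \<open>ys\<close>.\<close>

lemma Span_list [simp]:
  "Span K [] = {\<zero>}" "Span K (u # us) = line_extension K u (Span K us)"
  by (simp_all add: Span.simps)

lemma finite_extension_list [simp]:
  "finite_extension K [] = K"
  "finite_extension K (x # xs) = simple_extension (finite_extension K xs) x"
  by (simp_all add: finite_extension.simps)

lemmas frob_add = frobenius_add[OF prime_p char_p]

lemma frob_inj:
  assumes x: "x \<in> carrier R" and y: "y \<in> carrier R" and "x [^] p = y [^] p"
  shows "x = y"
proof -
  have "(x \<ominus> y) [^] p \<oplus> y [^] p = x [^] p"
    using frob_add[of "x \<ominus> y" y] x y by (simp add: minus_eq a_assoc l_neg)
  with assms have "(x \<ominus> y) [^] p = \<zero>"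
    by (simp add: add.r_cancel_one)
  then have "x \<ominus> y = \<zero>"
    using nat_pow_eq_zero[of "x \<ominus> y" p] x y by simp
  then show ?thesis using x y by simp
qed

lemma frob_ring_hom: "(\<lambda>x. x [^] p) \<in> ring_hom R R"
  by (auto intro!: ring_hom_memI simp: frob_add nat_pow_distrib)

sublocale frob: ring_hom_ring R R "\<lambda>x. x [^] p"
  using ring_hom_ringI2[OF ring_axioms ring_axioms frob_ring_hom] .

lemma pth_powers_subfield: "subfield (pth_powers p R) R"
  using frob.img_is_subfield(2)[OF carrier_is_subfield] unfolding pth_powers_def by simp


text \<open>These are the fields between R^p and R. Over such a field every element is a p-th root
  of a scalar, so finitely generated extensions are purely inseparable and their degrees are powers
  of p.\<close>

definition pbase :: "'a set \<Rightarrow> bool" where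
  "pbase K \<longleftrightarrow> subfield K R \<and> pth_powers p R \<subseteq> K"

lemma pbaseD:
  assumes "pbase K"
  shows "subfield K R" and "subring K R" and "K \<subseteq> carrier R" and "\<And>x. x \<in> carrier R \<Longrightarrow> x [^] p \<in> K"
  using assms subfieldE(1,3)[of K] unfolding pbase_def pth_powers_def by auto

lemma pbase_pth_powers: "pbase (pth_powers p R)"
  using pth_powers_subfield unfolding pbase_def by simp

section \<open>Minimal polynomials over fields containing the p-th powers\<close>

lemma coprime_power_mem:
  assumes K: "subfield K R" and x: "x \<in> carrier R" and "coprime e p" and "x [^] e \<in> K" and "x [^] p \<in> K"
  shows "x \<in> K"
proof (cases "x = \<zero> \<or> e = 0")
  case True
  then show ?thesis
  proof
    assume "e = 0"
    with assms have "p = 1" by simp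
    then show ?thesis using prime_p by simp
  qed (use subringE(2)[OF subfieldE(1)[OF K]] in simp)
next
  case False
  \<comment> \<open>Bezout writes \<open>x\<close> as the quotient of a power of x^e by a power of
    x^p, and both lie in \<open>K\<close>.\<close>
  then obtain u v where uv: "e * u = p * v + 1"
    using bezout_nat[of e p] \<open>coprime e p\<close> by (auto simp: coprime_iff_gcd_eq_1)
  have powK: "y [^] (m::nat) \<in> K" if "y \<in> K" for y m
    using that by (induction m) (auto simp: subringE(3,6)[OF subfieldE(1)[OF K]])
  have "x [^] (e * u) \<in> K" "x [^] (p * v) \<in> K"
    using powK[OF assms(4), of u] powK[OF assms(5), of v] x by (auto simp: nat_pow_pow)
  moreover have "x [^] (p * v) \<noteq> \<zero>" using nat_pow_eq_zero[OF x] False by blast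
  moreover have "x = x [^] (e * u) \<otimes> inv (x [^] (p * v))"
  proof -
    have "x [^] (e * u) = x \<otimes> x [^] (p * v)" using x uv by (simp add: m_comm)
    then show ?thesis using x \<open>x [^] (p * v) \<noteq> \<zero>\<close> by (simp add: m_assoc field_Units)
  qed
  ultimately show ?thesis
    using subfield_m_inv(1)[OF K, of "x [^] (p * v)"] subringE(6)[OF subfieldE(1)[OF K]]
    by (metis DiffD1 DiffI singletonD)
qed

text \<open>In characteristic p the polynomial (X - x)^p is X^p + (-x)^p, and p-th powers are
  scalars. The minimal polynomial of \<open>x\<close> over \<open>K\<close> will be a divisor of
  it.\<close>

lemma linear_power_mem:
  assumes K: "pbase K" and x: "x \<in> carrier R"
  shows "[\<one>, \<ominus> x] [^]\<^bsub>poly_ring R\<^esub> p \<in> carrier (K[X])"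
proof -
  interpret UP: domain "poly_ring R"
    using univ_poly_is_domain[OF carrier_is_subring] .
  have hom: "poly_of_const \<in> ring_hom R (poly_ring R)"
    using canonical_embedding_is_hom[OF carrier_is_subring] by simp
  interpret c: ring_hom_ring R "poly_ring R" poly_of_const
    using ring_hom_ringI2[OF ring_axioms UP.ring_axioms hom] .
  have "[n] \<cdot>\<^bsub>poly_ring R\<^esub> \<one>\<^bsub>poly_ring R\<^esub> = poly_of_const ([n] \<cdot> \<one>)" for n :: nat
    by (induction n) simp_all
  then have char: "[p] \<cdot>\<^bsub>poly_ring R\<^esub> \<one>\<^bsub>poly_ring R\<^esub> = \<zero>\<^bsub>poly_ring R\<^esub>"
    using char_p by simp
  have X: "X \<in> carrier (poly_ring R)" using var_closed(1)[OF carrier_is_subring] .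
  have "[\<one>, \<ominus> x] = X \<oplus>\<^bsub>poly_ring R\<^esub> poly_of_const (\<ominus> x)"
    using x by (simp add: univ_poly_add var_def poly_of_const_def)
  then have "[\<one>, \<ominus> x] [^]\<^bsub>poly_ring R\<^esub> p
      = X [^]\<^bsub>poly_ring R\<^esub> p \<oplus>\<^bsub>poly_ring R\<^esub> poly_of_const ((\<ominus> x) [^] p)"
    using UP.frobenius_add[OF prime_p char X, of "poly_of_const (\<ominus> x)"] x
      c.hom_nat_pow[of "\<ominus> x" p] by (metis c.hom_closed a_inv_closed)
  also have "X [^]\<^bsub>poly_ring R\<^esub> p = X [^]\<^bsub>K[X]\<^esub> p"
    by (simp add: nat_pow_def univ_poly_mult univ_poly_one)
  finally have eq: "[\<one>, \<ominus> x] [^]\<^bsub>poly_ring R\<^esub> p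
      = X [^]\<^bsub>K[X]\<^esub> p \<oplus>\<^bsub>K[X]\<^esub> poly_of_const ((\<ominus> x) [^] p)"
    by (simp add: univ_poly_add)
  have "poly_of_const ((\<ominus> x) [^] p) \<in> carrier (K[X])"
    using ring_hom_closed[OF canonical_embedding_is_hom[OF pbaseD(2)[OF K]]] pbaseD(4)[OF K, of "\<ominus> x"] x
    by (metis a_inv_closed partial_object.select_convs(1) partial_object.surjective partial_object.update_convs(1))
  then show ?thesis
    unfolding eq using var_pow_closed[OF pbaseD(2)[OF K]] univ_poly_is_ring[OF pbaseD(2)[OF K]]
    by (intro ring.ring_simprules(1)) auto
qed

lemma linear_power_lead_coeff:
  assumes x: "x \<in> carrier R"
  shows "lead_coeff ([\<one>, \<ominus> x] [^]\<^bsub>poly_ring R\<^esub> (n::nat)) = \<one>"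
proof -
  interpret UP: domain "poly_ring R"
    using univ_poly_is_domain[OF carrier_is_subring] .
  have l: "[\<one>, \<ominus> x] \<in> carrier (poly_ring R)"
    using x unfolding sym[OF univ_poly_carrier] polynomial_def by simp
  show ?thesis
  proof (induction n)
    case 0 show ?case by (simp add: univ_poly_one)
  next
    case (Suc n)
    have "[\<one>, \<ominus> x] [^]\<^bsub>poly_ring R\<^esub> n \<noteq> []"
      using polynomial_pow_not_zero[OF l] by simp
    then show ?case
      using poly_mult_lead_coeff[OF carrier_is_subring, of "[\<one>, \<ominus> x] [^]\<^bsub>poly_ring R\<^esub> n" "[\<one>, \<ominus> x]"] l Suc
      by (simp add: univ_poly_mult univ_poly_carrier)
  qed
qed

lemma linear_power_eval:
  assumes "x \<in> carrier R" "y \<in> carrier R"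
  shows "eval ([\<one>, \<ominus> x] [^]\<^bsub>poly_ring R\<^esub> (n::nat)) y = (y \<ominus> x) [^] n"
proof -
  interpret ev: ring_hom_ring "poly_ring R" R "\<lambda>q. eval q y"
    using eval_ring_hom[OF carrier_is_subring assms(2)] .
  have l: "[\<one>, \<ominus> x] \<in> carrier (poly_ring R)"
    using assms unfolding sym[OF univ_poly_carrier] polynomial_def by simp
  show ?thesis using ev.hom_nat_pow[OF l] assms by (simp add: minus_eq)
qed

lemma pbase_algebraic:
  assumes K: "pbase K" and x: "x \<in> carrier R"
  shows "(algebraic over K) x"
proof -
  have l: "[\<one>, \<ominus> x] \<in> carrier (poly_ring R)"
    using x unfolding sym[OF univ_poly_carrier] polynomial_def by simp
  show ?thesis
    using algebraicI[OF linear_power_mem[OF K x]] polynomial_pow_not_zero[OF l, of p]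
      linear_power_eval[OF x x, of p] x prime_gt_0_nat[OF prime_p] by (simp add: nat_pow_zero minus_eq r_neg)
qed

text \<open>
  The minimal polynomial divides \<open>(X - x)\<^sup>p\<close>, hence is \<open>(X - x)\<^sup>e\<close>; its constant coefficient then
  shows that \<open>x\<^sup>e\<close> lies in \<open>K\<close>, which forces \<open>x \<in> K\<close> if \<open>0 < e < p\<close>.
\<close>

lemma degree_Irr:
  assumes K: "pbase K" and x: "x \<in> carrier R" and "x \<notin> K"
  shows "degree (Irr K x) = p"
proof -
  define f where "f = Irr K x"
  define e where "e = degree f"
  define q where "q = [\<one>, \<ominus> x] [^]\<^bsub>poly_ring R\<^esub> p"
  interpret UP: domain "poly_ring R"
    using univ_poly_is_domain[OF carrier_is_subring] .
  note alg = pbase_algebraic[OF K x]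
  note irr = IrrE[OF pbaseD(1)[OF K] x alg, folded f_def]
  have l: "[\<one>, \<ominus> x] \<in> carrier (poly_ring R)"
    using x unfolding sym[OF univ_poly_carrier] polynomial_def by simp
  have fR: "f \<in> carrier (poly_ring R)"
    using irr(1) pbaseD(3)[OF K] unfolding sym[OF univ_poly_carrier] polynomial_def by auto
  have e0: "0 < e"
    using pirreducible_degree[OF pbaseD(1)[OF K] irr(1,2)] unfolding e_def by simp
  then have f0: "f \<noteq> []" unfolding e_def by auto
  have qR: "q \<in> carrier (poly_ring R)" unfolding q_def using l by simp
  have q0: "q \<noteq> []" unfolding q_def using polynomial_pow_not_zero[OF l] by simp
  have degq: "degree q = p" unfolding q_def using polynomial_pow_degree[OF l] by simp
  have "eval q x = \<zero>"
    unfolding q_def using linear_power_eval[OF x x, of p] x prime_gt_0_nat[OF prime_p] by (simp add: nat_pow_zero minus_eq r_neg)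
  then have fq: "f pdivides q"
    using Irr_minimal[OF pbaseD(1)[OF K] x alg] linear_power_mem[OF K x] unfolding f_def q_def by simp
  then have ep: "e \<le> p"
    using pdivides_imp_degree_le[OF carrier_is_subring fR qR q0] degq unfolding e_def by simp
  \<comment> \<open>The polynomial \<open>q\<close> has degree p and the root \<open>x\<close> with
    multiplicity p, so it splits with no other root. Both properties pass to its divisor
    \<open>f\<close>, which is therefore a power of X - x times a constant.\<close>
  have "p \<le> alg_mult q x"
    using alg_multE(2)[OF x qR q0, of p, folded q_def] polynomial_pow_division[OF qR, of 1 1] qR by simp
  then have sub: "replicate_mset p x \<subseteq># roots q"
    using alg_mult_eq_count_roots[OF qR] by (simp add: count_le_replicate_mset_subset_eq)
  moreover have "size (roots q) \<le> p" using size_roots_le_degree[OF qR] degq by simp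
  ultimately have rq: "roots q = replicate_mset p x"
    by (metis mset_subset_size not_le size_replicate_mset subset_mset.le_neq_trans)
  then have "splitted q" unfolding splitted_def degq by simp
  then have "splitted f" using pdivides_imp_splitted[OF fR qR q0 _ fq] by simp
  moreover obtain m where m: "roots f = replicate_mset m x"
    using pdivides_imp_roots_incl[OF fR qR q0 fq] unfolding rq by (auto elim: msubseteq_replicate_msetE)
  ultimately have "roots f = replicate_mset e x" unfolding splitted_def e_def by simp
  then have "alg_mult f x = e" using alg_mult_eq_count_roots[OF fR] by simp
  then have "([\<one>, \<ominus> x] [^]\<^bsub>poly_ring R\<^esub> e) pdivides f"
    using alg_multE(1)[OF x fR f0] by simp
  then obtain g where g: "g \<in> carrier (poly_ring R)" "f = ([\<one>, \<ominus> x] [^]\<^bsub>poly_ring R\<^esub> e) \<otimes>\<^bsub>poly_ring R\<^esub> g"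
    unfolding pdivides_def by auto
  have le: "[\<one>, \<ominus> x] [^]\<^bsub>poly_ring R\<^esub> e \<in> carrier (poly_ring R)" "[\<one>, \<ominus> x] [^]\<^bsub>poly_ring R\<^esub> e \<noteq> []"
    using l polynomial_pow_not_zero[OF l] by auto
  have g0: "g \<noteq> []"
    using f0 g(2) UP.r_null[OF le(1)] by (auto simp: univ_poly_zero)
  have "degree f = e + degree g"
    using poly_mult_degree_eq[OF carrier_is_subring, of "[\<one>, \<ominus> x] [^]\<^bsub>poly_ring R\<^esub> e" g] le g g0
      polynomial_pow_degree[OF l, of e]
    by (simp add: univ_poly_carrier univ_poly_mult)
  then have "degree g = 0" unfolding e_def by simp
  then obtain c where c: "g = [c]" using g0 by (cases g) auto
  then have cR: "c \<in> carrier R" using g(1) unfolding sym[OF univ_poly_carrier] polynomial_def by simp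
  \<comment> \<open>Both \<open>f\<close> and the power of X - x are monic, so the constant cofactor
    is 1.\<close>
  have "\<one> = \<one> \<otimes> c"
    using poly_mult_lead_coeff[OF carrier_is_subring, of "[\<one>, \<ominus> x] [^]\<^bsub>poly_ring R\<^esub> e" g] le g g0 c
      linear_power_lead_coeff[OF x, of e] irr(3) by (simp add: univ_poly_carrier univ_poly_mult)
  then have c1: "c = \<one>" using cR by simp
  \<comment> \<open>Evaluation at 0 reads off the constant coefficient. It lies in \<open>K\<close>
    because adjoining 0 to \<open>K\<close> gives nothing new.\<close>
  interpret ev: ring_hom_ring "poly_ring R" R "\<lambda>q. eval q \<zero>"
    using eval_ring_hom[OF carrier_is_subring zero_closed] .
  have "eval f \<zero> = (\<ominus> x) [^] e"
    using ev.hom_mult[OF le(1) g(1)] linear_power_eval[OF x zero_closed, of e] g(2) c c1 x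
    by (simp add: minus_eq)
  moreover have "eval f \<zero> \<in> simple_extension K \<zero>"
    using simple_extension_as_eval_img[OF pbaseD(3)[OF K] zero_closed] irr(1) by auto
  then have "eval f \<zero> \<in> K"
    using simple_extension_subring_incl[OF pbaseD(2)[OF K] subset_refl, of \<zero>] subringE(2)[OF pbaseD(2)[OF K]] by auto
  ultimately have mem: "(\<ominus> x) [^] e \<in> K" by simp
  have "e = p"
  proof (rule ccontr)
    assume "e \<noteq> p"
    then have "coprime e p"
      using prime_imp_coprime[OF prime_p, of e] e0 ep nat_dvd_not_less[of e p] by (simp add: coprime_commute)
    then have "\<ominus> x \<in> K"
      using coprime_power_mem[OF pbaseD(1)[OF K] a_inv_closed[OF x] _ mem pbaseD(4)[OF K a_inv_closed[OF x]]] by simp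
    then show False
      using subringE(5)[OF pbaseD(2)[OF K], of "\<ominus> x"] x \<open>x \<notin> K\<close> by simp
  qed
  then show ?thesis unfolding e_def f_def .
qed

section \<open>Degrees of finitely generated extensions\<close>

lemma simple_extension_absorb: "pbase K \<Longrightarrow> x \<in> K \<Longrightarrow> simple_extension K x = K"
  using simple_extension_subring_incl[OF pbaseD(2) subset_refl] simple_extension_incl[OF pbaseD(3)] pbaseD(3)
  by (metis subset_antisym subsetD)

lemma dimension_simple_extension_p:
  assumes "pbase K" "x \<in> carrier R" "x \<notin> K"
  shows "dimension p K (simple_extension K x)"
  using dimension_simple_extension[OF pbaseD(1) _ pbase_algebraic] degree_Irr assms by metis

lemma pbase_simple_extension:
  assumes "pbase K" "x \<in> carrier R"
  shows "pbase (simple_extension K x)"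
  using simple_extension_is_subfield[OF pbaseD(1)] pbase_algebraic simple_extension_incl[OF pbaseD(3)] assms
  unfolding pbase_def by blast

lemma pbase_finite_extension:
  assumes "pbase K" "set xs \<subseteq> carrier R"
  shows "pbase (finite_extension K xs)"
  using assms(2) by (induction xs) (auto simp: assms(1) pbase_simple_extension)

lemma finite_extension_base_incl:
  assumes "pbase K" "set xs \<subseteq> carrier R"
  shows "K \<subseteq> finite_extension K xs"
  using finite_extension_incl[OF pbaseD(3)] assms by blast

lemma finite_extension_subset:
  assumes "pbase L" "K \<subseteq> L" "set xs \<subseteq> L"
  shows "finite_extension K xs \<subseteq> L"
  using finite_extension_subring_incl[OF pbaseD(2)] assms by blast

lemma finite_extension_append:
  "finite_extension K (ys @ xs) = finite_extension (finite_extension K xs) ys"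
  by (simp add: finite_extension.simps)

text \<open>Each generator multiplies the degree by 1 or by p, according to whether it lies in the
  field generated so far.\<close>

lemma dimension_finite_extension:
  assumes K: "pbase K" and "set xs \<subseteq> carrier R"
  shows "\<exists>k \<le> length xs. dimension (p ^ k) K (finite_extension K xs)"
  using assms(2)
proof (induction xs)
  case Nil
  then show ?case using dimension_one[OF pbaseD(1)[OF K]] by (intro exI[of _ 0]) simp
next
  case (Cons x xs)
  then obtain k where k: "k \<le> length xs" "dimension (p ^ k) K (finite_extension K xs)" by auto
  have L: "pbase (finite_extension K xs)" using pbase_finite_extension[OF K] Cons by simp
  show ?case
  proof (cases "x \<in> finite_extension K xs")
    case True
    then show ?thesis using simple_extension_absorb[OF L] k by (auto intro!: exI[of _ k])
  next
    case False
    then have "dimension p (finite_extension K xs) (simple_extension (finite_extension K xs) x)"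
      using dimension_simple_extension_p[OF L] Cons by simp
    then have "dimension (p ^ k * p) K (finite_extension K (x # xs))"
      using telescopic_base[OF pbaseD(1)[OF K] pbaseD(1)[OF L] k(2)] by simp
    then show ?thesis using k(1) by (intro exI[of _ "Suc k"]) (simp add: mult.commute)
  qed
qed

end

section \<open>Spans and degrees of purely inseparable extensions\<close>

context char_p_field
begin

section \<open>Linear spans and change of the base field\<close>

lemma Span_mono_field:
  assumes "K \<subseteq> L" "us = vs"
  shows "Span K us \<subseteq> Span L vs"
  using assms(2)
proof (induction us arbitrary: vs)
  case (Cons u us)
  then show ?case using assms(1) by (auto simp: line_extension_mem_iff) blast
qed simp

lemma Span_subset_subring:
  assumes L: "subring L R" and "K \<subseteq> L" "set us \<subseteq> L"
  shows "Span K us \<subseteq> L"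
  using assms(3)
proof (induction us)
  case Nil show ?case using subringE(2)[OF L] by simp
next
  case (Cons u us)
  have "k \<otimes> u \<oplus> v \<in> L" if "k \<in> K" "v \<in> Span K us" for k v
    using that Cons assms(2) by (intro subringE(6,7)[OF L]) auto
  then show ?case by (auto simp: line_extension_mem_iff)
qed

lemma Span_eq_mono:
  assumes "subfield K R" "subfield L R" "K \<subseteq> L" "set us \<subseteq> carrier R" "set vs \<subseteq> carrier R"
    and "Span K us \<subseteq> Span K vs"
  shows "Span L us \<subseteq> Span L vs"
proof -
  have "set us \<subseteq> Span K us" using Span_base_incl assms by blast
  also have "\<dots> \<subseteq> Span L vs" using assms(6) Span_mono_field[OF assms(3), of vs] by blast
  finally show ?thesis using mono_Span_subset assms by blast
qed

lemma spanning_sublist: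
  assumes K: "subfield K R" and "set us \<subseteq> carrier R"
  shows "\<exists>ws. set ws \<subseteq> set us \<and> independent K ws \<and> Span K ws = Span K us"
  using assms(2)
proof (induction us)
  case (Cons u us)
  then obtain ws where ws: "set ws \<subseteq> set us" "independent K ws" "Span K ws = Span K us" by auto
  show ?case
  proof (cases "u \<in> Span K us")
    case True
    have "Span K (u # us) = Span K us"
      using True mono_Span_subset[OF K, of "u # us" us] Span_base_incl[OF K, of us] mono_Span[OF K, of us u] Cons.prems
      by (metis insert_subset list.simps(15) subset_antisym)
    then show ?thesis using ws by auto
  next
    case False
    then have "independent K (u # ws)" using ws Cons.prems by (auto intro: li_Cons)
    then show ?thesis using ws by (intro exI[of _ "u # ws"]) auto
  qed
qed auto

text \<open>An independent list drawn from \<open>us\<close> with the same span has the same length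
  as \<open>us\<close>. Being distinct, it exhausts \<open>us\<close> and is a permutation of
  it.\<close>

lemma independent_if_spanning:
  assumes K: "subfield K R" and us: "set us \<subseteq> carrier R"
    and "Span K us = E" "dimension (length us) K E"
  shows "independent K us"
proof -
  obtain ws where ws: "set ws \<subseteq> set us" "independent K ws" "Span K ws = Span K us"
    using spanning_sublist[OF K us] by blast
  have l: "length ws = length us"
    using dimension_is_inj[OF K dimension_independent[OF ws(2)]] ws(3) assms(3,4) by simp
  have "distinct ws" using independent_distinct[OF K ws(2)] .
  then have "set ws = set us"
    using ws(1) l card_length[of us] distinct_card[of ws] card_seteq[of "set us" "set ws"] by simp
  then show ?thesis using independent_same_set[OF K, of ws us] l ws(2) by simp
qed

text \<open>Multiplication by \<open>x\<close> is linear, so its effect on a span can be tested on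
  generators. Used to show that the span of Pfister coefficients is closed under multiplication by
  the first generator.\<close>

lemma Span_mult_subset:
  assumes K: "subfield K R" and us: "set us \<subseteq> carrier R" and ws: "set ws \<subseteq> carrier R" and x: "x \<in> carrier R"
    and "\<And>u. u \<in> set us \<Longrightarrow> u \<otimes> x \<in> Span K ws" and "v \<in> Span K us"
  shows "v \<otimes> x \<in> Span K ws"
  using us assms(5,6)
proof (induction us arbitrary: v)
  case Nil
  then show ?case using x Span_subgroup_props(2)[OF K ws] by simp
next
  case (Cons u us)
  then obtain k w where kw: "k \<in> K" "w \<in> Span K us" "v = k \<otimes> u \<oplus> w"
    by (auto simp: line_extension_mem_iff)
  have c: "k \<in> carrier R" "w \<in> carrier R" "u \<in> carrier R"
    using kw subfieldE(3)[OF K] Span_in_carrier[of K us] Cons.prems(1) by auto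
  have "v \<otimes> x = k \<otimes> (u \<otimes> x) \<oplus> w \<otimes> x" using kw(3) c x by (simp add: l_distr m_assoc)
  moreover have "k \<otimes> (u \<otimes> x) \<in> Span K ws"
    using Span_smult_closed[OF K ws kw(1)] Cons.prems(2) by simp
  moreover have "w \<otimes> x \<in> Span K ws" using Cons kw(2) by simp
  ultimately show ?case using Span_subgroup_props(3)[OF K ws] by simp
qed

section \<open>Pfister coefficients as generators of a field\<close>

lemma set_pfister_Cons:
  "set (pfister_coeffs p R (a # as)) = {a [^] i \<otimes> c | i c. i < p \<and> c \<in> set (pfister_coeffs p R as)}"
proof -
  have "set (pfister_coeffs p R (a # as)) = (\<Union>i\<in>{..<p}. (\<lambda>c. a [^] i \<otimes> c) ` set (pfister_coeffs p R as))"
    by (auto simp: tensor_coeffs_def)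
  then show ?thesis by blast
qed

lemma pfister_coeffs_in_carrier:
  "set as \<subseteq> carrier R \<Longrightarrow> set (pfister_coeffs p R as) \<subseteq> carrier R"
proof (induction as)
  case (Cons a as)
  then show ?case unfolding set_pfister_Cons by auto
qed simp

lemma pfister_coeffs_in_extension:
  assumes K: "pbase K" and "set as \<subseteq> L" and L: "pbase L"
  shows "set (pfister_coeffs p R as) \<subseteq> L"
  using assms(2)
proof (induction as)
  case Nil
  then show ?case using subringE(3)[OF pbaseD(2)[OF L]] by simp
next
  case (Cons a as)
  have "a [^] (i::nat) \<in> L" for i
    using Cons subringE(3,6)[OF pbaseD(2)[OF L]] by (induction i) auto
  then show ?case unfolding set_pfister_Cons using Cons subringE(6)[OF pbaseD(2)[OF L]] by auto
qed

text \<open>The monomials in the generators with exponents below p suffice, because the p-th power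
  of a generator is a scalar. This is what makes the values of a quasi-Pfister form a field.\<close>

lemma Span_pfister_coeffs:
  assumes K: "pbase K" and "set as \<subseteq> carrier R"
  shows "Span K (pfister_coeffs p R as) = finite_extension K as"
  using assms(2)
proof (induction as)
  case Nil
  have "k \<otimes> \<one> \<oplus> \<zero> = k" if "k \<in> K" for k
    using that pbaseD(3)[OF K] by auto
  then show ?case by (auto simp: line_extension_mem_iff)
next
  case (Cons a as)
  let ?L = "finite_extension K as" and ?T = "Span K (pfister_coeffs p R (a # as))"
  note kf = pbaseD(1)[OF K]
  have a: "a \<in> carrier R" and as: "set as \<subseteq> carrier R" using Cons.prems by auto
  have E: "pbase (finite_extension K (a # as))" using pbase_finite_extension[OF K Cons.prems] .
  note pc = pfister_coeffs_in_carrier[OF Cons.prems] and pc' = pfister_coeffs_in_carrier[OF as]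
  have "?T \<subseteq> finite_extension K (a # as)"
    using Span_subset_subring[OF pbaseD(2)[OF E] finite_extension_base_incl[OF K Cons.prems]]
      pfister_coeffs_in_extension[OF K _ E] finite_extension_mem[OF pbaseD(2)[OF K] Cons.prems] by blast
  \<comment> \<open>The elements of a simple extension are built by Horner's rule as
    \<open>k1 \<otimes> a \<oplus> k2\<close>, so it is enough that \<open>?T\<close> contains the
    smaller field and is closed under multiplication by \<open>a\<close>.\<close>
  moreover have "x \<in> ?T" if "x \<in> simple_extension ?L a" for x
    using that
  proof induction
    case zero show ?case using Span_subgroup_props(2)[OF kf pc] .
  next
    case (lin k1 k2)
    have base: "c \<in> ?T" if "c \<in> set (pfister_coeffs p R as)" for c
    proof -
      have "a [^] (0::nat) \<otimes> c \<in> set (pfister_coeffs p R (a # as))"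
        unfolding set_pfister_Cons using that prime_gt_0_nat[OF prime_p] by blast
      moreover have "a [^] (0::nat) \<otimes> c = c" using that pc' by auto
      ultimately show ?thesis using Span_base_incl[OF kf pc] by (metis subsetD)
    qed
    have "u \<otimes> a \<in> ?T" if u: "u \<in> set (pfister_coeffs p R (a # as))" for u
    proof -
      obtain i c where ic: "u = a [^] i \<otimes> c" "i < p" "c \<in> set (pfister_coeffs p R as)"
        using u unfolding set_pfister_Cons by blast
      then have ua: "u \<otimes> a = a [^] Suc i \<otimes> c" using a pc' by (auto simp: m_ac)
      show ?thesis
      \<comment> \<open>The exponent overflows only here: a^p joins the scalars and the exponent
        falls back to 0.\<close>
      proof (cases "Suc i = p")
        case True
        then show ?thesis
          using Span_smult_closed[OF kf pc pbaseD(4)[OF K a] base[OF ic(3)]] ua by simp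
      next
        case False
        then have "Suc i < p" using ic(2) by simp
        then have "u \<otimes> a \<in> set (pfister_coeffs p R (a # as))"
          unfolding set_pfister_Cons ua using ic(3) by blast
        then show ?thesis using Span_base_incl[OF kf pc] by blast
      qed
    qed
    then have "k1 \<otimes> a \<in> ?T" using Span_mult_subset[OF kf pc pc a] lin by blast
    moreover have "k2 \<in> ?T"
      using lin(2) Cons.IH[OF as] mono_Span_subset[OF kf _ pc, of "pfister_coeffs p R as"] base by blast
    ultimately show ?case using Span_subgroup_props(3)[OF kf pc] by blast
  qed
  ultimately show ?case by auto
qed

text \<open>A generator that raises the degree lies outside the field generated so far, hence
  outside the linear span as well: every factor p in the degree costs a new dimension. The
  \<open>Suc\<close> is the dimension that 1 contributes.\<close>

lemma degree_le_span:
  assumes K: "pbase K" and "set xs \<subseteq> carrier R"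
  shows "\<exists>l j. dimension (Suc l) K (Span K (\<one> # xs)) \<and> dimension (p ^ j) K (finite_extension K xs) \<and> j \<le> l"
  using assms(2)
proof (induction xs)
  case Nil
  have "independent K [\<one>]" by (intro li_Cons) auto
  from dimension_independent[OF this] show ?case
    using dimension_one[OF pbaseD(1)[OF K]] by (intro exI[of _ 0]) simp
next
  case (Cons x xs)
  then obtain l j where lj: "dimension (Suc l) K (Span K (\<one> # xs))" "dimension (p ^ j) K (finite_extension K xs)" "j \<le> l"
    by auto
  note kf = pbaseD(1)[OF K]
  have xs: "set xs \<subseteq> carrier R" and x: "x \<in> carrier R" using Cons.prems by auto
  let ?L = "finite_extension K xs"
  have L: "pbase ?L" using pbase_finite_extension[OF K xs] .
  have eq: "Span K (\<one> # x # xs) = Span K (x # \<one> # xs)"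
    using Span_same_set[OF kf, of "\<one> # x # xs" "x # \<one> # xs"] Cons.prems by auto
  show ?case
  proof (cases "x \<in> Span K (\<one> # xs)")
    case True
    have "Span K (x # \<one> # xs) = Span K (\<one> # xs)"
      using True mono_Span_subset[OF kf, of "x # \<one> # xs" "\<one> # xs"] Span_base_incl[OF kf, of "\<one> # xs"]
        mono_Span[OF kf, of "\<one> # xs" x] x xs by (metis insert_subset list.simps(15) one_closed subset_antisym)
    moreover have "Span K (\<one> # xs) \<subseteq> ?L"
      using Span_subset_subring[OF pbaseD(2)[OF L] finite_extension_base_incl[OF K xs], of "\<one> # xs"]
        finite_extension_mem[OF pbaseD(2)[OF K] xs] subringE(3)[OF pbaseD(2)[OF L]]
      by (simp del: Span_list)
    then have "finite_extension K (x # xs) = ?L"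
      using simple_extension_absorb[OF L, of x] True by auto
    ultimately show ?thesis using lj eq by (intro exI[of _ l] exI[of _ j]) simp
  next
    case False
    have d: "dimension (Suc (Suc l)) K (Span K (\<one> # x # xs))"
      unfolding eq using Suc_dim[OF x False lj(1)] by simp
    show ?thesis
    proof (cases "x \<in> ?L")
      case True
      then show ?thesis using d lj simple_extension_absorb[OF L, of x]
        by (intro exI[of _ "Suc l"] exI[of _ j]) simp
    next
      case False
      have "dimension (p ^ Suc j) K (finite_extension K (x # xs))"
        using telescopic_base[OF kf pbaseD(1)[OF L] lj(2) dimension_simple_extension_p[OF L x False]]
        by (simp add: mult.commute)
      then show ?thesis using d lj(3) by (intro exI[of _ "Suc l"] exI[of _ "Suc j"]) simp
    qed
  qed
qed

section \<open>p-independence, expressed by maximal degree\<close>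

definition pindep :: "'a set \<Rightarrow> 'a list \<Rightarrow> bool" where
  "pindep K xs \<longleftrightarrow> set xs \<subseteq> carrier R \<and> dimension (p ^ length xs) K (finite_extension K xs)"

lemma p_power_inject: "p ^ a = p ^ b \<longleftrightarrow> a = b"
  using prime_gt_1_nat[OF prime_p] by simp

lemma pindep_same_set:
  assumes "pbase K" "pindep K xs" "set xs = set ys" "length xs = length ys"
  shows "pindep K ys"
  using assms finite_extension_same_set[OF pbaseD(2), of K xs ys] unfolding pindep_def by metis

text \<open>Degrees multiply in the tower through the extension by \<open>xs\<close>. Neither
  exponent exceeds the length of its list, so if their sum is maximal, both are.\<close>

lemma pindep_appendD:
  assumes K: "pbase K" and ys: "pindep K (ys @ xs)"
  shows "pindep K xs" and "dimension (p ^ length ys) (finite_extension K xs) (finite_extension K (ys @ xs))"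
proof -
  have c: "set xs \<subseteq> carrier R" "set ys \<subseteq> carrier R" using ys unfolding pindep_def by auto
  let ?L = "finite_extension K xs"
  have L: "pbase ?L" using pbase_finite_extension[OF K c(1)] .
  obtain a where a: "a \<le> length xs" "dimension (p ^ a) K ?L"
    using dimension_finite_extension[OF K c(1)] by blast
  obtain b where b: "b \<le> length ys" "dimension (p ^ b) ?L (finite_extension ?L ys)"
    using dimension_finite_extension[OF L c(2)] by blast
  have "dimension (p ^ a * p ^ b) K (finite_extension K (ys @ xs))"
    using telescopic_base[OF pbaseD(1)[OF K] pbaseD(1)[OF L] a(2) b(2)] by (simp add: finite_extension_append)
  then have "p ^ (a + b) = p ^ length (ys @ xs)"
    using dimension_is_inj[OF pbaseD(1)[OF K], of "p ^ a * p ^ b"] ys unfolding pindep_def power_add by blast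
  then have "a + b = length xs + length ys" unfolding p_power_inject by simp
  then have "a = length xs" "b = length ys" using a(1) b(1) by auto
  then show "pindep K xs" and "dimension (p ^ length ys) ?L (finite_extension K (ys @ xs))"
    using a b c unfolding pindep_def by (auto simp: finite_extension_append)
qed

lemma pindep_Cons:
  assumes K: "pbase K" and xs: "pindep K xs" and x: "x \<in> carrier R" "x \<notin> finite_extension K xs"
  shows "pindep K (x # xs)"
proof -
  have L: "pbase (finite_extension K xs)" using pbase_finite_extension[OF K] xs unfolding pindep_def by simp
  have "dimension (p ^ length xs * p) K (finite_extension K (x # xs))"
    using telescopic_base[OF pbaseD(1)[OF K] pbaseD(1)[OF L] _ dimension_simple_extension_p[OF L x]] xs
    unfolding pindep_def by simp
  then show ?thesis using xs x unfolding pindep_def by (simp add: mult.commute)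
qed

lemma dimension_mono:
  assumes K: "subfield K R" and "dimension a K E" "dimension b K G" "E \<subseteq> G"
  shows "a \<le> b"
proof -
  obtain us where us: "set us \<subseteq> carrier R" "independent K us" "length us = a" "Span K us = E"
    using exists_base[OF K assms(2)] by blast
  then show ?thesis
    using independent_length_le_dimension[OF K assms(3) us(2)] Span_base_incl[OF K us(1)] assms(4) by blast
qed

text \<open>Greedy completion to a p-basis: as long as \<open>P\<close> is not reached, any of its
  remaining elements extends the list, and the degree p^n bounds the number of steps.\<close>

lemma pindep_extend:
  assumes K: "pbase K" and P: "pbase P" and KP: "K \<subseteq> P" and dP: "dimension (p ^ n) K P"
    and "pindep K cs" "set cs \<subseteq> P"
  shows "\<exists>ds. set ds \<subseteq> P \<and> length (ds @ cs) = n \<and> finite_extension K (ds @ cs) = P"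
  using assms(5,6)
proof (induction "n - length cs" arbitrary: cs rule: less_induct)
  case less
  let ?L = "finite_extension K cs"
  have L: "?L \<subseteq> P" using finite_extension_subset[OF P KP] less.prems by blast
  have dL: "dimension (p ^ length cs) K ?L" using less.prems unfolding pindep_def by simp
  show ?case
  proof (cases "?L = P")
    case True
    then have "length cs = n"
      using dimension_is_inj[OF pbaseD(1)[OF K] dL, of "p ^ n"] dP p_power_inject by simp
    then show ?thesis using True by (intro exI[of _ "[]"]) simp
  next
    case False
    then obtain x where x: "x \<in> P" "x \<notin> ?L" using L by blast
    then have xs: "pindep K (x # cs)" using pindep_Cons[OF K less.prems(1)] pbaseD(3)[OF P] by blast
    have "p ^ Suc (length cs) \<le> p ^ n"
      using dimension_mono[OF pbaseD(1)[OF K] _ dP, of "p ^ Suc (length cs)" "finite_extension K (x # cs)"]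
        finite_extension_subset[OF P KP, of "x # cs"] xs less.prems x unfolding pindep_def by simp
    then have "Suc (length cs) \<le> n" using power_le_imp_le_exp[OF prime_gt_1_nat[OF prime_p]] by blast
    then obtain ds where "set ds \<subseteq> P" "length (ds @ x # cs) = n" "finite_extension K (ds @ x # cs) = P"
      using less.hyps[of "x # cs"] xs x less.prems by fastforce
    then show ?thesis using x by (intro exI[of _ "ds @ [x]"]) simp
  qed
qed

text \<open>Linear disjointness of the extensions by \<open>fs\<close> and by \<open>ds\<close>. A
  basis of the first that contains \<open>us\<close> still spans the compositum over the second, and
  its number of members is exactly the degree there, so it remains a basis.\<close>

lemma pindep_linearly_disjoint:
  assumes K: "pbase K" and fd: "pindep K (fs @ ds)"
    and us: "independent K us" "set us \<subseteq> finite_extension K fs"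
  shows "independent (finite_extension K ds) us"
proof -
  let ?L = "finite_extension K ds" and ?M = "finite_extension K fs" and ?P = "finite_extension K (fs @ ds)"
  have c: "set fs \<subseteq> carrier R" "set ds \<subseteq> carrier R" using fd unfolding pindep_def by auto
  have L: "pbase ?L" and M: "pbase ?M" using pbase_finite_extension[OF K] c by auto
  have "pindep K fs"
    using pindep_appendD(1)[OF K, of ds fs] pindep_same_set[OF K fd, of "ds @ fs"] by (auto simp: Un_commute)
  then have dM: "dimension (p ^ length fs) K ?M" unfolding pindep_def by simp
  obtain vs where vs: "length (vs @ us) = p ^ length fs" "independent K (vs @ us)" "Span K (vs @ us) = ?M"
    using complete_base[OF pbaseD(1)[OF K] dM us] by blast
  note cv = independent_in_carrier[OF vs(2)]
  have KL: "K \<subseteq> ?L" using finite_extension_base_incl[OF K c(2)] .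
  have MP: "?M \<subseteq> ?P"
    using finite_extension_subset[OF pbase_finite_extension[OF K, of "fs @ ds"]]
      finite_extension_base_incl[OF K, of "fs @ ds"] finite_extension_mem[OF pbaseD(2)[OF K], of "fs @ ds"] c by simp
  have PL: "?P = finite_extension ?L fs" by (rule finite_extension_append)
  have "Span ?L (vs @ us) \<subseteq> ?P"
  proof -
    have "set (vs @ us) \<subseteq> ?P" using Span_base_incl[OF pbaseD(1)[OF K] cv] vs(3) MP by blast
    moreover have "?L \<subseteq> ?P" using finite_extension_base_incl[OF L c(1)] PL by simp
    ultimately show ?thesis
      using Span_subset_subring[OF pbaseD(2)[OF pbase_finite_extension[OF K, of "fs @ ds"]]] c by simp
  qed
  moreover have "?P \<subseteq> Span ?L (vs @ us)"
  proof -
    \<comment> \<open>The monomials in \<open>fs\<close> span \<open>?P\<close> over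
      \<open>?L\<close>, and each of them is already a combination of the chosen basis over
      \<open>K\<close>.\<close>
    have "set (pfister_coeffs p R fs) \<subseteq> ?M"
      using pfister_coeffs_in_extension[OF K finite_extension_mem[OF pbaseD(2)[OF K] c(1)] M] .
    also have "\<dots> \<subseteq> Span ?L (vs @ us)" using Span_mono_field[OF KL, of "vs @ us"] vs(3) by simp
    finally have "Span ?L (pfister_coeffs p R fs) \<subseteq> Span ?L (vs @ us)"
      using mono_Span_subset[OF pbaseD(1)[OF L]] cv by blast
    then show ?thesis using Span_pfister_coeffs[OF L c(1)] PL by simp
  qed
  ultimately have "independent ?L (vs @ us)"
    using independent_if_spanning[OF pbaseD(1)[OF L] cv, of ?P] pindep_appendD(2)[OF K fd] vs(1) by auto
  then show ?thesis using independent_split(1)[OF pbaseD(1)[OF L]] by blast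
qed

section \<open>Multiplication of spans by a nonzero element\<close>

lemma Span_scale:
  assumes K: "subfield K R" and u: "u \<in> carrier R" and "set xs \<subseteq> carrier R"
  shows "Span K (map ((\<otimes>) u) xs) = (\<otimes>) u ` Span K xs"
  using assms(3)
proof (induction xs)
  case Nil show ?case using u by simp
next
  case (Cons x xs)
  have k: "k \<in> carrier R" if "k \<in> K" for k using that subfieldE(3)[OF K] by blast
  have s: "v \<in> carrier R" if "v \<in> Span K xs" for v
    using that Span_in_carrier[OF subfieldE(3)[OF K], of xs] Cons.prems by auto
  have *: "k \<otimes> (u \<otimes> x) \<oplus> u \<otimes> v = u \<otimes> (k \<otimes> x \<oplus> v)" if "k \<in> K" "v \<in> Span K xs" for k v
    using k[OF that(1)] s[OF that(2)] u Cons.prems by (simp add: r_distr m_lcomm)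
  have IH: "Span K (map ((\<otimes>) u) xs) = (\<otimes>) u ` Span K xs" using Cons by simp
  show ?case
  proof (intro equalityI subsetI)
    fix y assume "y \<in> Span K (map ((\<otimes>) u) (x # xs))"
    then obtain k w where "k \<in> K" "w \<in> Span K (map ((\<otimes>) u) xs)" "y = k \<otimes> (u \<otimes> x) \<oplus> w"
      by (auto simp: line_extension_mem_iff)
    then obtain v where v: "k \<in> K" "v \<in> Span K xs" "w = u \<otimes> v" "y = k \<otimes> (u \<otimes> x) \<oplus> w"
      using IH by blast
    then have "y = u \<otimes> (k \<otimes> x \<oplus> v)" using * by simp
    moreover have "k \<otimes> x \<oplus> v \<in> Span K (x # xs)" using v(1,2) by (auto simp: line_extension_mem_iff)
    ultimately show "y \<in> (\<otimes>) u ` Span K (x # xs)" by (rule image_eqI)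
  next
    fix y assume "y \<in> (\<otimes>) u ` Span K (x # xs)"
    then obtain k v where kv: "k \<in> K" "v \<in> Span K xs" "y = u \<otimes> (k \<otimes> x \<oplus> v)"
      by (auto simp: line_extension_mem_iff)
    then have "y = k \<otimes> (u \<otimes> x) \<oplus> u \<otimes> v" using * by simp
    moreover have "u \<otimes> v \<in> Span K (map ((\<otimes>) u) xs)" using IH kv(2) by (metis image_eqI)
    ultimately show "y \<in> Span K (map ((\<otimes>) u) (x # xs))"
      unfolding list.map Span_list line_extension_mem_iff using kv(1) by metis
  qed
qed

lemma dimension_scale:
  assumes K: "subfield K R" and u: "u \<in> carrier R" "u \<noteq> \<zero>" and "dimension m K E"
  shows "dimension m K ((\<otimes>) u ` E)"
proof -
  obtain us where us: "set us \<subseteq> carrier R" "independent K us" "length us = m" "Span K us = E"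
    using exists_base[OF K assms(4)] by blast
  have "independent K (map ((\<otimes>) u) xs)" if "independent K xs" for xs
    using that
  proof (induction xs rule: list.induct)
    case (Cons x xs)
    note li_Cons = independent_backwards(3,1,2)[OF Cons.prems]
    have xs: "set xs \<subseteq> carrier R" using independent_in_carrier[OF li_Cons(3)] .
    have "u \<otimes> x \<notin> Span K (map ((\<otimes>) u) xs)"
    proof
      assume "u \<otimes> x \<in> Span K (map ((\<otimes>) u) xs)"
      then obtain v where "v \<in> Span K xs" "u \<otimes> x = u \<otimes> v" using Span_scale[OF K u(1) xs] by auto
      then show False
        using m_lcancel[OF u(2,1) li_Cons(1), of v] Span_subgroup_props(1)[OF K xs] li_Cons(2) by auto
    qed
    then show ?case using Cons li_Cons u by (simp add: independent.li_Cons)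
  qed simp
  from dimension_independent[OF this[OF us(2)]] show ?thesis
    using Span_scale[OF K u(1) us(1)] us(3,4) by simp
qed

end

section \<open>Value spaces over intermediate fields\<close>

context char_p_field
begin

section \<open>The value space over a fixed base field\<close>

lemma dimension_Span_le:
  assumes K: "subfield K R" and us: "set us \<subseteq> carrier R" and "dimension n K (Span K us)"
  shows "n \<le> length us"
proof -
  obtain ws where ws: "set ws \<subseteq> set us" "independent K ws" "Span K ws = Span K us"
    using spanning_sublist[OF K us] by blast
  have "n = length ws"
    using dimension_is_inj[OF K assms(3)] dimension_independent[OF ws(2)] ws(3) by simp
  also have "\<dots> = card (set ws)" using independent_distinct[OF K ws(2)] by (simp add: distinct_card)
  also have "\<dots> \<le> card (set us)" using ws(1) by (simp add: card_mono)
  also have "\<dots> \<le> length us" by (rule card_length)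
  finally show ?thesis .
qed

text \<open>Each list lies in the extension of \<open>K\<close> by the other, and this persists when
  the base field grows. It lets \<open>as\<close> be exchanged for a p-basis over
  \<open>L\<close>.\<close>

lemma finite_extension_cong:
  assumes K: "pbase K" and L: "pbase L" and "K \<subseteq> L" and xs: "set xs \<subseteq> carrier R" and ys: "set ys \<subseteq> carrier R"
    and "finite_extension K xs = finite_extension K ys"
  shows "finite_extension L xs = finite_extension L ys"
proof -
  have "finite_extension L us \<subseteq> finite_extension L vs"
    if c: "set us \<subseteq> carrier R" "set vs \<subseteq> carrier R" and "finite_extension K us = finite_extension K vs" for us vs
  proof -
    have "set us \<subseteq> finite_extension K vs" using finite_extension_mem[OF pbaseD(2)[OF K] c(1)] that(3) by simp
    also have "\<dots> \<subseteq> finite_extension L vs" using mono_finite_extension[OF \<open>K \<subseteq> L\<close>] .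
    finally show ?thesis
      using finite_extension_subset[OF pbase_finite_extension[OF L c(2)] finite_extension_base_incl[OF L c(2)]] by simp
  qed
  from this[OF xs ys assms(6)] this[OF ys xs assms(6)[symmetric]] show ?thesis by blast
qed

lemma value_space_absorbed:
  assumes K: "pbase K" and as: "set as \<subseteq> carrier R" and bs: "set bs \<subseteq> finite_extension K as"
    and d: "d \<in> finite_extension K as"
  shows "Span K (pfister_coeffs p R as @ map ((\<otimes>) d) bs) = finite_extension K as"
proof -
  let ?Q = "finite_extension K as"
  have Q: "pbase ?Q" using pbase_finite_extension[OF K as] .
  note pc = pfister_coeffs_in_carrier[OF as]
  have "set (pfister_coeffs p R as @ map ((\<otimes>) d) bs) \<subseteq> ?Q"
    using Span_base_incl[OF pbaseD(1)[OF K] pc] Span_pfister_coeffs[OF K as] bs d subringE(6)[OF pbaseD(2)[OF Q] d]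
    by auto
  then have "Span K (pfister_coeffs p R as @ map ((\<otimes>) d) bs) \<subseteq> ?Q"
    using Span_subset_subring[OF pbaseD(2)[OF Q] finite_extension_base_incl[OF K as]] by blast
  moreover have "?Q \<subseteq> Span K (pfister_coeffs p R as @ map ((\<otimes>) d) bs)"
    using mono_Span_append(1)[OF pbaseD(1)[OF K] pc, of "map ((\<otimes>) d) bs"] Span_pfister_coeffs[OF K as] bs d pbaseD(3)[OF Q]
    by auto
  ultimately show ?thesis by simp
qed

text \<open>A nonzero common element \<open>d \<otimes> v\<close> of the two summands would put
  \<open>d\<close> into the field, by division by \<open>v\<close>, which lies there. So the sum is
  direct and the dimensions add up.\<close>

lemma value_space_direct:
  assumes K: "pbase K" and as: "set as \<subseteq> carrier R" and bs: "set bs \<subseteq> finite_extension K as"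
    and d: "d \<in> carrier R" "d \<notin> finite_extension K as"
    and q: "dimension q K (finite_extension K as)" and l: "dimension l K (Span K bs)"
  shows "dimension (q + l) K (Span K (pfister_coeffs p R as @ map ((\<otimes>) d) bs))"
proof -
  let ?Q = "finite_extension K as"
  note kf = pbaseD(1)[OF K]
  have Q: "pbase ?Q" using pbase_finite_extension[OF K as] .
  have d0: "d \<noteq> \<zero>" using d(2) subringE(2)[OF pbaseD(2)[OF Q]] by auto
  note pc = pfister_coeffs_in_carrier[OF as]
  have bc: "set bs \<subseteq> carrier R" using bs pbaseD(3)[OF Q] by blast
  then have dbc: "set (map ((\<otimes>) d) bs) \<subseteq> carrier R" using d by auto
  have bQ: "Span K bs \<subseteq> ?Q"
    using Span_subset_subring[OF pbaseD(2)[OF Q] finite_extension_base_incl[OF K as] bs] .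
  have "?Q \<inter> (\<otimes>) d ` Span K bs = {\<zero>}"
  proof -
    have "d \<otimes> v = \<zero>" if v: "v \<in> Span K bs" "d \<otimes> v \<in> ?Q" for v
    proof (rule ccontr)
      assume "d \<otimes> v \<noteq> \<zero>"
      then have v0: "v \<noteq> \<zero>" using d by auto
      have vQ: "v \<in> ?Q" and vc: "v \<in> carrier R" using v bQ pbaseD(3)[OF Q] by auto
      have "inv v \<in> ?Q" using subfield_m_inv(1)[OF pbaseD(1)[OF Q], of v] vQ v0 by simp
      then have "d \<otimes> v \<otimes> inv v \<in> ?Q" using subringE(6)[OF pbaseD(2)[OF Q] v(2)] by simp
      moreover have "d \<otimes> v \<otimes> inv v = d" using d vc v0 by (simp add: m_assoc field_Units)
      ultimately show False using d(2) by simp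
    qed
    moreover have "\<zero> \<in> ?Q" using subringE(2)[OF pbaseD(2)[OF Q]] .
    moreover have "d \<otimes> \<zero> \<in> (\<otimes>) d ` Span K bs" using Span_subgroup_props(2)[OF kf bc] by (rule imageI)
    ultimately show ?thesis using d by auto
  qed
  then have "dimension (q + l) K (?Q <+>\<^bsub>R\<^esub> (\<otimes>) d ` Span K bs)"
    using dimension_direct_sum_space[OF kf q dimension_scale[OF kf d(1) d0 l]] by simp
  then show ?thesis
    using Span_append_eq_set_add[OF kf pc dbc] Span_pfister_coeffs[OF K as] Span_scale[OF kf d(1) bc] by simp
qed

text \<open>
  Here and in \<open>exists_subfield_direct\<close>, \<open>bs\<close> spans \<open>b (K + K x\<^sub>1 + \<dots> + K x\<^sub>t)\<close> with \<open>xs = [x\<^sub>1, \<dots>, x\<^sub>t]\<close>, and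
  \<open>ys @ xs\<close> generates the same field as \<open>as\<close>.
\<close>

lemma value_space_dimension:
  assumes K: "pbase K" and as: "set as \<subseteq> carrier R"
    and c: "set xs \<subseteq> carrier R" "set ys \<subseteq> carrier R"
    and gen: "finite_extension K as = finite_extension K (ys @ xs)" and len: "length as = length (ys @ xs)"
    and b: "b \<in> finite_extension K as" "b \<noteq> \<zero>" and d: "d \<in> carrier R"
    and bs: "set bs \<subseteq> carrier R" "Span K bs = Span K (map ((\<otimes>) b) (\<one> # xs))"
    and m: "dimension m K (Span K (pfister_coeffs p R as @ map ((\<otimes>) d) bs))"
  shows "\<exists>k l. m = p ^ k + l \<and> k \<le> length as \<and>
    (l = 0 \<or> 1 \<le> l \<and> k + Suc (length xs) \<le> length as + l \<and> l \<le> Suc (length xs) \<and> l \<le> p ^ k)"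
proof -
  let ?Q = "finite_extension K as"
  note kf = pbaseD(1)[OF K]
  have Q: "pbase ?Q" using pbase_finite_extension[OF K as] .
  have bc: "b \<in> carrier R" using b pbaseD(3)[OF Q] by blast
  obtain k where k: "k \<le> length as" "dimension (p ^ k) K ?Q"
    using dimension_finite_extension[OF K as] by blast
  have xQ: "set (\<one> # xs) \<subseteq> ?Q"
    using gen finite_extension_mem[OF pbaseD(2)[OF K], of "ys @ xs"] c subringE(3)[OF pbaseD(2)[OF Q]] by auto
  have KQ: "K \<subseteq> ?Q" using finite_extension_base_incl[OF K as] .
  have bxQ: "set (map ((\<otimes>) b) (\<one> # xs)) \<subseteq> ?Q"
    using subringE(6)[OF pbaseD(2)[OF Q] b(1)] xQ by auto
  have bsQ: "set bs \<subseteq> ?Q"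
    using Span_base_incl[OF kf bs(1)] bs(2) Span_subset_subring[OF pbaseD(2)[OF Q] KQ bxQ] by blast
  show ?thesis
  proof (cases "d \<in> ?Q")
    case True
    then have "m = p ^ k"
      using dimension_is_inj[OF kf m, of "p ^ k"] value_space_absorbed[OF K as bsQ True] k(2) by simp
    then show ?thesis using k(1) by (intro exI[of _ k] exI[of _ 0]) simp
  next
    case False
    \<comment> \<open>This \<open>l\<close> is one less than the number in the conclusion, since the
      entry 1 accounts for one dimension. Scaling by \<open>b\<close> leaves dimensions
      unchanged.\<close>
    obtain l j where l: "dimension (Suc l) K (Span K (\<one> # xs))" "dimension (p ^ j) K (finite_extension K xs)" "j \<le> l"
      using degree_le_span[OF K c(1)] by blast
    have dl: "dimension (Suc l) K (Span K bs)"
      using dimension_scale[OF kf bc b(2) l(1)] Span_scale[OF kf bc, of "\<one> # xs"] bs(2) c(1) by simp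
    have "m = p ^ k + Suc l"
      using dimension_is_inj[OF kf m] value_space_direct[OF K as bsQ d False k(2) dl] by simp
    moreover have "Suc l \<le> p ^ k"
      using dimension_mono[OF kf dl k(2)] Span_subset_subring[OF pbaseD(2)[OF Q] KQ bsQ] by simp
    moreover have "Suc l \<le> Suc (length xs)"
      using dimension_Span_le[OF kf _ l(1)] c(1) by simp
    \<comment> \<open>In the tower through the extension by \<open>xs\<close> the exponent splits as
      k = j + i. Here i is at most \<open>length ys\<close>, and j is at most \<open>l\<close>
      because degree p^j requires that many dimensions besides that of 1.\<close>
    moreover have "k + Suc (length xs) \<le> length as + Suc l"
    proof -
      have X: "pbase (finite_extension K xs)" using pbase_finite_extension[OF K c(1)] .
      obtain i where i: "i \<le> length ys" "dimension (p ^ i) (finite_extension K xs) (finite_extension (finite_extension K xs) ys)"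
        using dimension_finite_extension[OF X c(2)] by blast
      have "dimension (p ^ (j + i)) K ?Q"
        using telescopic_base[OF kf pbaseD(1)[OF X] l(2) i(2)] unfolding gen finite_extension_append power_add .
      then have "k = j + i"
        using dimension_is_inj[OF kf k(2)] p_power_inject by blast
      then show ?thesis using i(1) l(3) len by simp
    qed
    ultimately show ?thesis using k(1) by (intro exI[of _ k] exI[of _ "Suc l"]) simp
  qed
qed

section \<open>Intermediate fields with prescribed dimensions\<close>

lemma exists_subfield_absorbing:
  assumes K: "pbase K" and as: "set as \<subseteq> carrier R" and cs: "pindep K cs"
    and gen: "finite_extension K as = finite_extension K cs"
    and bs: "set bs \<subseteq> finite_extension K as" and d: "d \<in> carrier R" "d \<notin> finite_extension K as"
    and k: "k \<le> length cs"
  shows "\<exists>L. pbase L \<and> K \<subseteq> L \<and> dimension (p ^ k) L (Span L (pfister_coeffs p R as @ map ((\<otimes>) d) bs))"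
proof -
  define fs where "fs = take k cs"
  \<comment> \<open>Putting \<open>d\<close> into the base field forces it to be absorbed; putting
    all but \<open>k\<close> members of the p-basis there leaves degree p^k.\<close>
  define ds where "ds = d # drop k cs"
  have cc: "set cs \<subseteq> carrier R" using cs unfolding pindep_def by simp
  have "pindep K (d # cs)" using pindep_Cons[OF K cs d(1)] d(2) gen by simp
  moreover have "set (d # cs) = set (fs @ ds)" "length (d # cs) = length (fs @ ds)"
    unfolding fs_def ds_def using k arg_cong[OF append_take_drop_id[of k cs], of set] by (auto simp del: append_take_drop_id)
  ultimately have fd: "pindep K (fs @ ds)" using pindep_same_set[OF K] by blast
  have c: "set fs \<subseteq> carrier R" "set ds \<subseteq> carrier R" using fd unfolding pindep_def by auto
  let ?L = "finite_extension K ds"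
  have L: "pbase ?L" and KL: "K \<subseteq> ?L"
    using pbase_finite_extension[OF K c(2)] finite_extension_base_incl[OF K c(2)] by auto
  have dL: "dimension (p ^ k) ?L (finite_extension ?L fs)"
    using pindep_appendD(2)[OF K fd] k unfolding finite_extension_append fs_def by simp
  note memL = finite_extension_mem[OF pbaseD(2)[OF K] c(2)]
  have "finite_extension ?L cs = finite_extension ?L fs"
  proof (intro equalityI)
    have F: "pbase (finite_extension ?L fs)" "?L \<subseteq> finite_extension ?L fs" "set fs \<subseteq> finite_extension ?L fs"
      using pbase_finite_extension[OF L c(1)] finite_extension_base_incl[OF L c(1)]
        finite_extension_mem[OF pbaseD(2)[OF L] c(1)] by auto
    have "set cs \<subseteq> set fs \<union> set ds"
      unfolding fs_def ds_def by (metis append_take_drop_id set_append set_subset_Cons sup.mono subset_refl)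
    then show "finite_extension ?L cs \<subseteq> finite_extension ?L fs"
      using finite_extension_subset[OF F(1,2), of cs] F memL by blast
    have "set fs \<subseteq> set cs" unfolding fs_def by (rule set_take_subset)
    then show "finite_extension ?L fs \<subseteq> finite_extension ?L cs"
      using finite_extension_subset[OF pbase_finite_extension[OF L cc] finite_extension_base_incl[OF L cc], of fs]
        finite_extension_mem[OF pbaseD(2)[OF L] cc] by blast
  qed
  then have Q: "finite_extension ?L as = finite_extension ?L fs"
    using finite_extension_cong[OF K L KL as cc gen] by simp
  have "d \<in> finite_extension ?L as"
    using memL finite_extension_base_incl[OF L as] unfolding ds_def by auto
  moreover have "set bs \<subseteq> finite_extension ?L as"
    using bs mono_finite_extension[OF KL, of as] by blast
  ultimately have "Span ?L (pfister_coeffs p R as @ map ((\<otimes>) d) bs) = finite_extension ?L as"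
    using value_space_absorbed[OF L as] by blast
  then show ?thesis using L KL dL Q by (intro exI[of _ ?L]) simp
qed

text \<open>
  The extension keeps \<open>k\<close> of the generators free (\<open>min k (l - 1)\<close> of them among the \<open>xs\<close>), and each
  remaining generator \<open>x\<close> is made congruent modulo \<open>L\<close> to an element \<open>m x\<close> of the field generated by
  the free ones: the \<open>m x\<close> are zero except for as many \<open>K\<close>-independent ones as are needed to
  reach dimension \<open>l\<close>.
\<close>

lemma exists_subfield_direct:
  assumes K: "pbase K" and as: "set as \<subseteq> carrier R" and cs: "pindep K (ys @ xs)"
    and gen: "finite_extension K as = finite_extension K (ys @ xs)"
    and b: "b \<in> finite_extension K as" "b \<noteq> \<zero>"
    and bs: "set bs \<subseteq> carrier R" "Span K bs = Span K (map ((\<otimes>) b) (\<one> # xs))"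
    and d: "d \<in> carrier R" "d \<notin> finite_extension K as"
    and k: "k \<le> length (ys @ xs)" and l: "1 \<le> l" "l \<le> Suc (length xs)" "l \<le> p ^ k"
      "k + 1 \<le> length ys + l"
  shows "\<exists>L. pbase L \<and> K \<subseteq> L \<and> dimension (p ^ k + l) L (Span L (pfister_coeffs p R as @ map ((\<otimes>) d) bs))"
proof -
  let ?P = "finite_extension K as"
  note kf = pbaseD(1)[OF K]
  have P: "pbase ?P" and KP: "K \<subseteq> ?P"
    using pbase_finite_extension[OF K as] finite_extension_base_incl[OF K as] by auto
  have cc: "set ys \<subseteq> carrier R" "set xs \<subseteq> carrier R" using cs unfolding pindep_def by auto
  have xyP: "set ys \<subseteq> ?P" "set xs \<subseteq> ?P"
    using finite_extension_mem[OF pbaseD(2)[OF K], of "ys @ xs"] gen cc by auto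
  have bc: "b \<in> carrier R" using b pbaseD(3)[OF P] by blast
  \<comment> \<open>As many members of \<open>xs\<close> as possible stay free. At most
    \<open>l - 1\<close> of them can, because 1 and \<open>r\<close> free members already give
    dimension r + 1. The other \<open>k - r\<close> free generators come from \<open>ys\<close>,
    which is long enough by the bound \<open>k + 1 \<le> length ys + l\<close>.\<close>
  define r where "r = min k (l - 1)"
  define A where "A = take r xs"
  define B where "B = drop r xs"
  define C where "C = take (k - r) ys"
  define D where "D = drop (k - r) ys"
  have r: "r \<le> length xs" "k - r \<le> length ys" "r \<le> k" "r \<le> l - 1" using l k unfolding r_def by auto
  have xs_AB: "xs = A @ B" and ys_CD: "ys = C @ D" unfolding A_def B_def C_def D_def by simp_all
  have len: "length A = r" "length B = length xs - r" "length C = k - r" "length D = length ys - (k - r)"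
    unfolding A_def B_def C_def D_def using r by auto
  let ?fs = "A @ C"
  let ?M = "finite_extension K ?fs"
  have cA: "set A \<subseteq> carrier R" "set B \<subseteq> carrier R" "set C \<subseteq> carrier R" "set D \<subseteq> carrier R"
    using cc unfolding xs_AB ys_CD by auto
  have "pindep K (B @ D @ A @ C)" "pindep K (B @ D @ C @ A)"
    using pindep_same_set[OF K cs, of "B @ D @ A @ C"] pindep_same_set[OF K cs, of "B @ D @ C @ A"]
    unfolding xs_AB ys_CD by auto
  then have fsi: "pindep K ?fs" and Ai: "pindep K A"
    using pindep_appendD(1)[OF K, of "B @ D" ?fs] pindep_appendD(1)[OF K, of "B @ D @ C" A] by auto
  have M: "pbase ?M" and KM: "K \<subseteq> ?M" using pbase_finite_extension[OF K, of ?fs] finite_extension_base_incl[OF K, of ?fs] cA by auto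
  have dM: "dimension (p ^ k) K ?M" using fsi len r unfolding pindep_def by simp
  have fsM: "set ?fs \<subseteq> ?M" using finite_extension_mem[OF pbaseD(2)[OF K], of ?fs] cA by simp
  have MP: "?M \<subseteq> ?P"
    using finite_extension_subset[OF P KP, of ?fs] xyP unfolding xs_AB ys_CD by auto
  \<comment> \<open>This is \<open>degree_le_span\<close> read backwards: the full degree p^r forces
    the full dimension r + 1.\<close>
  have oneA: "independent K (\<one> # A)"
  proof -
    obtain j i where ji: "dimension (Suc j) K (Span K (\<one> # A))" "dimension (p ^ i) K (finite_extension K A)" "i \<le> j"
      using degree_le_span[OF K cA(1)] by blast
    have "i = length A"
      using dimension_is_inj[OF kf ji(2)] Ai p_power_inject unfolding pindep_def by blast
    moreover have "Suc j \<le> Suc (length A)"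
      using dimension_Span_le[OF kf _ ji(1)] cA(1) by simp
    ultimately have "Suc j = length (\<one> # A)" using ji(3) by simp
    then show ?thesis using independent_if_spanning[OF kf, of "\<one> # A"] ji(1) cA(1) by (simp del: Span_list)
  qed
  have "set (\<one> # A) \<subseteq> ?M" using fsM subringE(3)[OF pbaseD(2)[OF M]] by auto
  then obtain vs where vs: "length (vs @ \<one> # A) = p ^ k" "independent K (vs @ \<one> # A)" "Span K (vs @ \<one> # A) = ?M"
    using complete_base[OF kf dM oneA] by blast
  \<comment> \<open>The missing \<open>l - 1 - r\<close> dimensions are taken from a basis of
    \<open>?M\<close>, which is large enough because it has p^k \<ge> l members.\<close>
  define es where "es = take (l - 1 - r) vs"
  have les: "length es = l - 1 - r" unfolding es_def using vs(1) l(3) len(1) by simp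
  define vs2 where "vs2 = drop (l - 1 - r) vs"
  have "vs = es @ vs2" unfolding es_def vs2_def by simp
  then have "set (vs @ \<one> # A) = set (vs2 @ es @ \<one> # A)" "length (vs @ \<one> # A) = length (vs2 @ es @ \<one> # A)"
    by auto
  then have "independent K (vs2 @ es @ \<one> # A)" using independent_same_set[OF kf _ _ vs(2)] by blast
  then have esi: "independent K (es @ \<one> # A)" using independent_split(1)[OF kf] by blast
  have vM: "set (vs @ \<one> # A) \<subseteq> ?M" using Span_base_incl[OF kf independent_in_carrier[OF vs(2)]] vs(3) by simp
  then have esM: "set (es @ \<one> # A) \<subseteq> ?M" unfolding es_def using set_take_subset[of "l - 1 - r" vs] by auto
  \<comment> \<open>The first members of \<open>B\<close> are paired with \<open>es\<close> and the
    others with 0. The number of zeros is what remains of the length of \<open>B\<close>, since (l -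
    1 - r) + (\<open>length xs\<close> - (l - 1)) = \<open>length xs\<close> - r.\<close>
  define mB where "mB = es @ replicate (length xs - (l - 1)) \<zero>"
  have lmB: "length mB = length B" unfolding mB_def using les len r l by simp
  have mBM: "set mB \<subseteq> ?M" using esM subringE(2)[OF pbaseD(2)[OF M]] unfolding mB_def by auto
  define gs where "gs = map (\<lambda>i. B ! i \<ominus> mB ! i) [0..<length B]"
  \<comment> \<open>The members of \<open>D\<close> enter the base field themselves: for them the
    element m is 0.\<close>
  define ds where "ds = gs @ D"
  have gsP: "set gs \<subseteq> ?P"
  proof -
    have "B ! i \<ominus> mB ! i \<in> ?P" if "i < length B" for i
    proof -
      have "B ! i \<in> set B" "mB ! i \<in> set mB" using that lmB by auto
      then have "B ! i \<in> ?P" "mB ! i \<in> ?P" using xyP mBM MP unfolding xs_AB by auto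
      then show ?thesis unfolding minus_eq using subringE(5,7)[OF pbaseD(2)[OF P]] by simp
    qed
    then show ?thesis unfolding gs_def by auto
  qed
  have dsP: "set ds \<subseteq> ?P" using gsP xyP unfolding ds_def ys_CD by auto
  have dsc: "set ds \<subseteq> carrier R" using dsP pbaseD(3)[OF P] by blast
  have mBc: "set mB \<subseteq> carrier R" and Mc: "?M \<subseteq> carrier R" using mBM pbaseD(3)[OF M] by auto
  have Bi: "B ! i = gs ! i \<oplus> mB ! i" "gs ! i = B ! i \<ominus> mB ! i" "gs ! i \<in> set gs" "mB ! i = B ! i \<oplus> \<ominus> (gs ! i)"
    "mB ! i \<in> set mB" "B ! i \<in> carrier R" "mB ! i \<in> carrier R" "gs ! i \<in> carrier R"
    if "i < length B" for i
  proof -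
    have m: "B ! i \<in> carrier R" "mB ! i \<in> carrier R" using that cA(2) mBc lmB nth_mem by (metis subsetD)+
    show g: "gs ! i = B ! i \<ominus> mB ! i" unfolding gs_def using that by simp
    show "gs ! i \<in> set gs" using that unfolding gs_def by auto
    show "mB ! i \<in> set mB" using that lmB by simp
    show "B ! i = gs ! i \<oplus> mB ! i" unfolding g minus_eq using m by (simp add: a_assoc l_neg)
    show "mB ! i = B ! i \<oplus> \<ominus> (gs ! i)" unfolding g minus_eq using m by (simp add: minus_add a_assoc[symmetric] r_neg)
    show "gs ! i \<in> carrier R" "B ! i \<in> carrier R" "mB ! i \<in> carrier R" unfolding g using m by auto
  qed
  let ?L = "finite_extension K ds"
  have L: "pbase ?L" and KL: "K \<subseteq> ?L"
    using pbase_finite_extension[OF K dsc] finite_extension_base_incl[OF K dsc] by auto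
  note dsL = finite_extension_mem[OF pbaseD(2)[OF K] dsc]
  have fdc: "set (?fs @ ds) \<subseteq> carrier R" using dsc cA by auto
  let ?E = "finite_extension K (?fs @ ds)"
  have E: "pbase ?E" and KE: "K \<subseteq> ?E" using pbase_finite_extension[OF K fdc] finite_extension_base_incl[OF K fdc] by auto
  note memE = finite_extension_mem[OF pbaseD(2)[OF K] fdc]
  \<comment> \<open>The differences lie in \<open>?P\<close>, and each \<open>B ! i\<close> is the
    sum of its difference and an element of \<open>?M\<close>. So the new generators give
    \<open>?P\<close> again, and as their number is that of the p-basis, they are
    p-independent.\<close>
  have EP: "?E = ?P"
  proof (intro equalityI)
    show "?E \<subseteq> ?P" using finite_extension_subset[OF P KP, of "?fs @ ds"] dsP fsM MP by auto
    have ME: "?M \<subseteq> ?E" using finite_extension_subset[OF E KE, of ?fs] memE by auto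
    have "x \<in> ?E" if x: "x \<in> set B" for x
    proof -
      obtain i where i: "i < length B" "x = B ! i" using x by (metis in_set_conv_nth)
      have "gs ! i \<in> ?E" using Bi(3)[OF i(1)] memE unfolding ds_def by auto
      moreover have "mB ! i \<in> ?E" using Bi(5)[OF i(1)] mBM ME by blast
      ultimately show ?thesis unfolding i(2) Bi(1)[OF i(1)] using subringE(7)[OF pbaseD(2)[OF E]] by blast
    qed
    then have "set (ys @ xs) \<subseteq> ?E" using memE unfolding xs_AB ys_CD ds_def by auto
    then show "?P \<subseteq> ?E" unfolding gen using finite_extension_subset[OF E KE] by blast
  qed
  have "length (?fs @ ds) = length (ys @ xs)" unfolding ds_def gs_def xs_AB ys_CD by simp
  then have fd: "pindep K (?fs @ ds)"
    using cs fdc EP gen unfolding pindep_def by simp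
  \<comment> \<open>The new base field lies inside \<open>?P\<close>, so extending it by
    \<open>as\<close> does not leave \<open>?P\<close>; in particular \<open>d\<close> stays
    outside.\<close>
  have PL: "finite_extension ?L as = ?P"
  proof (intro equalityI)
    show "finite_extension ?L as \<subseteq> ?P"
      using finite_extension_subset[OF P finite_extension_subset[OF P KP dsP], of as]
        finite_extension_mem[OF pbaseD(2)[OF K] as] by blast
    show "?P \<subseteq> finite_extension ?L as" using mono_finite_extension[OF KL] .
  qed
  have dP: "dimension (p ^ k) ?L (finite_extension ?L as)"
    using pindep_appendD(2)[OF K fd] len r unfolding EP PL by simp
  have esL: "independent ?L (es @ \<one> # A)"
    using pindep_linearly_disjoint[OF K fd esi esM] .
  note lf = pbaseD(1)[OF L]
  have esc: "set (es @ \<one> # A) \<subseteq> carrier R" and xc: "set (\<one> # xs) \<subseteq> carrier R"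
    using esM Mc cc by auto
  have gL: "g \<in> Span ?L us" if "g \<in> set gs" "\<one> \<in> set us" "set us \<subseteq> carrier R" for g us
  proof -
    have "g \<in> ?L" using that(1) dsL unfolding ds_def by auto
    then have "g \<otimes> \<one> \<in> Span ?L us"
      using Span_smult_closed[OF lf that(3)] Span_base_incl[OF lf that(3)] that(2) by blast
    then show ?thesis using \<open>g \<in> ?L\<close> pbaseD(3)[OF L] by auto
  qed
  \<comment> \<open>Each \<open>B ! i\<close> differs from \<open>mB ! i\<close> by an element of
    \<open>?L\<close>, that is, by a multiple of 1. As 1 occurs in both lists, one may replace the
    other, and the zeros drop out.\<close>
  have "Span ?L (\<one> # xs) = Span ?L (es @ \<one> # A)"
  proof (intro equalityI)
    have "x \<in> Span ?L (es @ \<one> # A)" if x: "x \<in> set B" for x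
    proof -
      obtain i where i: "i < length B" "x = B ! i" using x by (metis in_set_conv_nth)
      have "mB ! i \<in> Span ?L (es @ \<one> # A)"
        using Bi(5)[OF i(1)] Span_base_incl[OF lf esc] Span_subgroup_props(2)[OF lf esc] unfolding mB_def by auto
      moreover have "gs ! i \<in> Span ?L (es @ \<one> # A)" using gL[OF Bi(3)[OF i(1)] _ esc] by simp
      ultimately show ?thesis unfolding i(2) Bi(1)[OF i(1)] using Span_subgroup_props(3)[OF lf esc] by blast
    qed
    then have "set (\<one> # xs) \<subseteq> Span ?L (es @ \<one> # A)"
      using Span_base_incl[OF lf esc] unfolding xs_AB by auto
    then show "Span ?L (\<one> # xs) \<subseteq> Span ?L (es @ \<one> # A)" using mono_Span_subset[OF lf _ esc] by blast
    have "x \<in> Span ?L (\<one> # xs)" if xes: "x \<in> set es" for x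
    proof -
      obtain i where i: "i < length es" "x = es ! i" using xes by (metis in_set_conv_nth)
      then have iB: "i < length B" and x: "x = mB ! i"
        using lmB unfolding mB_def by (auto simp: nth_append)
      have "B ! i \<in> Span ?L (\<one> # xs)"
        using Span_base_incl[OF lf xc] nth_mem[OF iB] unfolding xs_AB by auto
      moreover have "\<ominus> (gs ! i) \<in> Span ?L (\<one> # xs)"
        using gL[OF Bi(3)[OF iB] _ xc] Span_subgroup_props(4)[OF lf xc] by simp
      ultimately show ?thesis unfolding x Bi(4)[OF iB] using Span_subgroup_props(3)[OF lf xc] by blast
    qed
    then have "set (es @ \<one> # A) \<subseteq> Span ?L (\<one> # xs)"
      using Span_base_incl[OF lf xc] unfolding xs_AB by auto
    then show "Span ?L (es @ \<one> # A) \<subseteq> Span ?L (\<one> # xs)" using mono_Span_subset[OF lf _ xc] by blast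
  qed
  then have "dimension l ?L (Span ?L (\<one> # xs))"
    using dimension_independent[OF esL] les len l r by simp
  then have "dimension l ?L (Span ?L (map ((\<otimes>) b) (\<one> # xs)))"
    using dimension_scale[OF lf bc b(2)] Span_scale[OF lf bc xc] by simp
  moreover have bxc: "set (map ((\<otimes>) b) (\<one> # xs)) \<subseteq> carrier R" using bc xc by auto
  then have "Span ?L (map ((\<otimes>) b) (\<one> # xs)) = Span ?L bs"
    using Span_eq_mono[OF kf lf KL bxc bs(1)] Span_eq_mono[OF kf lf KL bs(1) bxc] bs(2) by blast
  ultimately have dl: "dimension l ?L (Span ?L bs)" by simp
  have "set bs \<subseteq> ?P"
    using Span_base_incl[OF kf bs(1)] Span_subset_subring[OF pbaseD(2)[OF P] KP, of "map ((\<otimes>) b) (\<one> # xs)"]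
      subringE(6)[OF pbaseD(2)[OF P] b(1)] xyP subringE(3)[OF pbaseD(2)[OF P]] unfolding bs(2) by auto
  then have "dimension (p ^ k + l) ?L (Span ?L (pfister_coeffs p R as @ map ((\<otimes>) d) bs))"
    using value_space_direct[OF L as _ d(1) _ dP dl] d(2) unfolding PL by blast
  then show ?thesis using L KL by blast
qed

end

section \<open>Quasilinear forms and their values\<close>

lemma submoduleI':
  assumes "Module.module R M" "N \<subseteq> carrier M" "\<zero>\<^bsub>M\<^esub> \<in> N"
    and "\<And>v w. v \<in> N \<Longrightarrow> w \<in> N \<Longrightarrow> v \<oplus>\<^bsub>M\<^esub> w \<in> N"
    and "\<And>c v. c \<in> carrier R \<Longrightarrow> v \<in> N \<Longrightarrow> c \<odot>\<^bsub>M\<^esub> v \<in> N"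
  shows "LinearCombinations.submodule R N M"
  using assms by (intro LinearCombinations.submodule.intro)

lemma (in quasilinear_form) form_zero: "p > 0 \<Longrightarrow> \<phi> \<zero>\<^bsub>V\<^esub> = \<zero>\<^bsub>K\<^esub>"
proof -
  assume "p > 0"
  have "\<phi> (\<zero>\<^bsub>K\<^esub> \<odot>\<^bsub>V\<^esub> \<zero>\<^bsub>V\<^esub>) = \<zero>\<^bsub>K\<^esub> [^]\<^bsub>K\<^esub> p \<otimes>\<^bsub>K\<^esub> \<phi> \<zero>\<^bsub>V\<^esub>" by (rule form_smult) auto
  moreover have "\<phi> \<zero>\<^bsub>V\<^esub> \<in> carrier K" using form_closed by auto
  ultimately show ?thesis using \<open>p > 0\<close> by (simp add: nat_pow_zero)
qed

context char_p_field
begin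

lemma p_gt_0: "p > 0" using prime_gt_0_nat[OF prime_p] .

text \<open>A form is additive and turns a scalar a into a^p, so it carries linear combinations to
  combinations over the field of p-th powers.\<close>

lemma form_image_span:
  assumes q: "quasilinear_form p R V \<phi>" and vs: "set vs \<subseteq> carrier V"
  shows "\<phi> ` LinearCombinations.module.span R V (set vs) = Span (pth_powers p R) (map \<phi> vs)"
proof -
  interpret V: quasilinear_form p R V \<phi> by (fact q)
  let ?K = "pth_powers p R"
  note kf = pth_powers_subfield
  have mc: "set (map \<phi> vs) \<subseteq> carrier R" using vs V.form_closed by auto
  interpret S: LinearCombinations.submodule R "V.span (set vs)" V
    using V.span_is_submodule[OF vs] .
  have "Span ?K (map \<phi> us) \<subseteq> \<phi> ` V.span (set vs)" if "set us \<subseteq> set vs" for us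
    using that
  proof (induction us)
    case Nil
    then show ?case using V.form_zero[OF p_gt_0] S.zero_closed by (auto intro!: image_eqI[of _ _ "\<zero>\<^bsub>V\<^esub>"])
  next
    case (Cons u us)
    have "k \<otimes> \<phi> u \<oplus> w \<in> \<phi> ` V.span (set vs)" if k: "k \<in> ?K" and w: "w \<in> Span ?K (map \<phi> us)" for k w
    proof -
      obtain a where a: "a \<in> carrier R" "k = a [^] p" using k unfolding pth_powers_def by auto
      obtain w' where w': "w' \<in> V.span (set vs)" "w = \<phi> w'" using w Cons by auto
      have u: "u \<in> V.span (set vs)" using V.in_own_span[OF vs] Cons.prems by auto
      have c: "u \<in> carrier V" "w' \<in> carrier V" using u w' S.subset by auto
      have "\<phi> (a \<odot>\<^bsub>V\<^esub> u \<oplus>\<^bsub>V\<^esub> w') = k \<otimes> \<phi> u \<oplus> w"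
        using a c w' by (simp add: V.form_add V.form_smult)
      moreover have "a \<odot>\<^bsub>V\<^esub> u \<oplus>\<^bsub>V\<^esub> w' \<in> V.span (set vs)" using u w' a by simp
      ultimately show ?thesis by (metis image_eqI)
    qed
    then show ?case by (auto simp: line_extension_mem_iff)
  qed
  moreover have "\<phi> ` V.span (set vs) \<subseteq> Span ?K (map \<phi> vs)"
  proof -
    \<comment> \<open>The preimage of the span under the form is a subspace containing
      \<open>vs\<close>, so it contains everything that they span.\<close>
    have "LinearCombinations.submodule R {v \<in> carrier V. \<phi> v \<in> Span ?K (map \<phi> vs)} V"
    proof (rule submoduleI')
      show "\<zero>\<^bsub>V\<^esub> \<in> {v \<in> carrier V. \<phi> v \<in> Span ?K (map \<phi> vs)}"
        using V.form_zero[OF p_gt_0] Span_subgroup_props(2)[OF kf mc] by simp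
    next
      fix v w assume "v \<in> {v \<in> carrier V. \<phi> v \<in> Span ?K (map \<phi> vs)}" "w \<in> {v \<in> carrier V. \<phi> v \<in> Span ?K (map \<phi> vs)}"
      then show "v \<oplus>\<^bsub>V\<^esub> w \<in> {v \<in> carrier V. \<phi> v \<in> Span ?K (map \<phi> vs)}"
        using Span_subgroup_props(3)[OF kf mc] by (simp add: V.form_add)
    next
      fix c v assume "c \<in> carrier R" "v \<in> {v \<in> carrier V. \<phi> v \<in> Span ?K (map \<phi> vs)}"
      then show "c \<odot>\<^bsub>V\<^esub> v \<in> {v \<in> carrier V. \<phi> v \<in> Span ?K (map \<phi> vs)}"
        using Span_smult_closed[OF kf mc, of "c [^] p" "\<phi> v"] by (auto simp: V.form_smult pth_powers_def)
    qed (auto intro: V.module_axioms)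
    moreover have "set vs \<subseteq> {v \<in> carrier V. \<phi> v \<in> Span ?K (map \<phi> vs)}"
      using Span_base_incl[OF kf mc] vs by auto
    ultimately show ?thesis using V.span_is_subset by blast
  qed
  ultimately show ?thesis by blast
qed

text \<open>An anisotropic form is injective, as an additive map with trivial kernel. A relation
  among the values therefore comes from one among the vectors.\<close>

lemma form_independent:
  assumes q: "quasilinear_form p R V \<phi>" and an: "anisotropic R V \<phi>"
    and "distinct vs" "set vs \<subseteq> carrier V" "\<not> LinearCombinations.module.lin_dep R V (set vs)"
  shows "independent (pth_powers p R) (map \<phi> vs)"
proof -
  interpret V: quasilinear_form p R V \<phi> by (fact q)
  show ?thesis using assms(3-5)
  proof (induction vs)
    case (Cons v vs)
    have li: "V.lin_indpt (set vs)" using V.subset_li_is_li[OF Cons.prems(3), of "set vs"] by auto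
    have c: "v \<in> carrier V" "set vs \<subseteq> carrier V" using Cons.prems by auto
    have "\<phi> v \<notin> Span (pth_powers p R) (map \<phi> vs)"
    proof
      assume "\<phi> v \<in> Span (pth_powers p R) (map \<phi> vs)"
      then obtain w where w: "w \<in> V.span (set vs)" "\<phi> v = \<phi> w"
        using form_image_span[OF q c(2)] by auto
      have wc: "w \<in> carrier V" using w(1) c(2) V.span_is_subset2 by blast
      have "\<phi> (v \<ominus>\<^bsub>V\<^esub> w) \<oplus> \<phi> w = \<phi> v"
        using V.form_add[of "v \<ominus>\<^bsub>V\<^esub> w" w] c wc by (simp add: V.M.minus_eq V.M.a_assoc V.M.l_neg)
      moreover have "\<phi> (v \<ominus>\<^bsub>V\<^esub> w) \<in> carrier R" "\<phi> w \<in> carrier R" using V.form_closed c wc by auto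
      ultimately have "\<phi> (v \<ominus>\<^bsub>V\<^esub> w) = \<zero>" using w(2) by (metis add.r_cancel_one')
      then have "v \<ominus>\<^bsub>V\<^esub> w = \<zero>\<^bsub>V\<^esub>"
        using an c wc unfolding anisotropic_def by (metis V.M.minus_closed)
      moreover have "v = (v \<ominus>\<^bsub>V\<^esub> w) \<oplus>\<^bsub>V\<^esub> w"
        using c wc by (simp add: V.M.minus_eq V.M.a_assoc V.M.l_neg)
      ultimately have "v = w" using wc by (metis V.M.l_zero)
      then show False using w(1) V.lin_dep_iff_in_span[OF c(2) li c(1)] Cons.prems by simp
    qed
    then show ?case using Cons.IH Cons.prems(1) c li V.form_closed by (auto intro: li_Cons)
  qed simp
qed

lemma form_dimension:
  assumes q: "quasilinear_form p R V \<phi>" and an: "anisotropic R V \<phi>"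
  shows "dimension (vectorspace.dim R V) (pth_powers p R) (\<phi> ` carrier V)"
proof -
  interpret V: quasilinear_form p R V \<phi> by (fact q)
  obtain B where B: "finite B" "V.basis B" using V.finite_basis_exists[OF V.finite_dimensional] by blast
  then obtain vs where vs: "set vs = B" "distinct vs" using finite_distinct_list by blast
  have "V.dim = length vs" using V.dim_basis[OF B] vs by (simp add: distinct_card[symmetric])
  then show ?thesis
    using dimension_independent[OF form_independent[OF q an vs(2)]] form_image_span[OF q, of vs] B(2) vs
    unfolding V.basis_def by simp
qed

section \<open>Coordinate spaces and diagonal forms\<close>

lemma combine_eq_finsum:
  assumes "set cs \<subseteq> carrier R" "f \<in> {..<length cs} \<rightarrow> carrier R"
  shows "combine (map f [0..<length cs]) cs = (\<Oplus>i\<in>{..<length cs}. f i \<otimes> cs ! i)"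
  using assms
proof (induction cs arbitrary: f)
  case (Cons c cs)
  let ?n = "length cs"
  let ?g = "\<lambda>i. f i \<otimes> (c # cs) ! i"
  have g: "?g \<in> {..<Suc ?n} \<rightarrow> carrier R"
  proof (rule Pi_I)
    fix i assume i: "i \<in> {..<Suc ?n}"
    then have "(c # cs) ! i \<in> carrier R" using Cons.prems(1) nth_mem[of i "c # cs"] by (auto simp del: nth_mem)
    moreover have "f i \<in> carrier R" using Cons.prems(2) i by auto
    ultimately show "?g i \<in> carrier R" by simp
  qed
  have "combine (map f [0..<length (c # cs)]) (c # cs)
      = f 0 \<otimes> c \<oplus> combine (map (\<lambda>i. f (Suc i)) [0..<?n]) cs"
    by (simp add: upt_conv_Cons map_Suc_upt[symmetric] comp_def del: upt_Suc)
  also have "combine (map (\<lambda>i. f (Suc i)) [0..<?n]) cs = (\<Oplus>i\<in>{..<?n}. ?g (Suc i))"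
    using Cons.IH[of "\<lambda>i. f (Suc i)"] Cons.prems by (auto simp: Pi_def)
  also have "\<dots> = (\<Oplus>i\<in>Suc ` {..<?n}. ?g i)"
    by (rule add.finprod_reindex[symmetric]) (use g in auto)
  also have "f 0 \<otimes> c \<oplus> \<dots> = (\<Oplus>i\<in>insert 0 (Suc ` {..<?n}). ?g i)"
  proof (subst finsum_insert)
    show "?g \<in> Suc ` {..<?n} \<rightarrow> carrier R" using g by auto
    show "?g 0 \<in> carrier R" using Pi_mem[OF g, of 0] by blast
  qed auto
  also have "insert 0 (Suc ` {..<?n}) = {..<length (c # cs)}"
    by (auto simp: image_iff less_Suc_eq_0_disj)
  finally show ?case .
qed simp

lemma coord_space_simps [simp]:
  "carrier (coord_space R n) = {..<n} \<rightarrow>\<^sub>E carrier R"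
  "\<zero>\<^bsub>coord_space R n\<^esub> = (\<lambda>i\<in>{..<n}. \<zero>)"
  "v \<oplus>\<^bsub>coord_space R n\<^esub> w = (\<lambda>i\<in>{..<n}. v i \<oplus> w i)"
  "a \<odot>\<^bsub>coord_space R n\<^esub> v = (\<lambda>i\<in>{..<n}. a \<otimes> v i)"
  by (simp_all add: func_space_def)

lemma coord_space_vectorspace: "vectorspace R (coord_space R n)"
proof -
  have "Module.module R (coord_space R n)" by (rule func_space_is_module)
  then show ?thesis unfolding vectorspace_def using field_axioms by simp
qed

definition unit_coord :: "nat \<Rightarrow> nat \<Rightarrow> nat \<Rightarrow> 'a" where
  "unit_coord n j = (\<lambda>i\<in>{..<n}. if i = j then \<one> else \<zero>)"

lemma unit_coord_closed: "unit_coord n j \<in> carrier (coord_space R n)"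
  by (auto simp: unit_coord_def)

lemma unit_coord_inj: "inj_on (unit_coord n) {..<n}"
proof (rule inj_onI)
  fix i j assume "i \<in> {..<n}" "j \<in> {..<n}" "unit_coord n i = unit_coord n j"
  then have "i < n" "unit_coord n i i = unit_coord n j i" by simp_all
  then show "i = j" unfolding unit_coord_def by (simp split: if_splits)
qed

text \<open>The bound \<open>k\<close> serves the induction, but it is also used on its own: vectors
  supported on the first coordinates occur in the construction of an extended form.\<close>

lemma mem_span_unit_coord:
  assumes "k \<le> n" "v \<in> carrier (coord_space R n)" "\<And>i. k \<le> i \<Longrightarrow> i < n \<Longrightarrow> v i = \<zero>"
  shows "v \<in> LinearCombinations.module.span R (coord_space R n) (unit_coord n ` {..<k})"
  using assms
proof (induction k arbitrary: v)
  case 0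
  interpret V: vectorspace R "coord_space R n" by (rule coord_space_vectorspace)
  have "v = \<zero>\<^bsub>coord_space R n\<^esub>" using 0 by (auto simp: fun_eq_iff PiE_def extensional_def)
  show ?case unfolding \<open>v = \<zero>\<^bsub>coord_space R n\<^esub>\<close> by (rule V.span_zero)
next
  case (Suc k)
  interpret V: vectorspace R "coord_space R n" by (rule coord_space_vectorspace)
  let ?S = "unit_coord n ` {..<Suc k}"
  have Sc: "?S \<subseteq> carrier (coord_space R n)" using unit_coord_closed by blast
  interpret S: LinearCombinations.submodule R "V.span ?S" "coord_space R n"
    using V.span_is_submodule[OF Sc] .
  define w where "w = (\<lambda>i\<in>{..<n}. if i = k then \<zero> else v i)"
  have wc: "w \<in> carrier (coord_space R n)" using Suc.prems by (auto simp: w_def)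
  have "w \<in> V.span (unit_coord n ` {..<k})"
  proof (rule Suc.IH[OF _ wc])
    show "w i = \<zero>" if "k \<le> i" "i < n" for i using that Suc.prems(3)[of i] by (simp add: w_def)
  qed (use Suc.prems in simp)
  moreover have "unit_coord n ` {..<k} \<subseteq> ?S" by auto
  ultimately have w: "w \<in> V.span ?S" using V.span_is_monotone by blast
  have vk: "v k \<in> carrier R" using Suc.prems by auto
  have "unit_coord n k \<in> V.span ?S" using V.in_own_span[OF Sc] by auto
  then have "v k \<odot>\<^bsub>coord_space R n\<^esub> unit_coord n k \<oplus>\<^bsub>coord_space R n\<^esub> w \<in> V.span ?S"
    using w vk S.m_closed S.smult_closed by blast
  moreover have "v k \<odot>\<^bsub>coord_space R n\<^esub> unit_coord n k \<oplus>\<^bsub>coord_space R n\<^esub> w = v"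
  proof
    fix i
    have "i < n \<Longrightarrow> v i \<in> carrier R" using Suc.prems by auto
    moreover have "\<not> i < n \<Longrightarrow> v i = undefined" using Suc.prems by (auto simp: PiE_def extensional_def)
    ultimately show "(v k \<odot>\<^bsub>coord_space R n\<^esub> unit_coord n k \<oplus>\<^bsub>coord_space R n\<^esub> w) i = v i"
      using vk Suc.prems by (auto simp: unit_coord_def w_def)
  qed
  ultimately show ?case by simp
qed

lemma unit_coord_basis: "vectorspace.basis R (coord_space R n) (unit_coord n ` {..<n})"
proof -
  interpret V: vectorspace R "coord_space R n" by (rule coord_space_vectorspace)
  have Sc: "unit_coord n ` {..<k} \<subseteq> carrier (coord_space R n)" for k using unit_coord_closed by blast
  have "carrier (coord_space R n) \<subseteq> V.span (unit_coord n ` {..<n})"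
    using mem_span_unit_coord[of n n] by auto
  then have gen: "V.span (unit_coord n ` {..<n}) = carrier (coord_space R n)"
    using V.span_is_subset2[OF Sc] by blast
  have "V.lin_indpt (unit_coord n ` {..<k})" if "k \<le> n" for k
    using that
  proof (induction k)
    case 0
    show ?case by (simp add: V.lin_dep_def)
  next
    case (Suc k)
    \<comment> \<open>The vectors with vanishing coordinate \<open>k\<close> form a subspace that
      contains the earlier unit vectors but not the next one.\<close>
    let ?N = "{v \<in> carrier (coord_space R n). v k = \<zero>}"
    have "LinearCombinations.submodule R ?N (coord_space R n)"
      by (rule submoduleI') (use Suc.prems V.module_axioms in auto)
    moreover have "unit_coord n ` {..<k} \<subseteq> ?N"
      using Suc.prems Sc by (auto simp: unit_coord_def)
    ultimately have "V.span (unit_coord n ` {..<k}) \<subseteq> ?N" by (rule V.span_is_subset[rotated])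
    then have "unit_coord n k \<notin> V.span (unit_coord n ` {..<k})"
      using Suc.prems by (auto simp: unit_coord_def)
    moreover have "unit_coord n k \<notin> unit_coord n ` {..<k}"
      using inj_onD[OF unit_coord_inj[of n], of k] Suc.prems by fastforce
    ultimately have "V.lin_indpt (unit_coord n ` {..<k} \<union> {unit_coord n k})"
      using V.lin_dep_iff_in_span[OF Sc, of k "unit_coord n k"] Suc unit_coord_closed by auto
    then show ?case by (simp add: lessThan_Suc)
  qed
  then show ?thesis using gen Sc unfolding V.basis_def by blast
qed

lemma coord_space_dim: "vectorspace.dim R (coord_space R n) = n" "vectorspace.fin_dim R (coord_space R n)"
proof -
  interpret V: vectorspace R "coord_space R n" by (rule coord_space_vectorspace)
  show "V.dim = n"
    using V.dim_basis[OF _ unit_coord_basis] unit_coord_inj[of n] by (simp add: card_image)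
  show "V.fin_dim"
    unfolding V.fin_dim_def using unit_coord_basis[of n, unfolded V.basis_def]
    by (intro exI[of _ "unit_coord n ` {..<n}"]) simp
qed

lemma diag_form_eq_combine:
  assumes "set cs \<subseteq> carrier R" "v \<in> {..<length cs} \<rightarrow> carrier R"
  shows "diag_form p R cs v = combine (map (\<lambda>i. v i [^] p) [0..<length cs]) cs"
proof -
  have t: "v i \<in> carrier R" "cs ! i \<in> carrier R" if "i < length cs" for i
    using Pi_mem[OF assms(2), of i] subsetD[OF assms(1) nth_mem[OF that]] that by simp_all
  have "diag_form p R cs v = (\<Oplus>i\<in>{..<length cs}. v i [^] p \<otimes> cs ! i)"
    unfolding diag_form_def
  proof (rule finsum_cong')
    show "cs ! i \<otimes> v i [^] p = v i [^] p \<otimes> cs ! i" if "i \<in> {..<length cs}" for i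
      using t[of i] that m_comm by simp
    show "(\<lambda>i. v i [^] p \<otimes> cs ! i) \<in> {..<length cs} \<rightarrow> carrier R"
      using t by (intro Pi_I) simp
  qed simp
  also have "\<dots> = combine (map (\<lambda>i. v i [^] p) [0..<length cs]) cs"
    using t by (intro combine_eq_finsum[symmetric] assms(1) Pi_I) simp
  finally show ?thesis .
qed

lemma diag_form_quasilinear:
  assumes cs: "set cs \<subseteq> carrier R"
  shows "quasilinear_form p R (coord_space R (length cs)) (diag_form p R cs)"
proof -
  let ?n = "length cs"
  have c: "cs ! i \<in> carrier R" if "i < ?n" for i using subsetD[OF cs nth_mem[OF that]] .
  interpret V: vectorspace R "coord_space R ?n" by (rule coord_space_vectorspace)
  have vc: "v i \<in> carrier R" if "v \<in> carrier (coord_space R ?n)" "i < ?n" for v i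
    using PiE_mem[of v "{..<?n}" "\<lambda>_. carrier R" i] that by simp
  have t: "(\<lambda>i. cs ! i \<otimes> v i [^] p) \<in> {..<?n} \<rightarrow> carrier R" if "v \<in> carrier (coord_space R ?n)" for v
    using vc[OF that] c by (intro Pi_I) simp
  show ?thesis
  proof (intro quasilinear_form.intro quasilinear_form_axioms.intro)
    show "vectorspace R (coord_space R ?n)" by (rule coord_space_vectorspace)
    show "V.fin_dim" by (rule coord_space_dim)
    show "diag_form p R cs \<in> carrier (coord_space R ?n) \<rightarrow> carrier R"
    proof (rule Pi_I)
      fix v assume v: "v \<in> carrier (coord_space R ?n)"
      show "diag_form p R cs v \<in> carrier R" unfolding diag_form_def by (rule finsum_closed[OF t[OF v]])
    qed
  next
    fix a v assume a: "a \<in> carrier R" and v: "v \<in> carrier (coord_space R ?n)"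
    have "a [^] p \<otimes> (\<Oplus>i\<in>{..<?n}. cs ! i \<otimes> v i [^] p) = (\<Oplus>i\<in>{..<?n}. a [^] p \<otimes> (cs ! i \<otimes> v i [^] p))"
      using finsum_rdistr[OF _ _ t[OF v], of "a [^] p"] a by simp
    also have "\<dots> = (\<Oplus>i\<in>{..<?n}. cs ! i \<otimes> (a \<odot>\<^bsub>coord_space R ?n\<^esub> v) i [^] p)"
    proof (rule finsum_cong'[OF refl t])
      show "a \<odot>\<^bsub>coord_space R ?n\<^esub> v \<in> carrier (coord_space R ?n)" using a v by (rule V.smult_closed)
      fix i assume "i \<in> {..<?n}"
      then show "a [^] p \<otimes> (cs ! i \<otimes> v i [^] p) = cs ! i \<otimes> (a \<odot>\<^bsub>coord_space R ?n\<^esub> v) i [^] p"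
        using vc[OF v, of i] c[of i] a by (simp add: nat_pow_distrib m_lcomm)
    qed
    finally show "diag_form p R cs (a \<odot>\<^bsub>coord_space R ?n\<^esub> v) = a [^] p \<otimes> diag_form p R cs v"
      unfolding diag_form_def ..
  next
    fix v w assume v: "v \<in> carrier (coord_space R ?n)" and w: "w \<in> carrier (coord_space R ?n)"
    have "(\<Oplus>i\<in>{..<?n}. cs ! i \<otimes> v i [^] p) \<oplus> (\<Oplus>i\<in>{..<?n}. cs ! i \<otimes> w i [^] p)
        = (\<Oplus>i\<in>{..<?n}. cs ! i \<otimes> v i [^] p \<oplus> cs ! i \<otimes> w i [^] p)"
      by (rule finsum_addf[OF t[OF v] t[OF w], symmetric])
    also have "\<dots> = (\<Oplus>i\<in>{..<?n}. cs ! i \<otimes> (v \<oplus>\<^bsub>coord_space R ?n\<^esub> w) i [^] p)"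
    proof (rule finsum_cong'[OF refl t])
      show "v \<oplus>\<^bsub>coord_space R ?n\<^esub> w \<in> carrier (coord_space R ?n)" using v w by (rule V.M.a_closed)
      fix i assume "i \<in> {..<?n}"
      then show "cs ! i \<otimes> v i [^] p \<oplus> cs ! i \<otimes> w i [^] p = cs ! i \<otimes> (v \<oplus>\<^bsub>coord_space R ?n\<^esub> w) i [^] p"
        using vc[OF v, of i] vc[OF w, of i] c[of i] by (simp add: frob_add r_distr)
    qed
    finally show "diag_form p R cs (v \<oplus>\<^bsub>coord_space R ?n\<^esub> w) = diag_form p R cs v \<oplus> diag_form p R cs w"
      unfolding diag_form_def ..
  qed
qed

lemma diag_form_unit_coord:
  assumes "set cs \<subseteq> carrier R" "j < length cs"
  shows "diag_form p R cs (unit_coord (length cs) j) = cs ! j"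
proof -
  have c: "cs ! i \<in> carrier R" if "i < length cs" for i using subsetD[OF assms(1) nth_mem[OF that]] .
  have "diag_form p R cs (unit_coord (length cs) j) = (\<Oplus>i\<in>{..<length cs}. if i = j then cs ! i else \<zero>)"
    unfolding diag_form_def
  proof (rule finsum_cong')
    show "(\<lambda>i. if i = j then cs ! i else \<zero>) \<in> {..<length cs} \<rightarrow> carrier R" using c by (intro Pi_I) simp
    fix i assume "i \<in> {..<length cs}"
    then show "cs ! i \<otimes> unit_coord (length cs) j i [^] p = (if i = j then cs ! i else \<zero>)"
      using c[of i] p_gt_0 by (cases "i = j") (simp_all add: unit_coord_def nat_pow_zero)
  qed simp
  also have "\<dots> = cs ! j"
    using add.finprod_singleton_swap[of j "{..<length cs}" "(!) cs"] assms(2) c by (simp add: Pi_I)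
  finally show ?thesis .
qed

lemma diag_form_image:
  assumes cs: "set cs \<subseteq> carrier R"
  shows "diag_form p R cs ` carrier (coord_space R (length cs)) = Span (pth_powers p R) cs"
proof -
  let ?n = "length cs"
  interpret V: vectorspace R "coord_space R ?n" by (rule coord_space_vectorspace)
  let ?es = "map (unit_coord ?n) [0..<?n]"
  have sp: "V.span (set ?es) = carrier (coord_space R ?n)"
    using unit_coord_basis[of ?n] unfolding V.basis_def by (simp add: atLeast0LessThan)
  have m: "map (diag_form p R cs) ?es = cs"
    using diag_form_unit_coord[OF cs] by (intro nth_equalityI) simp_all
  have "set ?es \<subseteq> carrier (coord_space R ?n)" using unit_coord_closed by (auto simp del: coord_space_simps)
  from form_image_span[OF diag_form_quasilinear[OF cs] this] show ?thesis unfolding sp m .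
qed

lemma diag_form_append_zeros:
  assumes "set cs \<subseteq> carrier R" "v \<in> {..<length cs + k} \<rightarrow> carrier R"
  shows "diag_form p R (cs @ replicate k \<zero>) v = diag_form p R cs v"
proof -
  have c: "cs ! i \<in> carrier R" if "i < length cs" for i using subsetD[OF assms(1) nth_mem[OF that]] .
  have v: "v i \<in> carrier R" if "i < length cs + k" for i using Pi_mem[OF assms(2), of i] that by simp
  have t: "(cs @ replicate k \<zero>) ! i \<otimes> v i [^] p \<in> carrier R" if "i < length cs + k" for i
    using c v[OF that] that by (simp add: nth_append)
  show ?thesis unfolding diag_form_def
  proof (rule add.finprod_mono_neutral_cong_right)
    fix i assume "i \<in> {..<length (cs @ replicate k \<zero>)} - {..<length cs}"
    then have i: "\<not> i < length cs" "i < length cs + k" "i - length cs < k" by auto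
    then show "(cs @ replicate k \<zero>) ! i \<otimes> v i [^] p = \<zero>" using v[OF i(2)] by (simp add: nth_append)
  next
    show "(\<lambda>i. (cs @ replicate k \<zero>) ! i \<otimes> v i [^] p) \<in> {..<length (cs @ replicate k \<zero>)} \<rightarrow> carrier R"
      using t by (intro Pi_I) simp
  qed (simp_all add: nth_append)
qed

lemma diag_form_cong:
  assumes "set cs \<subseteq> carrier R" "v \<in> {..<length cs} \<rightarrow> carrier R" "\<And>i. i < length cs \<Longrightarrow> v i = w i"
  shows "diag_form p R cs v = diag_form p R cs w"
proof -
  have c: "cs ! i \<in> carrier R" if "i < length cs" for i using subsetD[OF assms(1) nth_mem[OF that]] .
  have v: "w i \<in> carrier R" if "i < length cs" for i
    using Pi_mem[OF assms(2), of i] assms(3)[OF that] that by simp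
  show ?thesis unfolding diag_form_def
    by (rule finsum_cong') (simp_all add: assms(3) c v)
qed

text \<open>A zero of the form is a relation among the \<open>cs\<close> whose coefficients are the
  p-th powers of the coordinates; these vanish only with the coordinates.\<close>

lemma diag_form_anisotropic:
  assumes "independent (pth_powers p R) cs"
  shows "anisotropic R (coord_space R (length cs)) (diag_form p R cs)"
  unfolding anisotropic_def
proof (intro ballI impI)
  note cs = independent_in_carrier[OF assms]
  fix v assume v: "v \<in> carrier (coord_space R (length cs))" and "diag_form p R cs v = \<zero>"
  then have z: "diag_form p R cs v = \<zero>" by simp
  have vc: "v i \<in> carrier R" if "i < length cs" for i
    using PiE_mem[of v "{..<length cs}" "\<lambda>_. carrier R" i] v that by simp
  have "combine (map (\<lambda>i. v i [^] p) [0..<length cs]) cs = \<zero>"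
    using diag_form_eq_combine[OF cs Pi_I, of v] z vc by simp
  moreover have "set (map (\<lambda>i. v i [^] p) [0..<length cs]) \<subseteq> pth_powers p R"
    using vc unfolding pth_powers_def by auto
  ultimately have "set (take (length cs) (map (\<lambda>i. v i [^] p) [0..<length cs])) \<subseteq> {\<zero>}"
    using independent_imp_trivial_combine[OF pth_powers_subfield assms] by blast
  then have "v i [^] p = \<zero>" if "i < length cs" for i
    using that by (simp add: image_subset_iff)
  then have vz: "v i = \<zero>" if "i < length cs" for i
    using nat_pow_eq_zero[OF vc[OF that]] that by blast
  show "v = \<zero>\<^bsub>coord_space R (length cs)\<^esub>"
  proof (rule ext)
    fix i
    show "v i = \<zero>\<^bsub>coord_space R (length cs)\<^esub> i"
      using vz[of i] v PiE_arb[of v "{..<length cs}" "\<lambda>_. carrier R" i] by (cases "i < length cs") simp_all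
  qed
qed

end

section \<open>Base change\<close>

lemma (in vectorspace) coordinates_exist:
  assumes B: "finite B" "basis B"
  obtains c where "\<And>v. v \<in> carrier V \<Longrightarrow> c v \<in> B \<rightarrow>\<^sub>E carrier K"
    and "\<And>v w b. v \<in> carrier V \<Longrightarrow> w \<in> carrier V \<Longrightarrow> b \<in> B \<Longrightarrow> c (v \<oplus>\<^bsub>V\<^esub> w) b = c v b \<oplus>\<^bsub>K\<^esub> c w b"
    and "\<And>a v b. a \<in> carrier K \<Longrightarrow> v \<in> carrier V \<Longrightarrow> b \<in> B \<Longrightarrow> c (a \<odot>\<^bsub>V\<^esub> v) b = a \<otimes>\<^bsub>K\<^esub> c v b"
    and "\<And>u b. u \<in> B \<Longrightarrow> b \<in> B \<Longrightarrow> c u b = (if b = u then \<one>\<^bsub>K\<^esub> else \<zero>\<^bsub>K\<^esub>)"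
proof -
  have BV: "B \<subseteq> carrier V" using B(2) unfolding basis_def by simp
  have uni: "\<exists>!a. a \<in> B \<rightarrow>\<^sub>E carrier K \<and> lincomb a B = v" if v: "v \<in> carrier V" for v
    using basis_criterion[OF B(1) BV] B(2) v by blast
  define c where "c v = (THE a. a \<in> B \<rightarrow>\<^sub>E carrier K \<and> lincomb a B = v)" for v
  have c: "c v \<in> B \<rightarrow>\<^sub>E carrier K" "lincomb (c v) B = v" if "v \<in> carrier V" for v
    using theI'[OF uni[OF that]] unfolding c_def by auto
  \<comment> \<open>Uniqueness of coordinates holds among functions that are undefined off
    \<open>B\<close>, so a candidate is restricted to \<open>B\<close> before it is
    compared.\<close>
  have c_eq: "c v b = a b" if "a \<in> B \<rightarrow> carrier K" "lincomb a B = v" "b \<in> B" for v a b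
  proof -
    have r: "restrict a B \<in> B \<rightarrow>\<^sub>E carrier K" using that(1) by simp
    have "lincomb (restrict a B) B = lincomb a B"
      by (rule lincomb_cong[OF refl BV _ that(1)]) simp
    then have l: "lincomb (restrict a B) B = v" using that(2) by simp
    have v: "v \<in> carrier V" using lincomb_closed[OF BV that(1)] that(2) by simp
    have "c v = restrict a B" using uni[OF v] c[OF v] r l by blast
    then show ?thesis using that(3) by simp
  qed
  have cP: "c v \<in> B \<rightarrow> carrier K" if "v \<in> carrier V" for v using c(1)[OF that] by auto
  have cm: "c v b \<in> carrier K" if "v \<in> carrier V" "b \<in> B" for v b using cP[OF that(1)] that(2) by auto
  show ?thesis
  proof (rule that[of c])
    show "c v \<in> B \<rightarrow>\<^sub>E carrier K" if "v \<in> carrier V" for v using c(1)[OF that] .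
  next
    fix v w b assume vw: "v \<in> carrier V" "w \<in> carrier V" and b: "b \<in> B"
    show "c (v \<oplus>\<^bsub>V\<^esub> w) b = c v b \<oplus>\<^bsub>K\<^esub> c w b"
    proof (rule c_eq[OF _ _ b])
      show "(\<lambda>b. c v b \<oplus>\<^bsub>K\<^esub> c w b) \<in> B \<rightarrow> carrier K" using cm vw by (intro Pi_I) simp
      show "lincomb (\<lambda>b. c v b \<oplus>\<^bsub>K\<^esub> c w b) B = v \<oplus>\<^bsub>V\<^esub> w"
        using lincomb_sum[OF B(1) BV cP[OF vw(1)] cP[OF vw(2)]] c(2) vw by simp
    qed
  next
    fix a v b assume a: "a \<in> carrier K" and v: "v \<in> carrier V" and b: "b \<in> B"
    show "c (a \<odot>\<^bsub>V\<^esub> v) b = a \<otimes>\<^bsub>K\<^esub> c v b"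
    proof (rule c_eq[OF _ _ b])
      show "(\<lambda>b. a \<otimes>\<^bsub>K\<^esub> c v b) \<in> B \<rightarrow> carrier K" using cm v a by (intro Pi_I) simp
      show "lincomb (\<lambda>b. a \<otimes>\<^bsub>K\<^esub> c v b) B = a \<odot>\<^bsub>V\<^esub> v"
        using lincomb_smult[OF BV cP[OF v] a] c(2) v by simp
    qed
  next
    fix u b assume u: "u \<in> B" and b: "b \<in> B"
    show "c u b = (if b = u then \<one>\<^bsub>K\<^esub> else \<zero>\<^bsub>K\<^esub>)"
    proof (rule c_eq[OF _ _ b])
      show "(\<lambda>b. if b = u then \<one>\<^bsub>K\<^esub> else \<zero>\<^bsub>K\<^esub>) \<in> B \<rightarrow> carrier K" by (intro Pi_I) simp
      have bc: "b \<in> carrier V" if "b \<in> B" for b using BV that by blast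
      have "lincomb (\<lambda>b. if b = u then \<one>\<^bsub>K\<^esub> else \<zero>\<^bsub>K\<^esub>) B = (\<Oplus>\<^bsub>V\<^esub>b\<in>B. if b = u then b else \<zero>\<^bsub>V\<^esub>)"
        unfolding lincomb_def
      proof (rule M.finsum_cong')
        show "(\<lambda>b. if b = u then b else \<zero>\<^bsub>V\<^esub>) \<in> B \<rightarrow> carrier V" using bc by (intro Pi_I) (auto simp: u)
      next
        show "(if b = u then \<one>\<^bsub>K\<^esub> else \<zero>\<^bsub>K\<^esub>) \<odot>\<^bsub>V\<^esub> b = (if b = u then b else \<zero>\<^bsub>V\<^esub>)" if "b \<in> B" for b
          using bc[OF that] by (cases "b = u") simp_all
      qed simp
      also have "\<dots> = u" using M.add.finprod_singleton_swap[OF u B(1), of "\<lambda>b. b"] bc by (simp add: Pi_I)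
      finally show "lincomb (\<lambda>b. if b = u then \<one>\<^bsub>K\<^esub> else \<zero>\<^bsub>K\<^esub>) B = u" .
    qed
  qed
qed

text \<open>The map applies \<open>h\<close> to the coordinates. It becomes the canonical map of a
  base change once the vectors \<open>w b\<close> form a basis of \<open>W\<close>.\<close>

lemma semilinear_extension_exists:
  assumes U: "vectorspace F U" and W: "vectorspace E W" and h: "h \<in> ring_hom F E"
    and B: "finite B" "vectorspace.basis F U B" and w: "w \<in> B \<rightarrow> carrier W"
  obtains \<iota> where "\<iota> \<in> carrier U \<rightarrow> carrier W"
    and "\<And>u v. u \<in> carrier U \<Longrightarrow> v \<in> carrier U \<Longrightarrow> \<iota> (u \<oplus>\<^bsub>U\<^esub> v) = \<iota> u \<oplus>\<^bsub>W\<^esub> \<iota> v"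
    and "\<And>a v. a \<in> carrier F \<Longrightarrow> v \<in> carrier U \<Longrightarrow> \<iota> (a \<odot>\<^bsub>U\<^esub> v) = h a \<odot>\<^bsub>W\<^esub> \<iota> v"
    and "\<And>b. b \<in> B \<Longrightarrow> \<iota> b = w b"
proof -
  interpret U: vectorspace F U by (fact U)
  interpret W: vectorspace E W by (fact W)
  interpret h: ring_hom_ring F E h
    using ring_hom_ringI2[OF U.ring_axioms W.ring_axioms h] .
  have BU: "B \<subseteq> carrier U" using B(2) unfolding U.basis_def by simp
  obtain c where c: "\<And>v. v \<in> carrier U \<Longrightarrow> c v \<in> B \<rightarrow>\<^sub>E carrier F"
    and cadd: "\<And>v w b. v \<in> carrier U \<Longrightarrow> w \<in> carrier U \<Longrightarrow> b \<in> B \<Longrightarrow> c (v \<oplus>\<^bsub>U\<^esub> w) b = c v b \<oplus>\<^bsub>F\<^esub> c w b"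
    and csm: "\<And>a v b. a \<in> carrier F \<Longrightarrow> v \<in> carrier U \<Longrightarrow> b \<in> B \<Longrightarrow> c (a \<odot>\<^bsub>U\<^esub> v) b = a \<otimes>\<^bsub>F\<^esub> c v b"
    and cB: "\<And>u b. u \<in> B \<Longrightarrow> b \<in> B \<Longrightarrow> c u b = (if b = u then \<one>\<^bsub>F\<^esub> else \<zero>\<^bsub>F\<^esub>)"
    using U.coordinates_exist[OF B] by blast
  have cm: "c v b \<in> carrier F" if "v \<in> carrier U" "b \<in> B" for v b using PiE_mem[OF c[OF that(1)] that(2)] .
  have wm: "w b \<in> carrier W" if "b \<in> B" for b using Pi_mem[OF w that] .
  define \<iota> where "\<iota> v = (\<Oplus>\<^bsub>W\<^esub>b\<in>B. h (c v b) \<odot>\<^bsub>W\<^esub> w b)" for v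
  have t: "(\<lambda>b. h (c v b) \<odot>\<^bsub>W\<^esub> w b) \<in> B \<rightarrow> carrier W" if "v \<in> carrier U" for v
    using cm[OF that] wm by (intro Pi_I) simp
  show ?thesis
  proof (rule that[of \<iota>])
    show "\<iota> \<in> carrier U \<rightarrow> carrier W"
      unfolding \<iota>_def by (intro Pi_I W.M.finsum_closed t)
  next
    fix u v assume uv: "u \<in> carrier U" "v \<in> carrier U"
    have "\<iota> (u \<oplus>\<^bsub>U\<^esub> v) = (\<Oplus>\<^bsub>W\<^esub>b\<in>B. h (c u b) \<odot>\<^bsub>W\<^esub> w b \<oplus>\<^bsub>W\<^esub> h (c v b) \<odot>\<^bsub>W\<^esub> w b)"
      unfolding \<iota>_def
    proof (rule W.M.finsum_cong')
      show "(\<lambda>b. h (c u b) \<odot>\<^bsub>W\<^esub> w b \<oplus>\<^bsub>W\<^esub> h (c v b) \<odot>\<^bsub>W\<^esub> w b) \<in> B \<rightarrow> carrier W"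
        using cm uv wm by (intro Pi_I) simp
      show "h (c (u \<oplus>\<^bsub>U\<^esub> v) b) \<odot>\<^bsub>W\<^esub> w b = h (c u b) \<odot>\<^bsub>W\<^esub> w b \<oplus>\<^bsub>W\<^esub> h (c v b) \<odot>\<^bsub>W\<^esub> w b" if "b \<in> B" for b
        using cadd[OF uv that] cm[OF uv(1) that] cm[OF uv(2) that] wm[OF that] by (simp add: W.smult_l_distr)
    qed simp
    also have "\<dots> = \<iota> u \<oplus>\<^bsub>W\<^esub> \<iota> v"
      unfolding \<iota>_def by (rule W.M.finsum_addf[OF t[OF uv(1)] t[OF uv(2)]])
    finally show "\<iota> (u \<oplus>\<^bsub>U\<^esub> v) = \<iota> u \<oplus>\<^bsub>W\<^esub> \<iota> v" .
  next
    fix a v assume a: "a \<in> carrier F" and v: "v \<in> carrier U"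
    have "\<iota> (a \<odot>\<^bsub>U\<^esub> v) = (\<Oplus>\<^bsub>W\<^esub>b\<in>B. h a \<odot>\<^bsub>W\<^esub> (h (c v b) \<odot>\<^bsub>W\<^esub> w b))"
      unfolding \<iota>_def
    proof (rule W.M.finsum_cong')
      show "(\<lambda>b. h a \<odot>\<^bsub>W\<^esub> (h (c v b) \<odot>\<^bsub>W\<^esub> w b)) \<in> B \<rightarrow> carrier W"
        using cm v wm a by (intro Pi_I) simp
      show "h (c (a \<odot>\<^bsub>U\<^esub> v) b) \<odot>\<^bsub>W\<^esub> w b = h a \<odot>\<^bsub>W\<^esub> (h (c v b) \<odot>\<^bsub>W\<^esub> w b)" if "b \<in> B" for b
        using csm[OF a v that] cm[OF v that] wm[OF that] a by (simp add: W.smult_assoc1)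
    qed simp
    also have "\<dots> = h a \<odot>\<^bsub>W\<^esub> \<iota> v"
      unfolding \<iota>_def using W.finsum_smult[OF _ t[OF v], of "h a"] a by (simp add: comp_def)
    finally show "\<iota> (a \<odot>\<^bsub>U\<^esub> v) = h a \<odot>\<^bsub>W\<^esub> \<iota> v" .
  next
    fix b assume b: "b \<in> B"
    have "\<iota> b = (\<Oplus>\<^bsub>W\<^esub>b'\<in>B. if b' = b then w b' else \<zero>\<^bsub>W\<^esub>)"
      unfolding \<iota>_def
    proof (rule W.M.finsum_cong')
      show "(\<lambda>b'. if b' = b then w b' else \<zero>\<^bsub>W\<^esub>) \<in> B \<rightarrow> carrier W" using wm by (intro Pi_I) (auto simp: b)
      show "h (c b b') \<odot>\<^bsub>W\<^esub> w b' = (if b' = b then w b' else \<zero>\<^bsub>W\<^esub>)" if "b' \<in> B" for b'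
        using cB[OF b that] wm[OF that] by (cases "b' = b") simp_all
    qed simp
    also have "\<dots> = w b" using W.M.add.finprod_singleton_swap[OF b B(1) w] by simp
    finally show "\<iota> b = w b" .
  qed
qed

lemma char_p_field_hom:
  assumes "char_p_field F p" "field E" "h \<in> ring_hom F E"
  shows "char_p_field E p"
proof -
  interpret F: char_p_field F p by (fact assms(1))
  interpret E: field E by (fact assms(2))
  interpret h: ring_hom_ring F E h using ring_hom_ringI2[OF F.ring_axioms E.ring_axioms assms(3)] .
  have "h ([n] \<cdot>\<^bsub>F\<^esub> \<one>\<^bsub>F\<^esub>) = [n] \<cdot>\<^bsub>E\<^esub> \<one>\<^bsub>E\<^esub>" for n :: nat by (induction n) simp_all
  from this[of p] have "[p] \<cdot>\<^bsub>E\<^esub> \<one>\<^bsub>E\<^esub> = \<zero>\<^bsub>E\<^esub>" using F.char_p by simp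
  then show ?thesis using F.prime_p assms(2) by (simp add: char_p_field_def char_p_field_axioms_def)
qed

section \<open>Anisotropic parts and extended forms\<close>

lemma isometric_image:
  assumes "isometric K V \<phi> W \<psi>"
  shows "\<phi> ` carrier V = \<psi> ` carrier W"
proof -
  obtain f where "bij_betw f (carrier V) (carrier W)" "\<And>v. v \<in> carrier V \<Longrightarrow> \<psi> (f v) = \<phi> v"
    using assms unfolding isometric_def by blast
  then have "\<phi> ` carrier V = (\<lambda>v. \<psi> (f v)) ` carrier V" "f ` carrier V = carrier W"
    by (auto simp: bij_betw_def)
  then show ?thesis by (metis image_image)
qed

text \<open>The zero summand contributes no values, so a form and its anisotropic part have the same
  values. The dimension can thus be read off from the values, whichever anisotropic part is
  chosen.\<close>

lemma (in char_p_field) anisotropic_part_dimension: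
  assumes "anisotropic_part p R W \<psi> A \<alpha>"
  shows "dimension (vectorspace.dim R A) (pth_powers p R) (\<psi> ` carrier W)"
proof -
  have q: "quasilinear_form p R A \<alpha>" and an: "anisotropic R A \<alpha>"
    using assms unfolding anisotropic_part_def by auto
  interpret A: quasilinear_form p R A \<alpha> by (fact q)
  obtain k where k: "isometric R W \<psi> (direct_sum A (coord_space R k)) (perp R \<alpha> (diag_form p R (replicate k \<zero>)))"
    using assms unfolding anisotropic_part_def by blast
  have z: "diag_form p R (replicate k \<zero>) x = \<zero>" if "x \<in> carrier (coord_space R k)" for x
  proof -
    have "x i \<in> carrier R" if "i < k" for i
      using PiE_mem[of x "{..<k}" "\<lambda>_. carrier R" i] that \<open>x \<in> carrier (coord_space R k)\<close> by simp
    then have "diag_form p R ([] @ replicate k \<zero>) x = diag_form p R [] x"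
      by (intro diag_form_append_zeros Pi_I) simp_all
    then show ?thesis by (simp add: diag_form_def)
  qed
  have "perp R \<alpha> (diag_form p R (replicate k \<zero>)) ` (carrier A \<times> carrier (coord_space R k)) = \<alpha> ` carrier A"
  proof (intro equalityI subsetI)
    fix y assume "y \<in> perp R \<alpha> (diag_form p R (replicate k \<zero>)) ` (carrier A \<times> carrier (coord_space R k))"
    then obtain v x where vx: "v \<in> carrier A" "x \<in> carrier (coord_space R k)"
      "y = \<alpha> v \<oplus> diag_form p R (replicate k \<zero>) x"
      by (auto simp: perp_def simp del: coord_space_simps)
    then have "y = \<alpha> v" using z[OF vx(2)] Pi_mem[OF A.form_closed vx(1)] by simp
    then show "y \<in> \<alpha> ` carrier A" using vx(1) by blast
  next
    fix y assume "y \<in> \<alpha> ` carrier A"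
    then obtain v where v: "v \<in> carrier A" "y = \<alpha> v" by blast
    let ?x = "\<zero>\<^bsub>coord_space R k\<^esub>"
    have x: "?x \<in> carrier (coord_space R k)" by simp
    have "y = perp R \<alpha> (diag_form p R (replicate k \<zero>)) (v, ?x)"
      unfolding perp_def using z[OF x] Pi_mem[OF A.form_closed v(1)] v(2) by simp
    then show "y \<in> perp R \<alpha> (diag_form p R (replicate k \<zero>)) ` (carrier A \<times> carrier (coord_space R k))"
      using v(1) x by blast
  qed
  then have "\<psi> ` carrier W = \<alpha> ` carrier A"
    using isometric_image[OF k] by (simp add: direct_sum_def)
  then show ?thesis using form_dimension[OF q an] by simp
qed

text \<open>A basis of \<open>V\<close> that becomes a basis of \<open>W\<close> gives a single list
  describing the values over \<open>F\<close> and, after applying \<open>h\<close>, over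
  \<open>E\<close>.\<close>

lemma scalar_extension_dimension:
  assumes F: "char_p_field F p" and q: "quasilinear_form p F V \<phi>" and fe: "field_extension F E h"
    and sc: "scalar_extension p F V \<phi> E h W \<psi>" and an: "anisotropic_part p E W \<psi> A \<alpha>"
  shows "\<exists>vs. set vs \<subseteq> carrier V \<and> \<phi> ` carrier V = ring.Span F (pth_powers p F) (map \<phi> vs) \<and>
    ring.dimension E (vectorspace.dim E A) (pth_powers p E) (ring.Span E (pth_powers p E) (map h (map \<phi> vs)))"
proof -
  interpret F: char_p_field F p by (fact F)
  have E: "char_p_field E p" using char_p_field_hom[OF F] fe unfolding field_extension_def by blast
  interpret E: char_p_field E p by (fact E)
  interpret V: quasilinear_form p F V \<phi> by (fact q)
  have qW: "quasilinear_form p E W \<psi>" using sc unfolding scalar_extension_def by blast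
  interpret W: quasilinear_form p E W \<psi> by (fact qW)
  have h: "h \<in> ring_hom F E" using fe unfolding field_extension_def by simp
  obtain \<iota> where i: "base_change F V E h W \<iota>"
    and psi: "\<And>e v. e \<in> carrier E \<Longrightarrow> v \<in> carrier V \<Longrightarrow> \<psi> (e \<odot>\<^bsub>W\<^esub> \<iota> v) = e [^]\<^bsub>E\<^esub> p \<otimes>\<^bsub>E\<^esub> h (\<phi> v)"
    using sc unfolding scalar_extension_def by blast
  have im: "\<iota> v \<in> carrier W" if "v \<in> carrier V" for v using i that unfolding base_change_def by auto
  have pi: "\<psi> (\<iota> v) = h (\<phi> v)" if "v \<in> carrier V" for v
  proof -
    have "\<phi> v \<in> carrier F" using V.form_closed that by auto
    then have "h (\<phi> v) \<in> carrier E" using ring_hom_closed[OF h] by simp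
    then show ?thesis using psi[OF E.one_closed that] im[OF that] by simp
  qed
  obtain B where B: "finite B" "V.basis B" "W.basis (\<iota> ` B)" using i unfolding base_change_def by blast
  obtain vs where vs: "set vs = B" using finite_list[OF B(1)] by blast
  have vc: "set vs \<subseteq> carrier V" using B(2) vs unfolding V.basis_def by simp
  have "\<phi> ` carrier V = F.Span (pth_powers p F) (map \<phi> vs)"
    using F.form_image_span[OF q vc] B(2) vs unfolding V.basis_def by simp
  moreover have "\<psi> ` carrier W = E.Span (pth_powers p E) (map h (map \<phi> vs))"
  proof -
    have wc: "set (map \<iota> vs) \<subseteq> carrier W" using im vc by auto
    have "W.span (set (map \<iota> vs)) = carrier W" using B(3) vs unfolding W.basis_def by simp
    moreover have "map \<psi> (map \<iota> vs) = map h (map \<phi> vs)" using pi vc by auto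
    ultimately show ?thesis using E.form_image_span[OF qW wc] by (simp only:)
  qed
  ultimately show ?thesis using E.anisotropic_part_dimension[OF an] vc by (intro exI[of _ vs]) simp
qed

lemma (in char_p_field) anisotropic_part_diag_form:
  assumes cs: "independent (pth_powers p R) cs"
  shows "anisotropic_part p R (coord_space R (length cs + k)) (diag_form p R (cs @ replicate k \<zero>))
    (coord_space R (length cs)) (diag_form p R cs)"
proof -
  let ?m = "length cs"
  let ?W = "coord_space R (?m + k)" and ?A = "coord_space R ?m" and ?Z = "coord_space R k"
  note cc = independent_in_carrier[OF cs]
  define f where "f v = (\<lambda>i\<in>{..<?m}. v i, \<lambda>j\<in>{..<k}. v (?m + j))" for v :: "nat \<Rightarrow> 'a"
  define g where "g = (\<lambda>(x, y). \<lambda>i\<in>{..<?m + k}. if i < ?m then x i else y (i - ?m) :: 'a)"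
  have vc: "v i \<in> carrier R" if "v \<in> carrier (coord_space R n)" "i < n" for v n i
    using PiE_mem[of v "{..<n}" "\<lambda>_. carrier R" i] that by simp
  have arb: "v i = undefined" if "v \<in> carrier (coord_space R n)" "\<not> i < n" for v n i
    using PiE_arb[of v "{..<n}" "\<lambda>_. carrier R" i] that by simp
  have mem: "(\<lambda>i\<in>{..<n}. u i) \<in> carrier (coord_space R n)" if "\<And>i. i < n \<Longrightarrow> u i \<in> carrier R" for n u
    using that by simp
  have fA: "fst (f v) \<in> carrier ?A" "snd (f v) \<in> carrier ?Z" if "v \<in> carrier ?W" for v
    unfolding f_def fst_conv snd_conv by (rule mem; rule vc[OF that]; simp)+
  have "f \<in> LinearCombinations.module_hom R ?W (direct_sum ?A ?Z)"
    unfolding LinearCombinations.module_hom_def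
  proof (intro CollectI conjI allI impI Pi_I)
    show "f v \<in> carrier (direct_sum ?A ?Z)" if "v \<in> carrier ?W" for v
      using fA[OF that] by (simp add: direct_sum_def mem_Times_iff del: coord_space_simps)
    show "f (v \<oplus>\<^bsub>?W\<^esub> w) = f v \<oplus>\<^bsub>direct_sum ?A ?Z\<^esub> f w" for v w
      by (simp add: direct_sum_def f_def fun_eq_iff)
    show "f (a \<odot>\<^bsub>?W\<^esub> v) = a \<odot>\<^bsub>direct_sum ?A ?Z\<^esub> f v" for a v
      by (simp add: direct_sum_def f_def fun_eq_iff)
  qed
  moreover have "bij_betw f (carrier ?W) (carrier (direct_sum ?A ?Z))"
  proof (rule bij_betw_byWitness[where f' = g])
    show "\<forall>v \<in> carrier ?W. g (f v) = v"
    proof (intro ballI ext)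
      fix v i assume "v \<in> carrier ?W"
      from arb[OF this, of i] show "g (f v) i = v i"
        by (cases "i < ?m + k") (auto simp: f_def g_def)
    qed
    show "\<forall>x \<in> carrier (direct_sum ?A ?Z). f (g x) = x"
    proof
      fix z assume "z \<in> carrier (direct_sum ?A ?Z)"
      then obtain x y where z: "z = (x, y)" "x \<in> carrier ?A" "y \<in> carrier ?Z"
        unfolding direct_sum_def by auto
      have "(\<lambda>i\<in>{..<?m}. g (x, y) i) = x"
        using arb[OF z(2)] by (auto simp: g_def fun_eq_iff)
      moreover have "(\<lambda>j\<in>{..<k}. g (x, y) (?m + j)) = y"
        using arb[OF z(3)] by (auto simp: g_def fun_eq_iff)
      ultimately show "f (g z) = z" unfolding z(1) f_def by simp
    qed
    show "f ` carrier ?W \<subseteq> carrier (direct_sum ?A ?Z)"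
    proof (rule image_subsetI)
      show "f v \<in> carrier (direct_sum ?A ?Z)" if "v \<in> carrier ?W" for v
        using fA[OF that] by (simp add: direct_sum_def mem_Times_iff del: coord_space_simps)
    qed
    show "g ` carrier (direct_sum ?A ?Z) \<subseteq> carrier ?W"
    proof (rule image_subsetI)
      fix z assume "z \<in> carrier (direct_sum ?A ?Z)"
      then obtain x y where z: "z = (x, y)" "x \<in> carrier ?A" "y \<in> carrier ?Z"
        unfolding direct_sum_def by auto
      show "g z \<in> carrier ?W" unfolding z(1) g_def prod.case
        by (rule mem) (use vc[OF z(2)] vc[OF z(3)] in simp)
    qed
  qed
  moreover have "perp R (diag_form p R cs) (diag_form p R (replicate k \<zero>)) (f v) = diag_form p R (cs @ replicate k \<zero>) v"
    if v: "v \<in> carrier ?W" for v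
  proof -
    have "diag_form p R ([] @ replicate k \<zero>) (snd (f v)) = diag_form p R [] (snd (f v))"
      using vc[OF fA(2)[OF v]] by (intro diag_form_append_zeros Pi_I) simp_all
    then have z: "diag_form p R (replicate k \<zero>) (snd (f v)) = \<zero>" by (simp add: diag_form_def)
    have "diag_form p R (cs @ replicate k \<zero>) v = diag_form p R cs v"
      using vc[OF v] by (intro diag_form_append_zeros cc Pi_I) simp
    also have "\<dots> = diag_form p R cs (fst (f v))"
      using vc[OF v] by (intro diag_form_cong cc Pi_I) (simp_all add: f_def)
    finally have e: "diag_form p R (cs @ replicate k \<zero>) v = diag_form p R cs (fst (f v))" .
    have "diag_form p R cs (fst (f v)) \<in> carrier R"
      using quasilinear_form.form_closed[OF diag_form_quasilinear[OF cc]] fA(1)[OF v] by (rule Pi_mem)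
    then show ?thesis unfolding e perp_def using z by (simp add: case_prod_beta)
  qed
  ultimately have "isometric R ?W (diag_form p R (cs @ replicate k \<zero>))
      (direct_sum ?A ?Z) (perp R (diag_form p R cs) (diag_form p R (replicate k \<zero>)))"
    unfolding isometric_def by blast
  then show ?thesis
    unfolding anisotropic_part_def using diag_form_quasilinear[OF cc] diag_form_anisotropic[OF cs] by blast
qed

text \<open>The split concerns the arguments and not the values, because \<open>g\<close> may send
  different basis vectors to the same value.\<close>

lemma (in char_p_field) exists_independent_split:
  assumes K: "subfield K R" and "distinct bs" "g ` set bs \<subseteq> carrier R"
  shows "\<exists>ss ts. set (ss @ ts) = set bs \<and> distinct (ss @ ts) \<and> independent K (map g ss) \<and>
    (\<forall>t \<in> set ts. g t \<in> Span K (map g ss))"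
  using assms(2,3)
proof (induction bs)
  case Nil
  show ?case by (intro exI[of _ "[]"]) simp
next
  case (Cons b bs)
  then obtain ss ts where st: "set (ss @ ts) = set bs" "distinct (ss @ ts)" "independent K (map g ss)"
    "\<forall>t \<in> set ts. g t \<in> Span K (map g ss)" by auto
  have b: "b \<notin> set (ss @ ts)" using Cons.prems st(1) by simp
  show ?case
  proof (cases "g b \<in> Span K (map g ss)")
    case True
    then show ?thesis using st b by (intro exI[of _ ss] exI[of _ "b # ts"]) auto
  next
    case False
    have gc: "set (map g ss) \<subseteq> carrier R" "g b \<in> carrier R" using Cons.prems st(1) by auto
    have "independent K (map g (b # ss))" using li_Cons[OF gc(2) False st(3)] by simp
    moreover have "g t \<in> Span K (map g (b # ss))" if "t \<in> set ts" for t
      using st(4) that mono_Span[OF K gc] by auto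
    ultimately show ?thesis using st(1,2) b by (intro exI[of _ "b # ss"] exI[of _ ts]) auto
  qed
qed

text \<open>
  The basis of the extended space is chosen adapted to the relations among the values
  \<open>h (\<phi> b)\<close>, so that the extended form is diagonal with an independent list of entries
  followed by zeros.
\<close>

lemma scalar_extension_exists:
  fixes E :: "'e ring"
  assumes F: "char_p_field F p" and q: "quasilinear_form p F U \<phi>" and fe: "field_extension F E h"
    and us: "set us \<subseteq> carrier U" "\<phi> ` carrier U = ring.Span F (pth_powers p F) (map \<phi> us)"
    and m: "ring.dimension E m (pth_powers p E) (ring.Span E (pth_powers p E) (map h (map \<phi> us)))"
  shows "m \<in> aniso_dims TYPE('e) p F U \<phi>"
proof -
  interpret F: char_p_field F p by (fact F)
  have E: "char_p_field E p" using char_p_field_hom[OF F] fe unfolding field_extension_def by blast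
  interpret E: char_p_field E p by (fact E)
  interpret U: quasilinear_form p F U \<phi> by (fact q)
  have hom: "h \<in> ring_hom F E" using fe unfolding field_extension_def by simp
  interpret h: ring_hom_ring F E h using ring_hom_ringI2[OF F.ring_axioms E.ring_axioms hom] .
  let ?K = "pth_powers p E"
  have pc: "\<phi> u \<in> carrier F" if "u \<in> carrier U" for u using Pi_mem[OF U.form_closed that] .
  obtain B where B: "finite B" "U.basis B" using U.finite_basis_exists[OF U.finite_dimensional] by blast
  have BU: "B \<subseteq> carrier U" using B(2) unfolding U.basis_def by simp
  define g where "g u = h (\<phi> u)" for u
  have gc: "g u \<in> carrier E" if "u \<in> carrier U" for u unfolding g_def using pc[OF that] by simp
  obtain bs where bs: "set bs = B" "distinct bs" using finite_distinct_list[OF B(1)] by blast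
  obtain ss ts where st: "set (ss @ ts) = B" "distinct (ss @ ts)" "E.independent ?K (map g ss)"
    "\<And>t. t \<in> set ts \<Longrightarrow> g t \<in> E.Span ?K (map g ss)"
    using E.exists_independent_split[OF E.pth_powers_subfield bs(2), of g] gc BU bs(1) by blast
  let ?cs = "map g ss" and ?k = "length ts" and ?n = "length ss"
  let ?N = "?n + ?k"
  have cc: "set ?cs \<subseteq> carrier E" using E.independent_in_carrier[OF st(3)] .
  let ?W = "coord_space E ?N"
  define \<psi> where "\<psi> = diag_form p E (?cs @ replicate ?k \<zero>\<^bsub>E\<^esub>)"
  have c0: "set (?cs @ replicate ?k \<zero>\<^bsub>E\<^esub>) \<subseteq> carrier E" using cc by auto
  have qW: "quasilinear_form p E ?W \<psi>" unfolding \<psi>_def using E.diag_form_quasilinear[OF c0] by simp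
  interpret W: quasilinear_form p E ?W \<psi> by (fact qW)
  let ?e = "E.unit_coord ?N"
  have ec: "?e j \<in> carrier ?W" for j by (rule E.unit_coord_closed)
  have psie: "\<psi> (?e j) = (?cs @ replicate ?k \<zero>\<^bsub>E\<^esub>) ! j" if "j < ?N" for j
    unfolding \<psi>_def using E.diag_form_unit_coord[OF c0, of j] that by simp
  have vc: "v i \<in> carrier E" if "v \<in> carrier (coord_space E n)" "i < n" for v n i
    using PiE_mem[of v "{..<n}" "\<lambda>_. carrier E" i] that by simp
  have ex: "\<exists>a. a \<in> carrier ?W \<and> (\<forall>i. ?n \<le> i \<longrightarrow> i < ?N \<longrightarrow> a i = \<zero>\<^bsub>E\<^esub>) \<and> \<psi> a = g t" if t: "t \<in> set ts" for t
  proof -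
    obtain x where x: "x \<in> carrier (coord_space E (length ?cs))" "g t = diag_form p E ?cs x"
      using st(4)[OF t] E.diag_form_image[OF cc] by auto
    have xc: "x i \<in> carrier E" if "i < ?n" for i using vc[OF x(1)] that by simp
    let ?a = "\<lambda>i\<in>{..<?N}. if i < ?n then x i else \<zero>\<^bsub>E\<^esub>"
    have ac: "?a i \<in> carrier E" if "i < ?N" for i using xc that by simp
    have "\<psi> ?a = diag_form p E ?cs ?a" unfolding \<psi>_def
      by (rule E.diag_form_append_zeros[OF cc]) (rule Pi_I, use ac in simp)
    also have "\<dots> = diag_form p E ?cs x"
      by (rule E.diag_form_cong[OF cc]) (rule Pi_I, use xc in simp_all)
    finally have "\<psi> ?a = g t" using x(2) by simp
    moreover have "?a \<in> carrier ?W" using ac by simp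
    ultimately show ?thesis by (intro exI[of _ ?a]) simp
  qed
  \<comment> \<open>For a dependent value \<open>g t\<close>, the vector \<open>a t\<close> is
    supported on the first \<open>?n\<close> coordinates and the form already takes this value
    there.\<close>
  define a where "a t = (SOME a. a \<in> carrier ?W \<and> (\<forall>i. ?n \<le> i \<longrightarrow> i < ?N \<longrightarrow> a i = \<zero>\<^bsub>E\<^esub>) \<and> \<psi> a = g t)" for t
  have a: "a t \<in> carrier ?W" "\<And>i. ?n \<le> i \<Longrightarrow> i < ?N \<Longrightarrow> a t i = \<zero>\<^bsub>E\<^esub>" "\<psi> (a t) = g t" if "t \<in> set ts" for t
    using someI_ex[OF ex[OF that]] unfolding a_def by blast+
  \<comment> \<open>A basis vector with dependent value is sent to \<open>a t\<close> plus a unit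
    vector on which the form vanishes. The value remains \<open>g t\<close>, and the unit vector can
    be recovered because \<open>a t\<close> lies in the span of the first \<open>?n\<close> ones; so
    the \<open>w b\<close> form a basis.\<close>
  define w where "w b = (let j = (THE j. j < ?N \<and> (ss @ ts) ! j = b) in
    if j < ?n then ?e j else a b \<oplus>\<^bsub>?W\<^esub> ?e j)" for b
  have wj: "w ((ss @ ts) ! j) = (if j < ?n then ?e j else a ((ss @ ts) ! j) \<oplus>\<^bsub>?W\<^esub> ?e j)" if "j < ?N" for j
  proof -
    have "(THE i. i < ?N \<and> (ss @ ts) ! i = (ss @ ts) ! j) = j"
      using st(2) that nth_eq_iff_index_eq[OF st(2)] by (intro the_equality) auto
    then show ?thesis unfolding w_def by simp
  qed
  have tsj: "(ss @ ts) ! j \<in> set ts" if "j < ?N" "\<not> j < ?n" for j using that by (simp add: nth_append)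
  have Bj: "\<exists>j < ?N. b = (ss @ ts) ! j" if "b \<in> B" for b
    using that unfolding st(1)[symmetric] by (metis in_set_conv_nth length_append)
  have wc: "w b \<in> carrier ?W" and wg: "\<psi> (w b) = g b" if b: "b \<in> B" for b
  proof -
    obtain j where j: "j < ?N" "b = (ss @ ts) ! j" using Bj[OF b] by blast
    have gb: "g b \<in> carrier E" using gc BU b by blast
    show "w b \<in> carrier ?W"
      using wj[OF j(1)] a(1)[OF tsj[OF j(1)]] ec W.M.a_closed unfolding j(2) by presburger
    show "\<psi> (w b) = g b"
    proof (cases "j < ?n")
      case True
      then show ?thesis using wj[OF j(1)] psie[OF j(1)] unfolding j(2) by (simp add: nth_append)
    next
      case False
      have "\<psi> (w b) = \<psi> (a b) \<oplus>\<^bsub>E\<^esub> \<psi> (?e j)"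
        using wj[OF j(1)] False W.form_add[OF a(1)[OF tsj[OF j(1) False]] ec] unfolding j(2) by simp
      moreover have "\<psi> (?e j) = \<zero>\<^bsub>E\<^esub>"
      proof -
        have "j - ?n < ?k" using False j(1) by simp
        then show ?thesis using psie[OF j(1)] False by (simp add: nth_append)
      qed
      ultimately show ?thesis using a(3)[OF tsj[OF j(1) False]] gb unfolding j(2) by simp
    qed
  qed
  have dimW: "W.dim = ?N" by (rule E.coord_space_dim)
  have cardB: "card B = ?N" using distinct_card[OF st(2)] st(1) by simp
  have wBc: "w ` B \<subseteq> carrier ?W" using wc by blast
  interpret S: LinearCombinations.submodule E "W.span (w ` B)" ?W using W.span_is_submodule[OF wBc] .
  have inS: "w b \<in> W.span (w ` B)" if "b \<in> B" for b using W.in_own_span[OF wBc] that by blast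
  have jB: "(ss @ ts) ! j \<in> B" if "j < ?N" for j using that unfolding st(1)[symmetric] by (metis length_append nth_mem)
  have e1: "?e j \<in> W.span (w ` B)" if "j < ?n" for j
    using wj[of j] inS[OF jB, of j] that by simp
  have e2: "?e j \<in> W.span (w ` B)" if j: "j < ?N" "\<not> j < ?n" for j
  proof -
    let ?b = "(ss @ ts) ! j"
    note at = a[OF tsj[OF j]]
    have "a ?b \<in> W.span (?e ` {..<?n})" using E.mem_span_unit_coord[of ?n ?N "a ?b"] at by simp
    moreover have "W.span (?e ` {..<?n}) \<subseteq> W.span (w ` B)"
      using e1 by (intro W.span_is_subset W.span_is_submodule wBc) blast
    ultimately have "a ?b \<in> W.span (w ` B)" by blast
    then have "\<ominus>\<^bsub>?W\<^esub> a ?b \<in> W.span (w ` B)" using W.span_neg[OF wBc] by simp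
    then have "\<ominus>\<^bsub>?W\<^esub> a ?b \<oplus>\<^bsub>?W\<^esub> w ?b \<in> W.span (w ` B)" using inS[OF jB[OF j(1)]] S.m_closed by blast
    moreover have "\<ominus>\<^bsub>?W\<^esub> a ?b \<oplus>\<^bsub>?W\<^esub> w ?b = ?e j"
      using wj[OF j(1)] j(2) W.M.r_neg1[OF at(1) ec] by presburger
    ultimately show ?thesis by simp
  qed
  have gen: "W.span (w ` B) = carrier ?W"
  proof
    have "?e ` {..<?N} \<subseteq> W.span (w ` B)" using e1 e2 by blast
    then have "W.span (?e ` {..<?N}) \<subseteq> W.span (w ` B)" by (intro W.span_is_subset W.span_is_submodule wBc)
    then show "carrier ?W \<subseteq> W.span (w ` B)" using E.unit_coord_basis[of ?N] unfolding W.basis_def by blast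
    show "W.span (w ` B) \<subseteq> carrier ?W" by (rule S.subset)
  qed
  have finw: "finite (w ` B)" using B(1) by simp
  have "card (w ` B) \<le> ?N" using card_image_le[OF B(1), of w] cardB by simp
  then have basisW: "W.basis (w ` B)" using W.dim_gen_is_basis[OF finw wBc gen] dimW by simp
  have "inj_on w B"
    using W.gen_ge_dim[OF finw wBc gen] dimW cardB card_image_le[OF B(1), of w] by (intro eq_card_imp_inj_on B(1)) simp
  have wP: "w \<in> B \<rightarrow> carrier ?W" using wc by (rule Pi_I)
  obtain \<iota> where i: "\<iota> \<in> carrier U \<rightarrow> carrier ?W"
    "\<And>u v. u \<in> carrier U \<Longrightarrow> v \<in> carrier U \<Longrightarrow> \<iota> (u \<oplus>\<^bsub>U\<^esub> v) = \<iota> u \<oplus>\<^bsub>?W\<^esub> \<iota> v"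
    "\<And>a v. a \<in> carrier F \<Longrightarrow> v \<in> carrier U \<Longrightarrow> \<iota> (a \<odot>\<^bsub>U\<^esub> v) = h a \<odot>\<^bsub>?W\<^esub> \<iota> v"
    "\<And>b. b \<in> B \<Longrightarrow> \<iota> b = w b"
    by (rule semilinear_extension_exists[OF U.vectorspace_axioms W.vectorspace_axioms hom B wP]) (rule that)
  have iw: "\<iota> ` B = w ` B" using i(4) by simp
  have "inj_on \<iota> B" using \<open>inj_on w B\<close> i(4) inj_on_cong[of B \<iota> w] by blast
  then have bc: "base_change F U E h ?W \<iota>"
    unfolding base_change_def using W.vectorspace_axioms i(1-3) B basisW iw by auto
  \<comment> \<open>The vectors on which both sides agree form a subspace, since both sides are
    additive and multiply by h(c)^p under a scalar c. It contains the basis by the choice of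
    \<open>w\<close>.\<close>
  have psi_i: "\<psi> (\<iota> v) = h (\<phi> v)" if v: "v \<in> carrier U" for v
  proof -
    let ?S = "{v \<in> carrier U. \<psi> (\<iota> v) = h (\<phi> v)}"
    note im = Pi_mem[OF i(1)]
    have "\<zero>\<^bsub>F\<^esub> \<odot>\<^bsub>U\<^esub> \<zero>\<^bsub>U\<^esub> = \<zero>\<^bsub>U\<^esub>" by simp
    then have "\<iota> \<zero>\<^bsub>U\<^esub> = \<zero>\<^bsub>E\<^esub> \<odot>\<^bsub>?W\<^esub> \<iota> \<zero>\<^bsub>U\<^esub>" using i(3)[of "\<zero>\<^bsub>F\<^esub>" "\<zero>\<^bsub>U\<^esub>"] by simp
    then have i0: "\<iota> \<zero>\<^bsub>U\<^esub> = \<zero>\<^bsub>?W\<^esub>" using W.lmult_0[OF im[OF U.M.zero_closed]] by simp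
    have "LinearCombinations.submodule F ?S U"
    proof (rule submoduleI')
      show "Module.module F U" by (rule U.module_axioms)
      show "\<zero>\<^bsub>U\<^esub> \<in> ?S" using i0 W.form_zero[OF E.p_gt_0] U.form_zero[OF E.p_gt_0] by simp
    next
      fix u v assume "u \<in> ?S" "v \<in> ?S"
      then show "u \<oplus>\<^bsub>U\<^esub> v \<in> ?S"
        using i(2)[of u v] W.form_add[OF im im, of u v] U.form_add[of u v] pc[of u] pc[of v] by simp
    next
      fix c v assume c: "c \<in> carrier F" and "v \<in> ?S"
      then show "c \<odot>\<^bsub>U\<^esub> v \<in> ?S"
        using i(3)[of c v] W.form_smult[OF _ im, of "h c" v] U.form_smult[of c v] pc[of v] h.hom_nat_pow[OF c] by simp
    qed auto
    moreover have "B \<subseteq> ?S" using BU wg i(4) unfolding g_def by auto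
    ultimately have "U.span B \<subseteq> ?S" by (rule U.span_is_subset[rotated])
    then show ?thesis using v B(2) unfolding U.basis_def by blast
  qed
  have sc: "scalar_extension p F U \<phi> E h ?W \<psi>"
    unfolding scalar_extension_def
  proof (intro conjI exI[of _ \<iota>] ballI)
    fix e v assume e: "e \<in> carrier E" and v: "v \<in> carrier U"
    show "\<psi> (e \<odot>\<^bsub>?W\<^esub> \<iota> v) = e [^]\<^bsub>E\<^esub> p \<otimes>\<^bsub>E\<^esub> h (\<phi> v)"
      using W.form_smult[OF e Pi_mem[OF i(1) v]] psi_i[OF v] by simp
  qed (fact qW bc)+
  have an: "anisotropic_part p E ?W \<psi> (coord_space E ?n) (diag_form p E ?cs)"
    using E.anisotropic_part_diag_form[OF st(3), of ?k] unfolding \<psi>_def by simp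
  \<comment> \<open>The dependent values lie in the span of \<open>?cs\<close>, so the images of
    \<open>us\<close> and the list \<open>?cs\<close> describe the same value space over the p-th
    powers of \<open>E\<close>, of dimension \<open>?n\<close>.\<close>
  have "m = ?n"
  proof -
    have hK: "h ` pth_powers p F \<subseteq> ?K" unfolding pth_powers_def by (auto simp: h.hom_nat_pow)
    have sub: "E.Span ?K (map h (map \<phi> us)) \<subseteq> E.Span ?K ?cs \<and> E.Span ?K ?cs \<subseteq> E.Span ?K (map h (map \<phi> us))"
    proof
      have c: "set (map h (map \<phi> us)) \<subseteq> carrier E" using gc us(1) unfolding g_def by auto
      have stU: "set (ss @ ts) \<subseteq> carrier U" unfolding st(1) by (rule BU)
      have "U.span (set (ss @ ts)) = carrier U" unfolding st(1) using B(2) U.basis_def by blast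
      then have stF: "\<phi> ` carrier U = F.Span (pth_powers p F) (map \<phi> (ss @ ts))"
        using F.form_image_span[OF q stU] by (simp only:)
      have fs: "h ` F.Span (pth_powers p F) (map \<phi> vs) \<subseteq> E.Span ?K (map h (map \<phi> vs))"
        if "set vs \<subseteq> carrier U" for vs
      proof -
        have "set (map \<phi> vs) \<subseteq> carrier F" using pc that by auto
        then have "E.Span (h ` pth_powers p F) (map h (map \<phi> vs)) = h ` F.Span (pth_powers p F) (map \<phi> vs)"
          by (rule h.Span_hom[OF subfieldE(3)[OF F.pth_powers_subfield]])
        then show ?thesis using E.Span_mono_field[OF hK refl, of "map h (map \<phi> vs)"] by simp
      qed
      have B_us: "g b \<in> E.Span ?K (map h (map \<phi> us))" if "b \<in> B" for b
        using fs[OF us(1)] us(2) BU that unfolding g_def by blast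
      show "E.Span ?K ?cs \<subseteq> E.Span ?K (map h (map \<phi> us))"
        using B_us st(1) by (intro E.mono_Span_subset E.pth_powers_subfield c) auto
      have all: "set (map g (ss @ ts)) \<subseteq> E.Span ?K ?cs"
        using st(4) E.Span_base_incl[OF E.pth_powers_subfield cc] by auto
      have "g u \<in> E.Span ?K ?cs" if u: "u \<in> carrier U" for u
      proof -
        have "\<phi> u \<in> F.Span (pth_powers p F) (map \<phi> (ss @ ts))"
          unfolding stF[symmetric] using u by (rule imageI)
        then have "g u \<in> E.Span ?K (map h (map \<phi> (ss @ ts)))"
          using fs[OF stU] unfolding g_def by blast
        also have "map h (map \<phi> (ss @ ts)) = map g (ss @ ts)" unfolding g_def by simp
        also have "E.Span ?K (map g (ss @ ts)) \<subseteq> E.Span ?K ?cs"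
          by (rule E.mono_Span_subset[OF E.pth_powers_subfield all cc])
        finally show ?thesis .
      qed
      then have "set (map h (map \<phi> us)) \<subseteq> E.Span ?K ?cs" using us(1) unfolding g_def by auto
      then show "E.Span ?K (map h (map \<phi> us)) \<subseteq> E.Span ?K ?cs"
        by (rule E.mono_Span_subset[OF E.pth_powers_subfield _ cc])
    qed
    then have "E.Span ?K (map h (map \<phi> us)) = E.Span ?K ?cs" by blast
    then show ?thesis
      using E.dimension_is_inj[OF E.pth_powers_subfield m] E.dimension_independent[OF st(3)] by simp
  qed
  then have "m = vectorspace.dim E (coord_space E ?n)" using E.coord_space_dim by simp
  then show ?thesis unfolding aniso_dims_def using fe sc an by blast
qed

section \<open>Quasi-Pfister and minimal forms\<close>

lemma pfister_coeffs_hom: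
  assumes h: "h \<in> ring_hom F E" and "ring F" "ring E" and "set as \<subseteq> carrier F"
  shows "pfister_coeffs p E (map h as) = map h (pfister_coeffs p F as) \<and> set (pfister_coeffs p F as) \<subseteq> carrier F"
  using assms(4)
proof (induction as)
  case Nil
  interpret F: ring F by (fact assms(2))
  show ?case using ring_hom_one[OF h] by simp
next
  case (Cons a as)
  interpret F: ring F by (fact assms(2))
  interpret h: ring_hom_ring F E h using ring_hom_ringI2[OF assms(2,3) h] .
  have a: "a \<in> carrier F" and IH: "pfister_coeffs p E (map h as) = map h (pfister_coeffs p F as)"
    "set (pfister_coeffs p F as) \<subseteq> carrier F" using Cons by auto
  have "h (a [^]\<^bsub>F\<^esub> i \<otimes>\<^bsub>F\<^esub> x) = h a [^]\<^bsub>E\<^esub> i \<otimes>\<^bsub>E\<^esub> h x"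
    if "x \<in> set (pfister_coeffs p F as)" for i :: nat and x
    using subsetD[OF IH(2) that] a by (simp add: h.hom_nat_pow)
  then have "pfister_coeffs p E (map h (a # as)) = map h (pfister_coeffs p F (a # as))"
    by (simp add: tensor_coeffs_def map_concat IH(1) comp_def cong: map_cong)
  moreover have "set (pfister_coeffs p F (a # as)) \<subseteq> carrier F"
    using IH(2) a by (auto simp: tensor_coeffs_def subset_iff)
  ultimately show ?case by blast
qed

lemma Span_transfer:
  assumes F: "char_p_field F p" and E: "field E" and h: "h \<in> ring_hom F E"
  shows "set xs \<subseteq> carrier F \<Longrightarrow>
      h ` ring.Span F (pth_powers p F) xs \<subseteq> ring.Span E (pth_powers p E) (map h xs)"
    and "set xs \<subseteq> carrier F \<Longrightarrow> set ys \<subseteq> carrier F \<Longrightarrow>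
      ring.Span F (pth_powers p F) xs = ring.Span F (pth_powers p F) ys \<Longrightarrow>
      ring.Span E (pth_powers p E) (map h xs) = ring.Span E (pth_powers p E) (map h ys)"
proof -
  interpret F: char_p_field F p by (fact F)
  interpret E: char_p_field E p using char_p_field_hom[OF F E h] .
  interpret h: ring_hom_ring F E h using ring_hom_ringI2[OF F.ring_axioms E.ring_axioms h] .
  have hK: "h ` pth_powers p F \<subseteq> pth_powers p E" unfolding pth_powers_def by (auto simp: h.hom_nat_pow)
  show sub: "h ` F.Span (pth_powers p F) xs \<subseteq> E.Span (pth_powers p E) (map h xs)"
    if "set xs \<subseteq> carrier F" for xs
    using h.Span_hom[OF subfieldE(3)[OF F.pth_powers_subfield] that] E.Span_mono_field[OF hK refl, of "map h xs"]
    by simp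
  have "E.Span (pth_powers p E) (map h us) \<subseteq> E.Span (pth_powers p E) (map h vs)"
    if c: "set us \<subseteq> carrier F" "set vs \<subseteq> carrier F"
      and eq: "F.Span (pth_powers p F) us = F.Span (pth_powers p F) vs" for us vs
  proof -
    have "h ` set us \<subseteq> E.Span (pth_powers p E) (map h vs)"
      using sub[OF c(2)] F.Span_base_incl[OF F.pth_powers_subfield c(1)] eq by blast
    moreover have "set (map h vs) \<subseteq> carrier E" using c(2) by auto
    ultimately show ?thesis using E.mono_Span_subset[OF E.pth_powers_subfield, of "map h us"] by simp
  qed
  from this[of xs ys] this[of ys xs]
  show "set xs \<subseteq> carrier F \<Longrightarrow> set ys \<subseteq> carrier F \<Longrightarrow>
      F.Span (pth_powers p F) xs = F.Span (pth_powers p F) ys \<Longrightarrow>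
      E.Span (pth_powers p E) (map h xs) = E.Span (pth_powers p E) (map h ys)"
    by auto
qed

lemma isometric_anisotropic:
  assumes "vectorspace K V" "vectorspace K W" "isometric K V \<phi> W \<psi>" "anisotropic K V \<phi>"
  shows "anisotropic K W \<psi>"
proof -
  interpret V: vectorspace K V by (fact assms(1))
  interpret W: vectorspace K W by (fact assms(2))
  obtain f where f: "f \<in> LinearCombinations.module_hom K V W" "bij_betw f (carrier V) (carrier W)"
    "\<And>v. v \<in> carrier V \<Longrightarrow> \<psi> (f v) = \<phi> v"
    using assms(3) unfolding isometric_def by blast
  interpret f: mod_hom K V W f
    using f(1) V.module_axioms W.module_axioms by (simp add: mod_hom_def mod_hom_axioms_def)
  show ?thesis
    unfolding anisotropic_def
  proof (intro ballI impI)
    fix w assume "w \<in> carrier W" and z: "\<psi> w = \<zero>\<^bsub>K\<^esub>"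
    then obtain v where v: "v \<in> carrier V" "w = f v" using f(2) unfolding bij_betw_def by blast
    then have "v = \<zero>\<^bsub>V\<^esub>" using z f(3) assms(4) unfolding anisotropic_def by simp
    then show "w = \<zero>\<^bsub>W\<^esub>" using v(2) f.f0_is_0 by simp
  qed
qed

context char_p_field
begin

text \<open>In a quotient of two values written as b u and b v the factor \<open>b\<close> cancels,
  so ratios to the single value \<open>b\<close> are enough to generate the norm field.\<close>

lemma norm_field_eq:
  assumes c: "b \<in> carrier R" "b \<noteq> \<zero>" "set bs \<subseteq> carrier R"
    and im: "\<sigma> ` carrier W = Span (pth_powers p R) (b # bs)"
  shows "norm_field p R W \<sigma> = finite_extension (pth_powers p R) (map (\<lambda>c. c \<otimes> inv b) bs)"
    and "Span (pth_powers p R) (b # bs)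
      = (\<otimes>) b ` Span (pth_powers p R) (\<one> # map (\<lambda>c. c \<otimes> inv b) bs)"
proof -
  let ?K = "pth_powers p R" and ?xs = "map (\<lambda>c. c \<otimes> inv b) bs"
  let ?N = "finite_extension ?K ?xs"
  note K = pbase_pth_powers
  have bi: "inv b \<in> carrier R" "b \<otimes> inv b = \<one>" using c field_Units by auto
  have xc: "set ?xs \<subseteq> carrier R" "set (\<one> # ?xs) \<subseteq> carrier R" using c bi by auto
  have N: "pbase ?N" using pbase_finite_extension[OF K xc(1)] .
  have "map ((\<otimes>) b) (\<one> # ?xs) = b # bs"
  proof -
    have "b \<otimes> (x \<otimes> inv b) = x" if "x \<in> set bs" for x
      using m_lcomm[of b x "inv b"] c bi that by auto
    then show ?thesis using c by (auto intro: map_idI)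
  qed
  then show eq: "Span ?K (b # bs) = (\<otimes>) b ` Span ?K (\<one> # ?xs)"
    using Span_scale[OF pbaseD(1)[OF K] c(1) xc(2)] by metis
  have SN: "Span ?K (\<one> # ?xs) \<subseteq> ?N"
    using Span_subset_subring[OF pbaseD(2)[OF N] finite_extension_base_incl[OF K xc(1)], of "\<one> # ?xs"]
      finite_extension_mem[OF pbaseD(2)[OF K] xc(1)] subringE(3)[OF pbaseD(2)[OF N]] by auto
  let ?H = "?K \<union> {x \<otimes> inv y | x y. x \<in> nonzero_values R W \<sigma> \<and> y \<in> nonzero_values R W \<sigma>}"
  have nz: "nonzero_values R W \<sigma> = Span ?K (b # bs) - {\<zero>}" unfolding nonzero_values_def im ..
  have HN: "?H \<subseteq> ?N"
  proof -
    have "x \<otimes> inv y \<in> ?N" if xy: "x \<in> nonzero_values R W \<sigma>" "y \<in> nonzero_values R W \<sigma>" for x y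
    proof -
      obtain u v where uv: "u \<in> ?N" "v \<in> ?N" "x = b \<otimes> u" "y = b \<otimes> v" "y \<noteq> \<zero>"
        using xy SN unfolding nz eq by blast
      have cr: "u \<in> carrier R" "v \<in> carrier R" using uv pbaseD(3)[OF N] by auto
      have v0: "v \<noteq> \<zero>" using uv(4,5) c by auto
      have vi: "inv v \<in> ?N" using subfield_m_inv(1)[OF pbaseD(1)[OF N], of v] uv(2) v0 by simp
      have vic: "inv v \<in> carrier R" using vi pbaseD(3)[OF N] by auto
      have "b \<otimes> v \<otimes> (inv v \<otimes> inv b) = (b \<otimes> inv b) \<otimes> (v \<otimes> inv v)"
        using c(1) cr(2) bi(1) vic by (simp add: m_ac)
      also have "\<dots> = \<one>" using bi(2) cr(2) v0 field_Units by simp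
      finally have "inv y = inv v \<otimes> inv b"
        unfolding uv(4) using c(1) cr(2) bi(1) vic by (intro comm_inv_char) simp_all
      then have "x \<otimes> inv y = (b \<otimes> inv b) \<otimes> (u \<otimes> inv v)"
        unfolding uv(3) using c(1) cr bi(1) vic by (simp add: m_ac)
      then have "x \<otimes> inv y = u \<otimes> inv v" using bi(2) cr(1) vic by simp
      then show ?thesis using subringE(6)[OF pbaseD(2)[OF N] uv(1) vi] by simp
    qed
    then show ?thesis using finite_extension_base_incl[OF K xc(1)] by blast
  qed
  have Hc: "?H \<subseteq> carrier R" using HN pbaseD(3)[OF N] by blast
  let ?G = "generate_field R ?H"
  have G: "subfield ?G R" and HG: "?H \<subseteq> ?G" using generate_fieldE(1,2)[OF Hc] by auto
  show "norm_field p R W \<sigma> = ?N"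
    unfolding norm_field_def
  proof
    show "?G \<subseteq> ?N" using generate_field_min_subfield1[OF Hc pbaseD(1)[OF N] HN] .
    have "x \<in> ?G" if x: "x \<in> set ?xs" for x
    proof -
      obtain y where y: "y \<in> set bs" "x = y \<otimes> inv b" using x by auto
      show ?thesis
      proof (cases "y = \<zero>")
        case True
        then show ?thesis using y(2) bi subringE(2)[OF subfieldE(1)[OF G]] by simp
      next
        case False
        have "set (b # bs) \<subseteq> Span ?K (b # bs)"
          using Span_base_incl[OF pbaseD(1)[OF K], of "b # bs"] c by simp
        then have "y \<in> nonzero_values R W \<sigma>" "b \<in> nonzero_values R W \<sigma>"
          unfolding nz using False y(1) c(2) by (simp_all del: Span_list) blast+
        then show ?thesis using HG y(2) by blast
      qed
    qed
    then show "?N \<subseteq> ?G"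
      using HG by (intro finite_extension_subring_incl subfieldE(1)[OF G]) auto
  qed
qed

text \<open>Anisotropy makes the degree of the field of values equal to the dimension p^n of the
  form, the largest degree that \<open>n\<close> generators can give.\<close>

lemma quasi_pfister_image:
  assumes V: "quasilinear_form p R V \<pi>" and pf: "quasi_pfister p R n V \<pi>" and an: "anisotropic R V \<pi>"
  obtains as where "pindep (pth_powers p R) as" "length as = n"
    "\<pi> ` carrier V = finite_extension (pth_powers p R) as"
proof -
  interpret V: quasilinear_form p R V \<pi> by (fact V)
  note K = pbase_pth_powers
  obtain as where as: "length as = n" "set as \<subseteq> carrier R"
    and iso: "isometric R V \<pi> (coord_space R (length (pfister_coeffs p R as))) (diag_form p R (pfister_coeffs p R as))"
    using pf unfolding quasi_pfister_def by (auto simp: Let_def)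
  let ?cs = "pfister_coeffs p R as"
  have im: "\<pi> ` carrier V = finite_extension (pth_powers p R) as"
    using isometric_image[OF iso] diag_form_image[OF pfister_coeffs_in_carrier[OF as(2)]]
      Span_pfister_coeffs[OF K as(2)] by simp
  obtain f where f: "f \<in> LinearCombinations.module_hom R V (coord_space R (length ?cs))"
    "bij_betw f (carrier V) (carrier (coord_space R (length ?cs)))"
    using iso unfolding isometric_def by blast
  interpret C: vectorspace R "coord_space R (length ?cs)" by (rule coord_space_vectorspace)
  interpret f: linear_map R V "coord_space R (length ?cs)" f
    using f(1) V.vectorspace_axioms C.vectorspace_axioms V.module_axioms C.module_axioms
    by (simp add: linear_map_def mod_hom_def mod_hom_axioms_def)
  have "V.dim = length ?cs"
    using f.dim_eq[OF V.finite_dimensional] f(2) coord_space_dim(1)[of "length ?cs"] unfolding bij_betw_def by simp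
  also have "\<dots> = p ^ n"
    unfolding as(1)[symmetric]
  proof (induction as)
    case (Cons a as)
    have "length (tensor_coeffs R cs ds) = length cs * length ds" for cs ds
      unfolding tensor_coeffs_def by (induction cs) auto
    then show ?case using Cons by simp
  qed simp
  finally have "dimension (p ^ n) (pth_powers p R) (finite_extension (pth_powers p R) as)"
    using form_dimension[OF V an] im by simp
  then show ?thesis using that[of as] as im unfolding pindep_def by simp
qed

text \<open>Dividing a basis of the values by one member \<open>b\<close> presents the norm field as
  the extension by the remaining ratios, one fewer than the dimension. Minimality then says that
  these are p-independent. They lie in the field of values of \<pi>, where they extend to a
  p-basis.\<close>

lemma minimal_subform_image:
  assumes W: "quasilinear_form p R W \<sigma>" and sub: "subform R W \<sigma> V \<pi>" and min: "minimal_form p R W \<sigma>"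
    and im: "\<pi> ` carrier V = finite_extension (pth_powers p R) as" and as: "pindep (pth_powers p R) as"
  obtains b bs xs ys where "set bs \<subseteq> carrier R" "\<sigma> ` carrier W = Span (pth_powers p R) bs"
    "b \<in> finite_extension (pth_powers p R) as" "b \<noteq> \<zero>"
    "Span (pth_powers p R) bs = Span (pth_powers p R) (map ((\<otimes>) b) (\<one> # xs))"
    "pindep (pth_powers p R) (ys @ xs)" "length (ys @ xs) = length as"
    "finite_extension (pth_powers p R) as = finite_extension (pth_powers p R) (ys @ xs)"
    "vectorspace.dim R W = Suc (length xs)"
proof -
  let ?K = "pth_powers p R"
  note K = pbase_pth_powers
  let ?P = "finite_extension ?K as"
  have ac: "set as \<subseteq> carrier R" using as unfolding pindep_def by simp
  have P: "pbase ?P" and KP: "?K \<subseteq> ?P" using pbase_finite_extension[OF K ac] finite_extension_base_incl[OF K ac] by auto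
  interpret W: quasilinear_form p R W \<sigma> by (fact W)
  have an: "anisotropic R W \<sigma>" and pos: "0 < W.dim" and deg: "norm_degree p R W \<sigma> = p ^ (W.dim - 1)"
    using min unfolding minimal_form_def by auto
  obtain B where B: "finite B" "W.basis B" using W.finite_basis_exists[OF W.finite_dimensional] by blast
  obtain ws where ws: "set ws = B" "distinct ws" using finite_distinct_list[OF B(1)] by blast
  have wc: "set ws \<subseteq> carrier W" "W.lin_indpt (set ws)" "W.span (set ws) = carrier W"
    using B(2) unfolding W.basis_def ws(1) by auto
  have dimW: "W.dim = length ws" using W.dim_basis[OF B] ws by (simp add: distinct_card[symmetric])
  define cs where "cs = map \<sigma> ws"
  have ind: "independent ?K cs" unfolding cs_def by (rule form_independent[OF W an ws(2) wc(1,2)])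
  have imW: "\<sigma> ` carrier W = Span ?K cs"
    unfolding cs_def using form_image_span[OF W wc(1)] wc(3) by simp
  have lcs: "length cs = W.dim" unfolding cs_def dimW by simp
  then obtain b bs where bs: "cs = b # bs" using pos by (cases cs) auto
  have c: "b \<in> carrier R" "set bs \<subseteq> carrier R" using independent_in_carrier[OF ind] unfolding bs by auto
  have b0: "b \<noteq> \<zero>"
    using independent_backwards(1)[OF ind[unfolded bs]] Span_subgroup_props(2)[OF pbaseD(1)[OF K] c(2)] by auto
  define xs where "xs = map (\<lambda>c. c \<otimes> inv b) bs"
  have xc: "set xs \<subseteq> carrier R" using c b0 field_Units unfolding xs_def by auto
  have lx: "W.dim = Suc (length xs)" using lcs unfolding bs xs_def by simp
  note nf = norm_field_eq[OF c(1) b0 c(2) imW[unfolded bs], folded xs_def]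
  have xp: "pindep ?K xs"
  proof -
    obtain k where k: "dimension (p ^ k) ?K (finite_extension ?K xs)"
      using dimension_finite_extension[OF K xc] by blast
    have "p ^ k = p ^ length xs"
      using dimI[OF pbaseD(1)[OF K] k] deg lx unfolding norm_degree_def nf(1) over_def by simp
    then show ?thesis using k xc unfolding pindep_def by simp
  qed
  have "\<sigma> ` carrier W \<subseteq> \<pi> ` carrier V"
  proof -
    obtain f where "f \<in> LinearCombinations.module_hom R W V" "\<And>v. v \<in> carrier W \<Longrightarrow> \<pi> (f v) = \<sigma> v"
      using sub unfolding subform_def by blast
    then show ?thesis using LinearCombinations.module_hom_closed[of f R W V] by (auto simp: Pi_iff) (metis image_eqI)
  qed
  then have csP: "set cs \<subseteq> ?P"
    using imW im Span_base_incl[OF pbaseD(1)[OF K] independent_in_carrier[OF ind]] by simp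
  then have bP: "b \<in> ?P" unfolding bs by simp
  have "inv b \<in> ?P" using subfield_m_inv(1)[OF pbaseD(1)[OF P], of b] bP b0 by simp
  then have "set xs \<subseteq> ?P"
    using csP subringE(6)[OF pbaseD(2)[OF P]] unfolding bs xs_def by auto
  moreover have "dimension (p ^ length as) ?K ?P" using as unfolding pindep_def by simp
  ultimately obtain ys where ys: "set ys \<subseteq> ?P" "length (ys @ xs) = length as" "finite_extension ?K (ys @ xs) = ?P"
    using pindep_extend[OF K P KP _ xp] by blast
  have "set (ys @ xs) \<subseteq> carrier R" using ys(1) xc pbaseD(3)[OF P] by auto
  then have yp: "pindep ?K (ys @ xs)" using as ys(2,3) unfolding pindep_def by simp
  have sp: "Span ?K cs = Span ?K (map ((\<otimes>) b) (\<one> # xs))"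
    using nf(2) Span_scale[OF pbaseD(1)[OF K] c(1), of "\<one> # xs"] xc unfolding bs by simp
  show ?thesis
    by (rule that[OF independent_in_carrier[OF ind] imW bP b0 sp yp ys(2) ys(3)[symmetric] lx])
qed

text \<open>
  Over \<open>R\<^sup>p \<subseteq> L \<subseteq> R\<close>, dimensions of \<open>L\<close>-spans are realized by the field extension \<open>R \<rightarrow> L\<close> given
  by the Frobenius map: it is isomorphic to the inclusion of \<open>R\<close> in \<open>L\<^sup>1\<^sup>/\<^sup>p\<close>.
\<close>

lemma subfield_dimension_realized:
  assumes q: "quasilinear_form p R U \<phi>" and L: "pbase L"
    and im: "\<phi> ` carrier U = Span (pth_powers p R) vs" and vs: "set vs \<subseteq> carrier R"
    and m: "dimension m L (Span L vs)"
  shows "m \<in> aniso_dims TYPE('a list) p R U \<phi>"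
proof -
  interpret U: quasilinear_form p R U \<phi> by (fact q)
  note K = pbase_pth_powers
  define L' where "L' = R\<lparr>carrier := L\<rparr>"
  \<comment> \<open>Singleton lists carry a copy of \<open>L\<close> in the type
    \<open>'a list\<close>.\<close>
  define E :: "'a list ring" where "E = image_ring (\<lambda>x. [x]) L'"
  define h where "h x = [x [^] p]" for x
  interpret L': field L' unfolding L'_def using subfield_iff(2)[OF pbaseD(1)[OF L]] .
  have inj: "inj_on (\<lambda>x. [x]) (carrier L')" by (simp add: inj_on_def)
  have iso: "(\<lambda>x. [x]) \<in> ring_hom L' E"
    using inj_imp_image_ring_iso[OF inj] unfolding E_def ring_iso_def by blast
  interpret E: field E unfolding E_def by (rule L'.inj_imp_image_ring_is_field[OF inj])
  interpret i: ring_hom_ring L' E "\<lambda>x. [x]" using ring_hom_ringI2[OF L'.ring_axioms E.ring_axioms iso] .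
  have "(\<lambda>x. x [^] p) \<in> ring_hom R L'"
    unfolding L'_def using pbaseD(4)[OF L]
    by (auto intro!: ring_hom_memI simp: frob_add nat_pow_distrib)
  from ring_hom_trans[OF this iso] have hom: "h \<in> ring_hom R E" by (simp add: h_def[abs_def] comp_def)
  interpret h: ring_hom_ring R E h using ring_hom_ringI2[OF ring_axioms E.ring_axioms hom] .
  have fe: "field_extension R E h"
    unfolding field_extension_def using hom field_axioms E.field_axioms by simp
  have cE: "carrier E = (\<lambda>x. [x]) ` L" unfolding E_def image_ring_carrier L'_def by simp
  \<comment> \<open>The p-th power of the copy of \<open>x\<close> is the image of \<open>x\<close>
    under \<open>h\<close>, so the p-th powers of \<open>E\<close> are exactly the image of
    \<open>L\<close>. As \<open>h\<close> is injective, dimensions over \<open>L\<close> become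
    dimensions over the p-th powers of \<open>E\<close>.\<close>
  have "[x] [^]\<^bsub>E\<^esub> p = h x" if "x \<in> L" for x
    using i.hom_nat_pow[of x p] that nat_pow_consistent[of x p L] unfolding L'_def h_def by simp
  then have hL: "h ` L = pth_powers p E"
    unfolding pth_powers_def cE image_image by (intro image_cong) simp_all
  have hinj: "inj_on h (carrier R)"
  proof (rule inj_onI)
    fix x y assume "x \<in> carrier R" "y \<in> carrier R" "h x = h y"
    then show "x = y" using frob_inj[of x y] unfolding h_def by blast
  qed
  obtain B where B: "finite B" "U.basis B" using U.finite_basis_exists[OF U.finite_dimensional] by blast
  obtain us where us: "set us = B" using finite_list[OF B(1)] by blast
  have uc: "set us \<subseteq> carrier U" "U.span (set us) = carrier U" using B(2) unfolding U.basis_def us by auto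
  have imu: "\<phi> ` carrier U = Span (pth_powers p R) (map \<phi> us)"
    using form_image_span[OF q uc(1)] uc(2) by simp
  have puc: "set (map \<phi> us) \<subseteq> carrier R" using uc(1) U.form_closed by auto
  have KL: "pth_powers p R \<subseteq> L" using L unfolding pbase_def by simp
  note lf = pbaseD(1)[OF L] and kf = pbaseD(1)[OF K]
  have "Span L vs = Span L (map \<phi> us)"
    using Span_eq_mono[OF kf lf KL vs puc] Span_eq_mono[OF kf lf KL puc vs] im imu by simp
  then have d: "dimension m L (Span L (map \<phi> us))" using m by simp
  have "inj_on h (Span L (map \<phi> us))"
    using hinj Span_in_carrier[OF pbaseD(3)[OF L] puc] by (rule inj_on_subset)
  from h.inj_hom_dimension[OF lf E.one_not_zero this d]
  have "E.dimension m (h ` L) (h ` Span L (map \<phi> us))" .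
  then have "E.dimension m (pth_powers p E) (E.Span (pth_powers p E) (map h (map \<phi> us)))"
    unfolding h.Span_hom[OF pbaseD(3)[OF L] puc, symmetric] hL .
  then show ?thesis
    using scalar_extension_exists[OF char_p_field_axioms q fe uc(1) imu] by blast
qed

end

section \<open>Dimensions of anisotropic parts\<close>

text \<open>The description of the values over the p-th powers of \<open>R\<close> consists of
  equalities of spans, which \<open>h\<close> transports to \<open>E\<close>. What may be lost in
  \<open>E\<close> is p-independence; \<open>value_space_dimension\<close> therefore works from
  generators and their number.\<close>

lemma (in char_p_field) aniso_dims_necessary:
  assumes q: "quasilinear_form p R U \<phi>" and as: "set as \<subseteq> carrier R"
    and c: "set (ys @ xs) \<subseteq> carrier R"
    and gen: "finite_extension (pth_powers p R) as = finite_extension (pth_powers p R) (ys @ xs)"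
    and len: "length as = length (ys @ xs)"
    and b: "b \<in> finite_extension (pth_powers p R) as" "b \<noteq> \<zero>" and d: "d \<in> carrier R"
    and bs: "set bs \<subseteq> carrier R"
      "Span (pth_powers p R) bs = Span (pth_powers p R) (map ((\<otimes>) b) (\<one> # xs))"
    and im: "\<phi> ` carrier U = Span (pth_powers p R) (pfister_coeffs p R as @ map ((\<otimes>) d) bs)"
    and m: "m \<in> aniso_dims TYPE('e) p R U \<phi>"
  shows "\<exists>k l. m = p ^ k + l \<and> k \<le> length as \<and>
    (l = 0 \<or> 1 \<le> l \<and> k + Suc (length xs) \<le> length as + l \<and> l \<le> Suc (length xs) \<and> l \<le> p ^ k)"
proof -
  let ?K = "pth_powers p R"
  note K = pbase_pth_powers
  obtain E :: "'e ring" and h and Y :: "('e, nat \<Rightarrow> 'e) module" and \<psi> and A :: "('e, nat \<Rightarrow> 'e) module" and \<alpha>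
    where fe: "field_extension R E h" and sc: "scalar_extension p R U \<phi> E h Y \<psi>"
      and an: "anisotropic_part p E Y \<psi> A \<alpha>" and mA: "m = vectorspace.dim E A"
    using m unfolding aniso_dims_def by blast
  have fE: "field E" and h: "h \<in> ring_hom R E" using fe unfolding field_extension_def by auto
  interpret E: char_p_field E p using char_p_field_hom[OF char_p_field_axioms fE h] .
  interpret h: ring_hom_ring R E h using ring_hom_ringI2[OF ring_axioms E.ring_axioms h] .
  let ?E = "pth_powers p E"
  note KE = E.pbase_pth_powers
  note tr = Span_transfer[OF char_p_field_axioms fE h]
  obtain us where us: "set us \<subseteq> carrier U" "\<phi> ` carrier U = Span ?K (map \<phi> us)"
    and dim: "E.dimension m ?E (E.Span ?E (map h (map \<phi> us)))"
    using scalar_extension_dimension[OF char_p_field_axioms q fe sc an] unfolding mA by blast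
  have uc: "set (map \<phi> us) \<subseteq> carrier R"
    using us(1) quasilinear_form.form_closed[OF q] by auto
  note pf = pfister_coeffs_hom[OF h ring_axioms E.ring_axioms, of _ p]
  have pc: "set (pfister_coeffs p R as) \<subseteq> carrier R" using pf[OF as] by simp
  have hc: "set (map h zs) \<subseteq> carrier E" if "set zs \<subseteq> carrier R" for zs using that by auto
  have hmult: "map h (map ((\<otimes>) a) zs) = map ((\<otimes>\<^bsub>E\<^esub>) (h a)) (map h zs)"
    if "a \<in> carrier R" "set zs \<subseteq> carrier R" for a zs
    using that by (auto simp: subset_iff)
  have dbc: "set (map ((\<otimes>) d) bs) \<subseteq> carrier R" using bs(1) d by auto
  have e1: "map h (pfister_coeffs p R as @ map ((\<otimes>) d) bs)
      = pfister_coeffs p E (map h as) @ map ((\<otimes>\<^bsub>E\<^esub>) (h d)) (map h bs)"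
    unfolding map_append hmult[OF d bs(1)] using pf[OF as] by simp
  have e2: "E.Span ?E (map h (map \<phi> us)) = E.Span ?E (map h (pfister_coeffs p R as @ map ((\<otimes>) d) bs))"
    using us(2) im pc dbc by (intro tr(2) uc) simp_all
  have dim': "E.dimension m ?E (E.Span ?E
      (pfister_coeffs p E (map h as) @ map ((\<otimes>\<^bsub>E\<^esub>) (h d)) (map h bs)))"
    using dim unfolding e1 e2 .
  have ext: "E.finite_extension ?E (map h zs) = E.Span ?E (map h (pfister_coeffs p R zs))"
    if "set zs \<subseteq> carrier R" for zs
    using E.Span_pfister_coeffs[OF KE hc[OF that]] pf[OF that] by simp
  \<comment> \<open>Equality of generated fields is rewritten as equality of spans of Pfister
    coefficients, the kind of statement that passes to \<open>E\<close>.\<close>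
  have gen': "E.finite_extension ?E (map h as) = E.finite_extension ?E (map h ys @ map h xs)"
  proof -
    have "Span ?K (pfister_coeffs p R as) = Span ?K (pfister_coeffs p R (ys @ xs))"
      using Span_pfister_coeffs[OF K as] Span_pfister_coeffs[OF K c] gen by simp
    then have "E.Span ?E (map h (pfister_coeffs p R as)) = E.Span ?E (map h (pfister_coeffs p R (ys @ xs)))"
      using pf[OF c] by (intro tr(2) pc) simp_all
    then show ?thesis using ext[OF as] ext[OF c] by simp
  qed
  have "h b \<in> E.finite_extension ?E (map h as)"
    using tr(1)[OF pc] b(1) unfolding ext[OF as] Span_pfister_coeffs[OF K as] by blast
  moreover have bc: "b \<in> carrier R"
    using b(1) pbaseD(3)[OF pbase_finite_extension[OF K as]] by blast
  have "h b \<noteq> \<zero>\<^bsub>E\<^esub>"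
  proof
    assume "h b = \<zero>\<^bsub>E\<^esub>"
    moreover have bi: "b \<otimes> inv b = \<one>" "inv b \<in> carrier R" using bc b(2) field_Units by simp_all
    have "h (b \<otimes> inv b) = h b \<otimes>\<^bsub>E\<^esub> h (inv b)" using bc bi(2) by (rule h.hom_mult)
    ultimately show False using E.one_not_zero bi by simp
  qed
  moreover have "E.Span ?E (map h bs) = E.Span ?E (map ((\<otimes>\<^bsub>E\<^esub>) (h b)) (\<one>\<^bsub>E\<^esub> # map h xs))"
  proof -
    have xc: "set (\<one> # xs) \<subseteq> carrier R" using c by simp
    have "E.Span ?E (map h bs) = E.Span ?E (map h (map ((\<otimes>) b) (\<one> # xs)))"
      using xc bc by (intro tr(2) bs) auto
    then show ?thesis unfolding hmult[OF bc xc] by simp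
  qed
  ultimately have "\<exists>k l. m = p ^ k + l \<and> k \<le> length (map h as) \<and>
    (l = 0 \<or> 1 \<le> l \<and> k + Suc (length (map h xs)) \<le> length (map h as) + l \<and> l \<le> Suc (length (map h xs)) \<and> l \<le> p ^ k)"
    using c d len by (intro E.value_space_dimension[OF KE hc[OF as] _ _ gen' _ _ _ _ hc[OF bs(1)] _ dim']) auto
  then show ?thesis by simp
qed

theorem theorem4p11:
  fixes F :: "'a ring"
    and V :: "('a, 'v) module" and W :: "('a, 'w) module" and U :: "('a, 'u) module"
    and \<pi> :: "'v \<Rightarrow> 'a" and \<sigma> :: "'w \<Rightarrow> 'a" and \<phi> :: "'u \<Rightarrow> 'a"
    and p n :: nat and d :: 'a and m :: int
  assumes "field F" and "prime p" and "[p] \<cdot>\<^bsub>F\<^esub> \<one>\<^bsub>F\<^esub> = \<zero>\<^bsub>F\<^esub>"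
    and "quasilinear_form p F V \<pi>" and "quasi_pfister p F n V \<pi>"
    and "quasilinear_form p F W \<sigma>" and "subform F W \<sigma> V \<pi>"
    and "minimal_form p F W \<sigma>" and "vectorspace.dim F W \<ge> 2"
    and "d \<in> carrier F" and "d \<noteq> \<zero>\<^bsub>F\<^esub>"
    and "quasilinear_form p F U \<phi>"
    and "isometric F U \<phi> (direct_sum V W) (perp F \<pi> (\<lambda>w. d \<otimes>\<^bsub>F\<^esub> \<sigma> w))"
    and "anisotropic F U \<phi>"
  shows "(m \<in> int ` aniso_dims TYPE('a list) p F U \<phi> \<longleftrightarrow>
           (\<exists>(k :: nat) (l :: int). m = int p ^ k + l \<and>
              (k \<le> n \<and> l = 0 \<or>
               k \<le> n \<and> max 1 (int k - int n + int (vectorspace.dim F W)) \<le> l \<and>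
                 l \<le> min (int (vectorspace.dim F W)) (int p ^ k))))
       \<and> aniso_dims TYPE('e) p F U \<phi> \<subseteq> aniso_dims TYPE('a list) p F U \<phi>"
proof -
  interpret F: char_p_field F p
    using assms(1-3) by (simp add: char_p_field_def char_p_field_axioms_def)
  interpret U: quasilinear_form p F U \<phi> by (fact assms)
  interpret V: quasilinear_form p F V \<pi> by (fact assms)
  interpret W: quasilinear_form p F W \<sigma> by (fact assms)
  let ?K = "pth_powers p F"
  let ?s = "vectorspace.dim F W"
  note K = F.pbase_pth_powers
  have VW: "vectorspace F (direct_sum V W)"
    by (rule direct_sum_is_vs[OF V.vectorspace_axioms W.vectorspace_axioms])
  have anVW: "v = \<zero>\<^bsub>V\<^esub> \<and> w = \<zero>\<^bsub>W\<^esub>"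
    if "v \<in> carrier V" "w \<in> carrier W" "\<pi> v \<oplus>\<^bsub>F\<^esub> d \<otimes>\<^bsub>F\<^esub> \<sigma> w = \<zero>\<^bsub>F\<^esub>" for v w
  proof -
    have "(v, w) = \<zero>\<^bsub>direct_sum V W\<^esub>"
      using isometric_anisotropic[OF U.vectorspace_axioms VW assms(13,14)] that
      unfolding anisotropic_def by (simp add: direct_sum_def perp_def)
    then show ?thesis by (simp add: direct_sum_def)
  qed
  have pic: "\<pi> v \<in> carrier F" if "v \<in> carrier V" for v using Pi_mem[OF V.form_closed that] .
  have sic: "\<sigma> w \<in> carrier F" if "w \<in> carrier W" for w using Pi_mem[OF W.form_closed that] .
  have anV: "anisotropic F V \<pi>"
    unfolding anisotropic_def
  proof (intro ballI impI)
    fix v assume v: "v \<in> carrier V" "\<pi> v = \<zero>\<^bsub>F\<^esub>"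
    then show "v = \<zero>\<^bsub>V\<^esub>"
      using anVW[OF v(1) W.M.zero_closed] W.form_zero[OF F.p_gt_0] assms(10) by simp
  qed
  obtain as where as: "F.pindep ?K as" "length as = n" "\<pi> ` carrier V = F.finite_extension ?K as"
    using F.quasi_pfister_image[OF assms(4,5) anV] by blast
  obtain b bs xs ys where bs: "set bs \<subseteq> carrier F" "\<sigma> ` carrier W = F.Span ?K bs"
    and b: "b \<in> F.finite_extension ?K as" "b \<noteq> \<zero>\<^bsub>F\<^esub>"
    and sp: "F.Span ?K bs = F.Span ?K (map ((\<otimes>\<^bsub>F\<^esub>) b) (\<one>\<^bsub>F\<^esub> # xs))"
    and xy: "F.pindep ?K (ys @ xs)" "length (ys @ xs) = length as"
    and gen: "F.finite_extension ?K as = F.finite_extension ?K (ys @ xs)"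
    and s: "?s = Suc (length xs)"
    by (rule F.minimal_subform_image[OF assms(6-8) as(3,1)])
  have ac: "set as \<subseteq> carrier F" and xc: "set (ys @ xs) \<subseteq> carrier F"
    using as(1) xy(1) unfolding F.pindep_def by auto
  note pc = F.pfister_coeffs_in_carrier[OF ac]
  have dbc: "set (map ((\<otimes>\<^bsub>F\<^esub>) d) bs) \<subseteq> carrier F" using bs(1) assms(10) by auto
  let ?vs = "pfister_coeffs p F as @ map ((\<otimes>\<^bsub>F\<^esub>) d) bs"
  have im: "\<phi> ` carrier U = F.Span ?K ?vs"
  proof -
    have "\<phi> ` carrier U = (\<lambda>(v, w). \<pi> v \<oplus>\<^bsub>F\<^esub> d \<otimes>\<^bsub>F\<^esub> \<sigma> w) ` (carrier V \<times> carrier W)"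
      using isometric_image[OF assms(13)] by (simp add: direct_sum_def perp_def)
    also have "\<dots> = \<pi> ` carrier V <+>\<^bsub>F\<^esub> (\<otimes>\<^bsub>F\<^esub>) d ` (\<sigma> ` carrier W)"
      unfolding set_add_def' by (auto simp: image_iff)
    also have "\<dots> = F.Span ?K ?vs"
      using F.Span_append_eq_set_add[OF F.pth_powers_subfield pc dbc] as(3) bs(2)
        F.Span_pfister_coeffs[OF K ac] F.Span_scale[OF F.pth_powers_subfield assms(10) bs(1)] by simp
    finally show ?thesis .
  qed
  have vsc: "set ?vs \<subseteq> carrier F" using pc dbc by simp
  let ?P = "F.finite_extension ?K as"
  have P: "F.pbase ?P" using F.pbase_finite_extension[OF K ac] .
  have sP: "\<sigma> ` carrier W \<subseteq> ?P"
  proof -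
    obtain f where f: "f \<in> LinearCombinations.module_hom F W V" "\<And>w. w \<in> carrier W \<Longrightarrow> \<pi> (f w) = \<sigma> w"
      using assms(7) unfolding subform_def by blast
    show ?thesis
    proof (rule image_subsetI)
      fix w assume w: "w \<in> carrier W"
      then have "f w \<in> carrier V" using LinearCombinations.module_hom_closed[OF f(1)] by auto
      then show "\<sigma> w \<in> ?P" unfolding as(3)[symmetric] f(2)[OF w, symmetric] by (rule imageI)
    qed
  qed
  then have bsP: "set bs \<subseteq> ?P"
    using F.Span_base_incl[OF F.pth_powers_subfield bs(1)] bs(2) by simp
  \<comment> \<open>If \<open>d\<close> were in \<open>?P\<close>, then so would be - d b. As a
    value of \<pi> it would cancel d b, where b is a value of \<sigma>, and anisotropy would force b
    = 0.\<close>
  have dP: "d \<notin> ?P"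
  proof
    assume dP: "d \<in> ?P"
    have "b \<otimes>\<^bsub>F\<^esub> \<one>\<^bsub>F\<^esub> \<in> F.Span ?K (map ((\<otimes>\<^bsub>F\<^esub>) b) (\<one>\<^bsub>F\<^esub> # xs))"
    proof -
      have "set (map ((\<otimes>\<^bsub>F\<^esub>) b) (\<one>\<^bsub>F\<^esub> # xs)) \<subseteq> carrier F"
        using xc b(1) F.pbaseD(3)[OF P] by auto
      from subsetD[OF F.Span_base_incl[OF F.pth_powers_subfield this]] show ?thesis by simp
    qed
    then have b1: "b \<otimes>\<^bsub>F\<^esub> \<one>\<^bsub>F\<^esub> \<in> \<sigma> ` carrier W" unfolding bs(2) sp .
    have bc: "b \<in> carrier F" using b(1) F.pbaseD(3)[OF P] by blast
    have "b \<in> \<sigma> ` carrier W" using b1 unfolding F.r_one[OF bc] .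
    then obtain w where w: "w \<in> carrier W" "b = \<sigma> w" by blast
    have "\<ominus>\<^bsub>F\<^esub> (d \<otimes>\<^bsub>F\<^esub> b) \<in> ?P"
      using subringE(5,6)[OF F.pbaseD(2)[OF P]] dP b(1) by simp
    then have "\<ominus>\<^bsub>F\<^esub> (d \<otimes>\<^bsub>F\<^esub> b) \<in> \<pi> ` carrier V" unfolding as(3) .
    then obtain v where v: "v \<in> carrier V" "\<ominus>\<^bsub>F\<^esub> (d \<otimes>\<^bsub>F\<^esub> b) = \<pi> v" by blast
    have "\<pi> v \<oplus>\<^bsub>F\<^esub> d \<otimes>\<^bsub>F\<^esub> \<sigma> w = \<zero>\<^bsub>F\<^esub>"
      unfolding v(2)[symmetric] w(2)[symmetric] using bc assms(10) by (simp add: F.l_neg)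
    then have "w = \<zero>\<^bsub>W\<^esub>" using anVW[OF v(1) w(1)] by blast
    then show False using w(2) b(2) W.form_zero[OF F.p_gt_0] by metis
  qed
  \<comment> \<open>The case of \<open>'e\<close> serves the second conjunct: whatever is reached
    over an arbitrary carrier type satisfies the conditions, and \<open>real\<close> attains it in
    \<open>'a list\<close>.\<close>
  have nec: "\<exists>k l. m' = p ^ k + l \<and> k \<le> n \<and>
      (l = 0 \<or> 1 \<le> l \<and> k + ?s \<le> n + l \<and> l \<le> ?s \<and> l \<le> p ^ k)"
    if "m' \<in> aniso_dims TYPE('e) p F U \<phi> \<or> m' \<in> aniso_dims TYPE('a list) p F U \<phi>" for m'
    using that
  proof
    note nec = F.aniso_dims_necessary[OF assms(12) ac xc gen xy(2)[symmetric] b assms(10) bs(1) sp im,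
      unfolded as(2), folded s]
    show ?thesis if "m' \<in> aniso_dims TYPE('e) p F U \<phi>" using nec[OF that] .
    show ?thesis if "m' \<in> aniso_dims TYPE('a list) p F U \<phi>" using nec[OF that] .
  qed
  have real: "p ^ k + l \<in> aniso_dims TYPE('a list) p F U \<phi>"
    if k: "k \<le> n" and l: "l = 0 \<or> 1 \<le> l \<and> k + ?s \<le> n + l \<and> l \<le> ?s \<and> l \<le> p ^ k" for k l
  proof -
    have "\<exists>L. F.pbase L \<and> ?K \<subseteq> L \<and> F.dimension (p ^ k + l) L (F.Span L ?vs)"
    proof (cases "l = 0")
      case True
      then show ?thesis
        using F.exists_subfield_absorbing[OF K ac as(1) refl bsP assms(10) dP] k as(2) by simp
    next
      case False
      then show ?thesis
        using F.exists_subfield_direct[OF K ac xy(1) gen b bs(1) sp assms(10) dP, of k l] l k s xy(2) as(2)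
        by simp
    qed
    then obtain L where "F.pbase L" "F.dimension (p ^ k + l) L (F.Span L ?vs)" by blast
    then show ?thesis using F.subfield_dimension_realized[OF assms(12) _ im vsc] by blast
  qed
  have sub: "aniso_dims TYPE('e) p F U \<phi> \<subseteq> aniso_dims TYPE('a list) p F U \<phi>"
    using nec real by blast
  have "m \<in> int ` aniso_dims TYPE('a list) p F U \<phi> \<longleftrightarrow>
      (\<exists>k l. m = int (p ^ k + l) \<and> k \<le> n \<and>
        (l = 0 \<or> 1 \<le> l \<and> k + ?s \<le> n + l \<and> l \<le> ?s \<and> l \<le> p ^ k))"
    using nec real by blast
  also have "\<dots> \<longleftrightarrow> (\<exists>(k :: nat) (l :: int). m = int p ^ k + l \<and>
      (k \<le> n \<and> l = 0 \<or> k \<le> n \<and> max 1 (int k - int n + int ?s) \<le> l \<and> l \<le> min (int ?s) (int p ^ k)))"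
  \<comment> \<open>The inequality \<open>k + ?s \<le> n + l\<close> is the lower bound on l without
    a subtraction that natural numbers would truncate. Conversely, an integer l is nonnegative in
    both alternatives, so it comes from a natural number.\<close>
  proof (intro iffI; elim exE conjE)
    fix k l :: nat
    assume "m = int (p ^ k + l)" "k \<le> n" "l = 0 \<or> 1 \<le> l \<and> k + ?s \<le> n + l \<and> l \<le> ?s \<and> l \<le> p ^ k"
    moreover have "int l \<le> int p ^ k" if "l \<le> p ^ k" using that by (metis of_nat_le_iff of_nat_power)
    ultimately show "\<exists>(k :: nat) (l :: int). m = int p ^ k + l \<and>
      (k \<le> n \<and> l = 0 \<or> k \<le> n \<and> max 1 (int k - int n + int ?s) \<le> l \<and> l \<le> min (int ?s) (int p ^ k))"
      by (intro exI[of _ k] exI[of _ "int l"]) auto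
  next
    fix k :: nat and l :: int
    assume m: "m = int p ^ k + l"
      and kl: "k \<le> n \<and> l = 0 \<or> k \<le> n \<and> max 1 (int k - int n + int ?s) \<le> l \<and> l \<le> min (int ?s) (int p ^ k)"
    then obtain l' where l': "l = int l'" by (metis le_max_iff_disj linorder_not_le max.absorb2 nonneg_int_cases order.trans zero_le_one order_refl max.bounded_iff)
    have "l' \<le> p ^ k" if "int l' \<le> int p ^ k" using that by (metis of_nat_le_iff of_nat_power)
    then show "\<exists>k l. m = int (p ^ k + l) \<and> k \<le> n \<and>
        (l = 0 \<or> 1 \<le> l \<and> k + ?s \<le> n + l \<and> l \<le> ?s \<and> l \<le> p ^ k)"
      using m kl unfolding l' by (intro exI[of _ k] exI[of _ l']) auto
  qed
  finally show ?thesis using sub by blast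
qed

end
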